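(* Let $\phi:R_{a,b}\to\Omega_{a,b}$ and $\psi:R_{a',b'}\to\Omega_{a',b'}$ be biholomorphic maps onto domains of the upper half-plane $\mathbb{H}$ that extend homeomorphically to the boundaries. Let $f:\widetilde\Omega_{a,b}\to\widetilde\Omega_{a',b'}$ be a quasiconformal map in $\mathcal F_{\phi,\psi}$ such that $f_\ast\widetilde\rho_\phi=\widetilde\rho_\psi$, where $\widetilde\rho_\phi$ is the extremal density of $\widetilde\Gamma_\phi$ and $\widetilde\rho_\psi$ is the extremal density of $\widetilde\Gamma_\psi$. Suppose also that $\widetilde\rho_\phi=\Pi^\ast\rho_\phi$ and $\widetilde\rho_\psi=\Pi^\ast\rho_\psi$. Then there is a quasiconformal map $g:\Omega_{a,b}\to\Omega_{a',b'}$, sending homeomorphically the boundary components of $\Omega_{a,b}$ on the corresponding ones of $\Omega_{a',b'}$, such that $\Pi\circ f=g\circ\Pi$ and $g_\ast\rho_\phi=\rho_\psi$.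
   Context: The Heisenberg group $\mathbf{H}$ is $\mathbb{C}\times\mathbb{R}$ with law $(z,t)\ast(z',t')=(z+z',t+t'+2\Im(z\overline{z'}))$, norm $\|(z,t)\|=(|z|^4+t^2)^{1/4}$ and distance $d(p,q)=\|p^{-1}\ast q\|$. Set $Z=\partial_z+i\overline z\,\partial_t$, $\overline Z=\partial_{\overline z}-iz\,\partial_t$, $\omega=dt-i\overline z\,dz+iz\,d\overline z$. A homeomorphism $f$ between domains of $\mathbf{H}$ is quasiconformal if $H(p,f)=\limsup_{r\to0}\frac{\max_{d(p,q)=r}d(f(p),f(q))}{\min_{d(p,q)=r}d(f(p),f(q))}$ is uniformly bounded. Standing assumption: all quasiconformal maps (in $\mathbf{H}$ and in $\mathbb{C}$) are $C^2$ and orientation preserving, and all curves are $C^1$. Such a map $f=(f_1,f_2)$ of $\mathbf{H}$ is contact ($f^\ast\omega=\lambda\omega$, $\lambda$ a nowhere vanishing real function), and orientation preserving means $\overline Zf_1=\mu Zf_1$, $\overline Z(f_2+i|f_1|^2)=\mu Z(f_2+i|f_1|^2)$ for some $\mu\in L^\infty$ with $\|\mu\|_{L^\infty}<1$. A curve $\gamma=(\gamma_1,\gamma_2)$ in $\mathbf{H}$ is horizontal if $\dot\gamma_2=-2\Im(\overline{\gamma_1}\dot\gamma_1)$. For a family $\Gamma$ of horizontal curves in a domain $\Omega\subset\mathbf{H}$, $adm(\Gamma)$ is the set of measurable $\rho:\Omega\to[0,\infty]$ with $\int\rho(\gamma(s))|\dot\gamma_1(s)|ds\ge1$ for all $\gamma\in\Gamma$,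 and $M(\Gamma)=\inf_{\rho\in adm(\Gamma)}\int_\Omega\rho^4dL^3$; an element of $adm(\Gamma)$ attaining the infimum is an extremal density (essentially unique when it exists). $\Pi(z,t)=t+i|z|^2$, viewed as a map from $\mathbf{H}$ to $\mathbb{H}\cup\{\Im=0\}$. $R_{a,b}=\{w\in\mathbb{H}\mid0<\Re w<a,\ 0<\Im w<b\}$, identified with $]0,a[\times]0,b[$, with $a,b,a',b'>0$. $\widetilde\Omega_{a,b}=\Pi^{-1}(\Omega_{a,b})$, $\widetilde\Omega_{a',b'}=\Pi^{-1}(\Omega_{a',b'})$. $\Gamma_0$ (resp. $\Gamma_0'$) is the family of horizontal segments $s\mapsto s+iy$ in $R_{a,b}$ (resp. $R_{a',b'}$), with extremal density (for the planar 2-modulus) $\rho_0=\frac1a$ (resp. $\rho_0'=\frac1{a'}$). $\Gamma_\phi=\phi(\Gamma_0)$, $\Gamma_\psi=\psi(\Gamma_0')$; $\widetilde\Gamma_\phi$ (resp. $\widetilde\Gamma_\psi$) is the family of all horizontal curves in $\mathbf{H}$ projecting by $\Pi$ to curves of $\Gamma_\phi$ (resp. $\Gamma_\psi$). Push-forwards: in the plane $g_\ast\rho=\frac{\rho}{|\partial_wg|-|\partial_{\overline w}g|}\circ g^{-1}$; in $\mathbf{H}$ $f_\ast\widetilde\rho=\frac{\widetilde\rho}{|Zf_1|-|\overline Zf_1|}\circ f^{-1}$. Pull-back: $(\Pi^\ast\rho)(z,t)=2|z|\rho(t+i|z|^2)$. $\rho_\phi=\phi_\ast\rho_0$ and $\rho_\psi=\psi_\ast\rho_0'$.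 The boundary components of $\Omega_{a,b}$ are $\partial\Omega_{0,x}=\phi(\{0\}\times[0,b])$, $\partial\Omega_{a,x}=\phi(\{a\}\times[0,b])$, $\partial\Omega_{s,0}=\phi([0,a]\times\{0\})$, $\partial\Omega_{s,b}=\phi([0,a]\times\{b\})$; those of $\Omega_{a',b'}$ are, correspondingly, $\partial\Omega_{0',x}=\psi(\{0\}\times[0,b'])$, $\partial\Omega_{a',x}=\psi(\{a'\}\times[0,b'])$, $\partial\Omega_{s,0'}=\psi([0,a']\times\{0\})$, $\partial\Omega_{s,b'}=\psi([0,a']\times\{b'\})$. A tilde, $\partial\widetilde\Omega_{\bullet}$, denotes the preimage by $\Pi$ of $\partial\Omega_{\bullet}$. $\mathcal F_{\phi,\psi}$ is the set of all quasiconformal maps $f:\widetilde\Omega_{a,b}\to\widetilde\Omega_{a',b'}$ such that (for the boundary extension) $f(\partial\widetilde\Omega_{0,x})=\partial\widetilde\Omega_{0',x}$, $f(\partial\widetilde\Omega_{a,x})=\partial\widetilde\Omega_{a',x}$, $f(\partial\widetilde\Omega_{s,0})=\partial\widetilde\Omega_{s,0'}$ and $f(\partial\widetilde\Omega_{s,b})=\partial\widetilde\Omega_{s,b'}$. *)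

theory Defs
  imports "HOL-Analysis.Analysis"
begin

section \<open>The Heisenberg group\<close>

type_synonym heis = "complex \<times> real"

definition hmult :: "heis \<Rightarrow> heis \<Rightarrow> heis" where
  "hmult p q = (fst p + fst q, snd p + snd q + 2 * Im (fst p * cnj (fst q)))"

definition hinv :: "heis \<Rightarrow> heis" where
  "hinv p = (- fst p, - snd p)"

definition hnorm :: "heis \<Rightarrow> real" where
  "hnorm p = root 4 (cmod (fst p) ^ 4 + (snd p)\<^sup>2)"

definition hdist :: "heis \<Rightarrow> heis \<Rightarrow> real" where
  "hdist p q = hnorm (hmult (hinv p) q)"

text \<open>\<open>contact_form p v\<close> is the form $dt - i \bar z\,dz + i z\,d\bar z$ at the point \<open>p\<close>,
  evaluated on the tangent vector \<open>v\<close>.\<close>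

definition contact_form :: "heis \<Rightarrow> heis \<Rightarrow> complex" where
  "contact_form p v =
     complex_of_real (snd v) - \<i> * cnj (fst p) * fst v + \<i> * fst p * cnj (fst v)"

definition Zop :: "(heis \<Rightarrow> complex) \<Rightarrow> heis \<Rightarrow> complex" where
  "Zop h p = (let D = frechet_derivative h (at p) in
     (D (1, 0) - \<i> * D (\<i>, 0)) / 2 + \<i> * cnj (fst p) * D (0, 1))"

definition Zbar_op :: "(heis \<Rightarrow> complex) \<Rightarrow> heis \<Rightarrow> complex" where
  "Zbar_op h p = (let D = frechet_derivative h (at p) in
     (D (1, 0) + \<i> * D (\<i>, 0)) / 2 - \<i> * fst p * D (0, 1))"

definition Wirt :: "(complex \<Rightarrow> complex) \<Rightarrow> complex \<Rightarrow> complex" where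
  "Wirt g w = (let D = frechet_derivative g (at w) in (D 1 - \<i> * D \<i>) / 2)"

definition Wirt_bar :: "(complex \<Rightarrow> complex) \<Rightarrow> complex \<Rightarrow> complex" where
  "Wirt_bar g w = (let D = frechet_derivative g (at w) in (D 1 + \<i> * D \<i>) / 2)"

definition hproj :: "heis \<Rightarrow> complex" where
  "hproj p = Complex (snd p) ((cmod (fst p))\<^sup>2)"


section \<open>Quasiconformal maps\<close>

definition is_domain :: "'a::topological_space set \<Rightarrow> bool" where
  "is_domain S \<longleftrightarrow> open S \<and> connected S \<and> S \<noteq> {}"

definition C2_on ::
    "('a::real_normed_vector \<Rightarrow> 'b::real_normed_vector) \<Rightarrow> 'a set \<Rightarrow> bool" where
  "C2_on f S \<longleftrightarrow>
     (\<exists>(f' :: 'a \<Rightarrow> 'a \<Rightarrow>\<^sub>L 'b) (f'' :: 'a \<Rightarrow> 'a \<Rightarrow>\<^sub>L ('a \<Rightarrow>\<^sub>L 'b)).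
        (\<forall>x\<in>S. (f has_derivative blinfun_apply (f' x)) (at x)) \<and>
        (\<forall>x\<in>S. (f' has_derivative blinfun_apply (f'' x)) (at x)) \<and>
        continuous_on S f'')"

text \<open>The dilatation $H(p,f)$ with respect to a distance \<open>d\<close>. For an open set \<open>S\<close> and small \<open>r\<close>
  the whole sphere of radius \<open>r\<close> lies in \<open>S\<close>; the restriction to \<open>S\<close> only keeps
  the values of \<open>f\<close> outside its domain out of the definition.\<close>

definition dilatation ::
    "('a \<Rightarrow> 'a \<Rightarrow> real) \<Rightarrow> 'a set \<Rightarrow> ('a \<Rightarrow> 'a) \<Rightarrow> 'a \<Rightarrow> ennreal" where
  "dilatation d S f p = Limsup (at_right (0::real))
     (\<lambda>r. (SUP q\<in>{q\<in>S. d p q = r}. ennreal (d (f p) (f q))) /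
          (INF q\<in>{q\<in>S. d p q = r}. ennreal (d (f p) (f q))))"

definition metric_qc ::
    "('a::topological_space \<Rightarrow> 'a \<Rightarrow> real) \<Rightarrow> ('a \<Rightarrow> 'a) \<Rightarrow> 'a set \<Rightarrow> 'a set \<Rightarrow> bool" where
  "metric_qc d f S T \<longleftrightarrow> is_domain S \<and> is_domain T \<and> (\<exists>h. homeomorphism S T f h) \<and>
     (\<exists>K::real. \<forall>p\<in>S. dilatation d S f p \<le> ennreal K)"

definition contact_on :: "(heis \<Rightarrow> heis) \<Rightarrow> heis set \<Rightarrow> bool" where
  "contact_on f S \<longleftrightarrow>
     (\<exists>\<kappa>::heis \<Rightarrow> real. \<forall>p\<in>S. \<kappa> p \<noteq> 0 \<and>
        (\<forall>v. contact_form (f p) (frechet_derivative f (at p) v)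
              = complex_of_real (\<kappa> p) * contact_form p v))"

text \<open>A measurable Beltrami coefficient on \<open>S\<close> with essential supremum less than 1.\<close>

definition beltrami_coeff :: "('a::euclidean_space \<Rightarrow> complex) \<Rightarrow> 'a set \<Rightarrow> bool" where
  "beltrami_coeff \<mu> S \<longleftrightarrow> \<mu> \<in> borel_measurable (lebesgue_on S) \<and>
     (\<exists>k<1. AE p in lebesgue_on S. cmod (\<mu> p) \<le> k)"

text \<open>Note that \<open>hproj (f q)\<close> is $f_2 + i |f_1|^2$ at \<open>q\<close>.\<close>

definition orientation_preserving_H :: "(heis \<Rightarrow> heis) \<Rightarrow> heis set \<Rightarrow> bool" where
  "orientation_preserving_H f S \<longleftrightarrow>
     (\<exists>\<mu>. beltrami_coeff \<mu> S \<and>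
        (AE p in lebesgue_on S.
           Zbar_op (\<lambda>q. fst (f q)) p = \<mu> p * Zop (\<lambda>q. fst (f q)) p \<and>
           Zbar_op (\<lambda>q. hproj (f q)) p = \<mu> p * Zop (\<lambda>q. hproj (f q)) p))"

definition orientation_preserving_C :: "(complex \<Rightarrow> complex) \<Rightarrow> complex set \<Rightarrow> bool" where
  "orientation_preserving_C g S \<longleftrightarrow>
     (\<exists>\<mu>. beltrami_coeff \<mu> S \<and>
        (AE w in lebesgue_on S. Wirt_bar g w = \<mu> w * Wirt g w))"

text \<open>Quasiconformal maps are by convention $C^2$ and orientation preserving, and those of
  the Heisenberg group are contact transformations with nowhere vanishing conformal factor.\<close>

definition quasiconformal_H :: "(heis \<Rightarrow> heis) \<Rightarrow> heis set \<Rightarrow> heis set \<Rightarrow> bool" where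
  "quasiconformal_H f S T \<longleftrightarrow>
     metric_qc hdist f S T \<and> C2_on f S \<and> contact_on f S \<and> orientation_preserving_H f S"

definition quasiconformal_C ::
    "(complex \<Rightarrow> complex) \<Rightarrow> complex set \<Rightarrow> complex set \<Rightarrow> bool" where
  "quasiconformal_C g S T \<longleftrightarrow>
     metric_qc dist g S T \<and> C2_on g S \<and> orientation_preserving_C g S"


section \<open>Curve families and extremal densities\<close>

text \<open>A parametrized curve is a pair of a parameter interval and a function, of which only
  the values on the interval matter.\<close>

type_synonym 'a curve = "real set \<times> (real \<Rightarrow> 'a)"

definition horizontal_curve :: "heis curve \<Rightarrow> bool" where
  "horizontal_curve c \<longleftrightarrow> (case c of (I, \<gamma>) \<Rightarrow>
     \<gamma> C1_differentiable_on I \<and>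
     (\<forall>s\<in>I. snd (vector_derivative \<gamma> (at s))
              = - 2 * Im (cnj (fst (\<gamma> s)) * fst (vector_derivative \<gamma> (at s)))))"

definition horizontal_lifts :: "complex curve set \<Rightarrow> heis curve set" where
  "horizontal_lifts \<Gamma> =
     {(I, \<gamma>) | I \<gamma>. horizontal_curve (I, \<gamma>) \<and> (\<exists>c. (I, c) \<in> \<Gamma> \<and> (\<forall>s\<in>I. hproj (\<gamma> s) = c s))}"

definition adm :: "heis set \<Rightarrow> heis curve set \<Rightarrow> (heis \<Rightarrow> ennreal) set" where
  "adm \<Omega> \<Gamma> = {\<rho>. \<rho> \<in> borel_measurable (restrict_space borel \<Omega>) \<and>
     (\<forall>(I, \<gamma>)\<in>\<Gamma>.
        1 \<le> (\<integral>\<^sup>+ s\<in>I. (\<rho> (\<gamma> s) * ennreal (cmod (fst (vector_derivative \<gamma> (at s))))) \<partial>lborel))}"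

definition modulus :: "heis set \<Rightarrow> heis curve set \<Rightarrow> ennreal" where
  "modulus \<Omega> \<Gamma> = (INF \<rho>\<in>adm \<Omega> \<Gamma>. \<integral>\<^sup>+ p\<in>\<Omega>. (\<rho> p) ^ 4 \<partial>lborel)"

definition extremal_density ::
    "heis set \<Rightarrow> heis curve set \<Rightarrow> (heis \<Rightarrow> ennreal) \<Rightarrow> bool" where
  "extremal_density \<Omega> \<Gamma> \<rho> \<longleftrightarrow>
     \<rho> \<in> adm \<Omega> \<Gamma> \<and> (\<integral>\<^sup>+ p\<in>\<Omega>. (\<rho> p) ^ 4 \<partial>lborel) = modulus \<Omega> \<Gamma>"

definition pushforward_C ::
    "(complex \<Rightarrow> complex) \<Rightarrow> complex set \<Rightarrow> (complex \<Rightarrow> ennreal) \<Rightarrow> complex \<Rightarrow> ennreal" where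
  "pushforward_C g S \<rho> w = (let v = inv_into S g w in
     \<rho> v / ennreal (cmod (Wirt g v) - cmod (Wirt_bar g v)))"

definition pushforward_H ::
    "(heis \<Rightarrow> heis) \<Rightarrow> heis set \<Rightarrow> (heis \<Rightarrow> ennreal) \<Rightarrow> heis \<Rightarrow> ennreal" where
  "pushforward_H f S \<rho> q = (let p = inv_into S f q in
     \<rho> p / ennreal (cmod (Zop (\<lambda>r. fst (f r)) p) - cmod (Zbar_op (\<lambda>r. fst (f r)) p)))"

definition pullback_hproj :: "(complex \<Rightarrow> ennreal) \<Rightarrow> heis \<Rightarrow> ennreal" where
  "pullback_hproj \<rho> p = ennreal (2 * cmod (fst p)) * \<rho> (hproj p)"


section \<open>Conformal images of rectangles\<close>

definition upper_half_plane :: "complex set" where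
  "upper_half_plane = {w. 0 < Im w}"

definition rect :: "real \<Rightarrow> real \<Rightarrow> complex set" where
  "rect a b = {w. 0 < Re w \<and> Re w < a \<and> 0 < Im w \<and> Im w < b}"

definition left_side :: "real \<Rightarrow> real \<Rightarrow> complex set" where
  "left_side a b = {w. Re w = 0 \<and> 0 \<le> Im w \<and> Im w \<le> b}"

definition right_side :: "real \<Rightarrow> real \<Rightarrow> complex set" where
  "right_side a b = {w. Re w = a \<and> 0 \<le> Im w \<and> Im w \<le> b}"

definition bottom_side :: "real \<Rightarrow> real \<Rightarrow> complex set" where
  "bottom_side a b = {w. 0 \<le> Re w \<and> Re w \<le> a \<and> Im w = 0}"

definition top_side :: "real \<Rightarrow> real \<Rightarrow> complex set" where
  "top_side a b = {w. 0 \<le> Re w \<and> Re w \<le> a \<and> Im w = b}"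

definition biholomorphic :: "(complex \<Rightarrow> complex) \<Rightarrow> complex set \<Rightarrow> complex set \<Rightarrow> bool" where
  "biholomorphic \<phi> S T \<longleftrightarrow>
     \<phi> holomorphic_on S \<and> bij_betw \<phi> S T \<and> inv_into S \<phi> holomorphic_on T"

text \<open>The symbol \<open>\<phi>\<close> also denotes the homeomorphic extension to the closed rectangle.\<close>

definition rect_chart ::
    "(complex \<Rightarrow> complex) \<Rightarrow> real \<Rightarrow> real \<Rightarrow> complex set \<Rightarrow> bool" where
  "rect_chart \<phi> a b \<Omega> \<longleftrightarrow>
     is_domain \<Omega> \<and> \<Omega> \<subseteq> upper_half_plane \<and> biholomorphic \<phi> (rect a b) \<Omega> \<and>
     (\<exists>h. homeomorphism (closure (rect a b)) (closure \<Omega>) \<phi> h)"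

definition horizontal_segments :: "real \<Rightarrow> real \<Rightarrow> complex curve set" where
  "horizontal_segments a b = {({0<..<a}, \<lambda>s. Complex s y) | y. 0 < y \<and> y < b}"

definition image_family ::
    "(complex \<Rightarrow> complex) \<Rightarrow> complex curve set \<Rightarrow> complex curve set" where
  "image_family \<phi> \<Gamma> = {(I, \<phi> \<circ> c) | I c. (I, c) \<in> \<Gamma>}"

definition lifted_family ::
    "(complex \<Rightarrow> complex) \<Rightarrow> real \<Rightarrow> real \<Rightarrow> heis curve set" where
  "lifted_family \<phi> a b = horizontal_lifts (image_family \<phi> (horizontal_segments a b))"

text \<open>The density $\phi_*\rho_0$, where $\rho_0 = 1/a$ on the rectangle.\<close>

definition rect_density :: "(complex \<Rightarrow> complex) \<Rightarrow> real \<Rightarrow> real \<Rightarrow> complex \<Rightarrow> ennreal" where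
  "rect_density \<phi> a b = pushforward_C \<phi> (rect a b) (\<lambda>_. ennreal (1 / a))"

text \<open>The class of quasiconformal maps between the preimages of \<open>\<Omega>\<close> and \<open>\<Omega>'\<close> whose continuous
  extension \<open>F\<close> to the closure respects the four boundary components.\<close>

definition qc_class ::
    "(complex \<Rightarrow> complex) \<Rightarrow> real \<Rightarrow> real \<Rightarrow> complex set \<Rightarrow>
     (complex \<Rightarrow> complex) \<Rightarrow> real \<Rightarrow> real \<Rightarrow> complex set \<Rightarrow> (heis \<Rightarrow> heis) set" where
  "qc_class \<phi> a b \<Omega> \<psi> a' b' \<Omega>' =
     {f. quasiconformal_H f (hproj -` \<Omega>) (hproj -` \<Omega>') \<and>
         (\<exists>F. continuous_on (closure (hproj -` \<Omega>)) F \<and> (\<forall>p\<in>hproj -` \<Omega>. F p = f p) \<and>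
            F ` (hproj -` \<phi> ` left_side a b) = hproj -` \<psi> ` left_side a' b' \<and>
            F ` (hproj -` \<phi> ` right_side a b) = hproj -` \<psi> ` right_side a' b' \<and>
            F ` (hproj -` \<phi> ` bottom_side a b) = hproj -` \<psi> ` bottom_side a' b' \<and>
            F ` (hproj -` \<phi> ` top_side a b) = hproj -` \<psi> ` top_side a' b')}"

end

theory Submission
  imports Defs "HOL-Complex_Analysis.Complex_Analysis"
begin

text \<open>
  Write \<open>k = a' / a\<close>. The modulus of the lifted family is finite, so an extremal density can be compared
  with perturbations of it; moving mass between two squares at the same height shows that extremality of
  $\Pi^*\rho_\phi$ forces $|\phi'|^2 / (\Im \phi)^2$ to depend only on the height. This permits explicit
  coordinates \<open>E x y \<theta>\<close> on the lifted domain whose \<open>x\<close>-lines are the curves of the lifted family and in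
  which the contact planes are spanned by $\partial_x$ and $\partial_y + x\,c(y)\,\partial_\theta$.

  The equation $f_*\tilde\rho_\phi = \tilde\rho_\psi$ says that \<open>f\<close> stretches horizontal vectors at least
  by \<open>k\<close>, measured in the charts. Hence the preimage of a lifted horizontal segment has length at most
  \<open>a\<close>, while it joins two sides at distance \<open>a\<close>; so it is a lifted horizontal segment itself. Therefore
  \<open>f\<close> maps \<open>E x y \<theta>\<close> to \<open>E (k x) (h y \<theta>) \<theta>'\<close> with \<open>h\<close> and \<open>\<theta>'\<close> independent of \<open>x\<close>. The contact
  condition then is a polynomial identity in \<open>x\<close>, and its quadratic coefficient gives
  $\partial_\theta h = 0$. So \<open>f\<close> descends to $x + iy \mapsto kx + i\,h(y)$ in the charts, and the
  Beltrami equation bounds the derivative of \<open>h\<close> between \<open>k\<close> and a multiple of \<open>k\<close>.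
\<close>

section \<open>Measures of projections and of conformal images\<close>

text \<open>Multiply the pulled-back density by a factor \<open>m\<close> depending on the point of
  the rectangle. Its energy becomes a constant times the integral of \<open>m ^ 4 * J\<close> with
  \<open>J = (Im \<phi> / |\<phi>'|)\<^sup>2\<close>, whereas admissibility constrains only the
  integrals of \<open>m\<close> along horizontal lines. So \<open>m = 1\<close> can be minimal only
  if \<open>J\<close> is constant on each line. This constancy makes the phase of a lifted segment
  affine in \<open>x\<close>. Up to a non-zero factor the contact form is then
  \<open>x * exp (- 2 * ee y) dy + 2 d\<theta>\<close>, with the same shape in the target, where
  \<open>x\<close> becomes \<open>k * x\<close>. Preimages of segments are measured, not images: the
  quantity |A| - |B| in the push-forward is the least stretching of a horizontal vector, which
  bounds lengths of preimages from above. The length argument leaves open that the height of the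
  image varies along a fibre of the projection. That is the real obstacle to descending, and the
  place where the contact condition is indispensable.\<close>

lemma continuous_on_hproj [continuous_intros]: "continuous_on S hproj"
  unfolding hproj_def Complex_eq by (intro continuous_intros)

lemma hproj_measurable [measurable]: "hproj \<in> borel_measurable borel"
  using continuous_on_hproj by (rule borel_measurable_continuous_onI)

lemma hproj_sel [simp]: "Re (hproj p) = snd p" "Im (hproj p) = (cmod (fst p))\<^sup>2"
  by (simp_all add: hproj_def)

lemma borel_measurable_ennreal_continuous_on:
  fixes u :: "'a::topological_space \<Rightarrow> real"
  assumes "S \<in> sets borel" "continuous_on S u"
  shows "(\<lambda>x. ennreal (u x) * indicator S x) \<in> borel_measurable borel"
proof -
  have "(\<lambda>x. ennreal (indicator S x *\<^sub>R u x)) \<in> borel_measurable borel"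
    using borel_measurable_continuous_on_indicator[OF assms] by measurable
  also have "(\<lambda>x. ennreal (indicator S x *\<^sub>R u x)) = (\<lambda>x. ennreal (u x) * indicator S x)"
    by (auto simp: indicator_def)
  finally show ?thesis .
qed

lemma emeasure_lborel_complex_box:
  assumes "Re l \<le> Re u" "Im l \<le> Im u"
  shows "emeasure lborel (box l u) = ennreal ((Re u - Re l) * (Im u - Im l))"
  using assms by (subst emeasure_lborel_box) (auto simp: Basis_complex_def)

text \<open>The bounds concern the squared modulus, so the area is linear in them;
  \<open>max 0\<close> admits boxes that reach below the real axis.\<close>

lemma emeasure_lborel_annulus:
  "emeasure lborel {z::complex. l < (cmod z)\<^sup>2 \<and> (cmod z)\<^sup>2 < u} = ennreal (pi * (max 0 u - max 0 l))"
proof -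
  define A where "A = {z::complex. l < (cmod z)\<^sup>2 \<and> (cmod z)\<^sup>2 < u}"
  have disc: "emeasure lborel (ball (0::complex) (sqrt (max 0 u))) = ennreal (pi * max 0 u)"
    "emeasure lborel (cball (0::complex) (sqrt (max 0 l))) = ennreal (pi * max 0 l)"
    by (simp_all add: emeasure_ball emeasure_cball eval_unit_ball_vol)
  show ?thesis
  proof (cases "max 0 l < u")
    case False
    then have "u \<le> max 0 l" "u \<le> (cmod z)\<^sup>2 \<or> (cmod z)\<^sup>2 \<le> l" for z :: complex
      using zero_le_power2[of "cmod z"] by linarith+
    then have "A = {}"
      unfolding A_def by (auto simp: not_less[symmetric])
    with False show ?thesis
      unfolding A_def[symmetric] by (subst ennreal_neg) (auto simp: mult_nonneg_nonpos)
  next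
    case True
    have sub: "cball (0::complex) (sqrt (max 0 l)) \<subseteq> ball 0 (sqrt (max 0 u))"
      using True by (auto simp: le_less_trans real_sqrt_less_mono)
    have iff: "sqrt (max 0 l) < cmod z \<longleftrightarrow> max 0 l < (cmod z)\<^sup>2" "cmod z < sqrt (max 0 u) \<longleftrightarrow> (cmod z)\<^sup>2 < u" for z
      using real_sqrt_less_iff[of "max 0 l" "(cmod z)\<^sup>2"] real_sqrt_less_iff[of "(cmod z)\<^sup>2" "max 0 u"]
        zero_le_power2[of "cmod z"] True
      by (auto simp del: zero_le_power2 real_sqrt_less_iff)
    show ?thesis
    proof (cases "0 \<le> l")
      case True2: True
      have "A = ball 0 (sqrt (max 0 u)) - cball 0 (sqrt (max 0 l))"
      proof (rule set_eqI)
        fix z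
        have "z \<notin> cball 0 (sqrt (max 0 l)) \<longleftrightarrow> sqrt (max 0 l) < cmod z"
          by (simp add: not_le)
        then show "z \<in> A \<longleftrightarrow> z \<in> ball 0 (sqrt (max 0 u)) - cball 0 (sqrt (max 0 l))"
          unfolding Diff_iff iff mem_ball_0 using True2 by (auto simp: A_def)
      qed
      then have "emeasure lborel A = ennreal (pi * max 0 u) - ennreal (pi * max 0 l)"
        using disc sub by (simp add: emeasure_Diff)
      then show ?thesis
        by (simp add: A_def ennreal_minus right_diff_distrib)
    next
      case False
      have "A = ball 0 (sqrt (max 0 u))"
      proof -
        have "l < (cmod z)\<^sup>2" for z :: complex
          using False zero_le_power2[of "cmod z"] by linarith
        then show ?thesis
          using iff by (auto simp: A_def)
      qed
      then show ?thesis
        using disc False by (simp add: A_def)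
    qed
  qed
qed

text \<open>In polar coordinates Lebesgue measure on the group is $\frac12\,d(r^2)\,d\theta\,dt$.\<close>

lemma distr_hproj:
  "distr lborel borel hproj = density lborel (\<lambda>w. ennreal pi * indicator upper_half_plane w)"
proof (rule measure_eqI_generator_eq)
  let ?E = "range (\<lambda>(a, b). box a b::complex set)"
  have uhp [measurable]: "upper_half_plane \<in> sets borel"
    unfolding upper_half_plane_def by measurable
  have "open upper_half_plane"
    unfolding upper_half_plane_def by (simp add: open_halfspace_Im_gt)
  have eq: "emeasure (distr lborel borel hproj) (box l u) = ennreal (pi * (Re u - Re l) * (max 0 (Im u) - max 0 (Im l)))"
      "emeasure (density lborel (\<lambda>w. ennreal pi * indicator upper_half_plane w)) (box l u)
      = ennreal (pi * (Re u - Re l) * (max 0 (Im u) - max 0 (Im l)))"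
    if "Re l \<le> Re u" "Im l \<le> Im u" for l u
  proof -
    have "hproj -` box l u = {z. Im l < (cmod z)\<^sup>2 \<and> (cmod z)\<^sup>2 < Im u} \<times> {Re l<..<Re u}"
      by (auto simp: in_box_complex_iff)
    then have "emeasure (distr lborel borel hproj) (box l u) =
        emeasure (lborel \<Otimes>\<^sub>M lborel) ({z::complex. Im l < (cmod z)\<^sup>2 \<and> (cmod z)\<^sup>2 < Im u} \<times> {Re l<..<Re u})"
      by (simp add: emeasure_distr lborel_prod)
    also have "\<dots> = emeasure lborel {z::complex. Im l < (cmod z)\<^sup>2 \<and> (cmod z)\<^sup>2 < Im u} * emeasure lborel {Re l<..<Re u}"
      by (rule lborel.emeasure_pair_measure_Times) auto
    also have "\<dots> = ennreal (pi * (Re u - Re l) * (max 0 (Im u) - max 0 (Im l)))"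
      using that by (simp add: emeasure_lborel_annulus ennreal_mult[symmetric] mult_ac)
    finally show "emeasure (distr lborel borel hproj) (box l u) = ennreal (pi * (Re u - Re l) * (max 0 (Im u) - max 0 (Im l)))" .
    have "emeasure (density lborel (\<lambda>w. ennreal pi * indicator upper_half_plane w)) (box l u) =
        (\<integral>\<^sup>+ w. ennreal pi * indicator (box l u \<inter> upper_half_plane) w \<partial>lborel)"
      by (subst emeasure_density) (auto intro!: nn_integral_cong simp: indicator_def)
    also have "\<dots> = ennreal pi * emeasure lborel (box l u \<inter> upper_half_plane)"
      by (subst nn_integral_cmult_indicator) auto
    also have "box l u \<inter> upper_half_plane = box (Complex (Re l) (max 0 (Im l))) (Complex (Re u) (max 0 (Im u)))"
      by (auto simp: upper_half_plane_def in_box_complex_iff)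
    also have "ennreal pi * emeasure lborel \<dots> = ennreal (pi * (Re u - Re l) * (max 0 (Im u) - max 0 (Im l)))"
      using that by (subst emeasure_lborel_complex_box) (auto simp: ennreal_mult[symmetric] mult_ac)
    finally show "emeasure (density lborel (\<lambda>w. ennreal pi * indicator upper_half_plane w)) (box l u)
      = ennreal (pi * (Re u - Re l) * (max 0 (Im u) - max 0 (Im l)))" .
  qed
  show "Int_stable ?E"
    by (auto simp: Int_stable_def box_Int_box)
  show "?E \<subseteq> Pow UNIV" "sets (distr lborel borel hproj) = sigma_sets UNIV ?E"
    "sets (density lborel (\<lambda>w. ennreal pi * indicator upper_half_plane w)) = sigma_sets UNIV ?E"
    by (simp_all add: borel_eq_box)
  let ?A = "\<lambda>n::nat. box (- (real n *\<^sub>R One)) (real n *\<^sub>R One) :: complex set"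
  show "range ?A \<subseteq> ?E" "(\<Union>i. ?A i) = UNIV"
    unfolding UN_box_eq_UNIV by auto
  show "emeasure (distr lborel borel hproj) (?A i) \<noteq> \<infinity>" for i
    by (subst eq) (auto simp: Basis_complex_def)
  show "emeasure (distr lborel borel hproj) X =
      emeasure (density lborel (\<lambda>w. ennreal pi * indicator upper_half_plane w)) X" if "X \<in> ?E" for X
  proof -
    from that obtain l u where X: "X = box l u" by force
    show ?thesis
    proof (cases "Re l \<le> Re u \<and> Im l \<le> Im u")
      case False
      then have "X = {}" by (auto simp: X in_box_complex_iff)
      then show ?thesis by simp
    qed (simp add: X eq)
  qed
qed

lemma nn_integral_hproj:
  assumes [measurable]: "g \<in> borel_measurable borel" and "\<And>w. w \<notin> upper_half_plane \<Longrightarrow> g w = 0"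
  shows "(\<integral>\<^sup>+ p. g (hproj p) \<partial>lborel) = ennreal pi * (\<integral>\<^sup>+ w. g w \<partial>lborel)"
proof -
  have uhp [measurable]: "upper_half_plane \<in> sets borel"
    unfolding upper_half_plane_def by measurable
  have "(\<integral>\<^sup>+ p. g (hproj p) \<partial>lborel) = (\<integral>\<^sup>+ w. g w \<partial>distr lborel borel hproj)"
    by (subst nn_integral_distr) auto
  also have "\<dots> = (\<integral>\<^sup>+ w. (ennreal pi * indicator upper_half_plane w) * g w \<partial>lborel)"
    unfolding distr_hproj by (subst nn_integral_density) auto
  also have "\<dots> = (\<integral>\<^sup>+ w. ennreal pi * g w \<partial>lborel)"
    using assms(2) by (intro nn_integral_cong) (auto simp: indicator_def)
  finally show ?thesis by (simp add: nn_integral_cmult)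
qed

section \<open>Change of variables under injective holomorphic maps\<close>

definition vec_complex :: "real^2 \<Rightarrow> complex" where
  "vec_complex x = Complex (x $ 1) (x $ 2)"

definition complex_vec :: "complex \<Rightarrow> real^2" where
  "complex_vec z = vector [Re z, Im z]"

lemma vec_complex_inverse [simp]: "vec_complex (complex_vec z) = z" "complex_vec (vec_complex x) = x"
  by (auto simp: vec_complex_def complex_vec_def vector_def vec_eq_iff forall_2 complex_eq_iff)

lemma bounded_linear_vec_complex: "bounded_linear vec_complex"
  by (intro linear_conv_bounded_linear[THEN iffD1] linearI) (auto simp: vec_complex_def complex_eq_iff)

lemma bounded_linear_complex_vec: "bounded_linear complex_vec"
  by (intro linear_conv_bounded_linear[THEN iffD1] linearI)
     (auto simp: complex_vec_def vector_def vec_eq_iff forall_2)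

lemma continuous_on_vec_complex: "continuous_on S vec_complex"
  by (rule linear_continuous_on[OF bounded_linear_vec_complex])

lemma continuous_on_complex_vec: "continuous_on S complex_vec"
  by (rule linear_continuous_on[OF bounded_linear_complex_vec])

lemma distr_vec_complex: "distr lborel borel vec_complex = lborel"
proof (rule lborel_eqI[symmetric])
  fix l u :: complex
  assume le: "\<And>b. b \<in> Basis \<Longrightarrow> l \<bullet> b \<le> u \<bullet> b"
  then have le': "Re l \<le> Re u" "Im l \<le> Im u"
    using le[of 1] le[of \<i>] by (auto simp: Basis_complex_def)
  have "vec_complex -` box l u = box (complex_vec l) (complex_vec u)"
    by (auto simp: in_box_complex_iff vec_complex_def complex_vec_def mem_box_cart forall_2)
  moreover have [measurable]: "vec_complex \<in> borel_measurable borel"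
    by (rule borel_measurable_continuous_onI[OF continuous_on_vec_complex])
  ultimately have "emeasure (distr lborel borel vec_complex) (box l u) = emeasure lborel (box (complex_vec l) (complex_vec u))"
    by (simp add: emeasure_distr)
  also have "\<dots> = ennreal (measure lborel (cbox (complex_vec l) (complex_vec u)))"
    by (simp add: emeasure_lborel_box_eq emeasure_lborel_cbox_eq emeasure_eq_ennreal_measure[symmetric])
  also have "measure lborel (cbox (complex_vec l) (complex_vec u)) = (Re u - Re l) * (Im u - Im l)"
    using le' by (subst content_cbox_cart) (auto simp: interval_ne_empty_cart forall_2 complex_vec_def UNIV_2)
  also have "\<dots> = (\<Prod>b\<in>Basis. (u - l) \<bullet> b)"
    by (simp add: Basis_complex_def)
  finally show "emeasure (distr lborel borel vec_complex) (box l u) = (\<Prod>b\<in>Basis. (u - l) \<bullet> b)" .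
qed simp

text \<open>Multiplication by \<phi>' has determinant |\<phi>'|^2, so this is the change of
  variables transferred to \<open>real^2\<close>. Compactness of \<open>B\<close> makes the
  integrand continuous on a compact set, hence integrable.\<close>

lemma nn_integral_conformal_image:
  fixes \<phi> \<phi>' :: "complex \<Rightarrow> complex" and g :: "complex \<Rightarrow> real"
  assumes B: "compact B" and inj: "inj_on \<phi> B"
    and der: "\<And>\<zeta>. \<zeta> \<in> B \<Longrightarrow> (\<phi> has_field_derivative \<phi>' \<zeta>) (at \<zeta>)"
    and cont: "continuous_on B \<phi>'" and g: "continuous_on (\<phi> ` B) g"
    and nonneg: "\<And>w. w \<in> \<phi> ` B \<Longrightarrow> 0 \<le> g w"
  shows "(\<integral>\<^sup>+ w. ennreal (g w) * indicator (\<phi> ` B) w \<partial>lborel) =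
    (\<integral>\<^sup>+ \<zeta>. ennreal ((cmod (\<phi>' \<zeta>))\<^sup>2 * g (\<phi> \<zeta>)) * indicator B \<zeta> \<partial>lborel)"
proof -
  define S where "S = complex_vec ` B"
  define h where "h = complex_vec \<circ> \<phi> \<circ> vec_complex"
  define h' where "h' x = (\<lambda>v. complex_vec (\<phi>' (vec_complex x) * vec_complex v))" for x
  \<comment> \<open>Vector-valued, as required by the change-of-variables theorem; \<open>bl\<close>
    extracts the single component afterwards.\<close>
  define G :: "real^2 \<Rightarrow> real^1" where "G x = vec (g (vec_complex x))" for x
  define J where "J x = (cmod (\<phi>' (vec_complex x)))\<^sup>2" for x
  have S: "compact S"
    unfolding S_def using B continuous_on_complex_vec by (rule compact_continuous_image[rotated])
  have mem_S: "x \<in> S \<longleftrightarrow> vec_complex x \<in> B" for x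
    unfolding S_def by (metis image_iff vec_complex_inverse)
  have hS: "x \<in> h ` S \<longleftrightarrow> vec_complex x \<in> \<phi> ` B" for x
    unfolding S_def h_def by (auto simp: image_iff) (metis vec_complex_inverse)+
  have cont_\<phi>: "continuous_on B \<phi>"
    using der by (meson DERIV_continuous_on has_field_derivative_at_within)
  have derh: "(h has_derivative h' x) (at x within S)" if "x \<in> S" for x
  proof -
    have "(\<phi> has_derivative (*) (\<phi>' (vec_complex x))) (at (vec_complex x))"
      using der that by (auto simp: mem_S has_field_derivative_def)
    then have "(\<phi> \<circ> vec_complex has_derivative (*) (\<phi>' (vec_complex x)) \<circ> vec_complex) (at x)"
      by (intro diff_chain_at[OF bounded_linear_imp_has_derivative[OF bounded_linear_vec_complex]])
    then have "(complex_vec \<circ> (\<phi> \<circ> vec_complex) has_derivative complex_vec \<circ> ((*) (\<phi>' (vec_complex x)) \<circ> vec_complex)) (at x)"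
      by (rule diff_chain_at) (rule bounded_linear_imp_has_derivative[OF bounded_linear_complex_vec])
    then show ?thesis
      by (simp add: h_def h'_def o_def has_derivative_at_withinI)
  qed
  have inj_h: "inj_on h S"
    using inj by (auto simp: inj_on_def h_def mem_S) (metis vec_complex_inverse)
  have det: "\<bar>det (matrix (h' x))\<bar> = J x" for x
    by (simp add: h'_def J_def matrix_def det_2 complex_vec_def vec_complex_def axis_def cmod_def
        power2_eq_square)
  have cont_G: "continuous_on (h ` S) (\<lambda>x. g (vec_complex x))"
    by (rule continuous_on_compose2[OF g continuous_on_vec_complex]) (use hS in auto)
  have "compact (h ` S)"
    unfolding h_def using S by (intro compact_continuous_image continuous_on_compose
        continuous_on_complex_vec continuous_on_vec_complex)
      (use cont_\<phi> mem_S in \<open>auto elim!: continuous_on_subset\<close>)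
  then have G_int: "G absolutely_integrable_on h ` S"
  proof -
    have "continuous_on (h ` S) G"
      unfolding G_def vec_def using cont_G by (intro continuous_on_vec_lambda)
    then have "integrable lborel (\<lambda>x. indicator (h ` S) x *\<^sub>R G x)"
      using \<open>compact (h ` S)\<close> by (intro borel_integrable_compact)
    then show ?thesis
      unfolding set_integrable_def by (subst integrable_completion) (auto dest: borel_measurable_integrable)
  qed
  then have change: "(\<lambda>x. \<bar>det (matrix (h' x))\<bar> *\<^sub>R G (h x)) absolutely_integrable_on S"
      "integral S (\<lambda>x. \<bar>det (matrix (h' x))\<bar> *\<^sub>R G (h x)) = integral (h ` S) G"
    using has_absolute_integral_change_of_variables[of S h h' G "integral (h ` S) G"] S derh inj_h
    by (auto intro: lmeasurable_compact[THEN fmeasurableD])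
  define I where "I = integral (h ` S) G"
  have bl: "bounded_linear (\<lambda>x::real^1. x $ 1)"
    by (rule bounded_linear_vec_nth)
  have "(G has_integral I) (h ` S)"
    using G_int by (simp add: I_def set_lebesgue_integral_eq_integral(1) integrable_integral)
  from has_integral_linear[OF this bl]
  have int1: "((\<lambda>x. g (vec_complex x)) has_integral I $ 1) (h ` S)"
    by (simp add: o_def G_def)
  have "((\<lambda>x. \<bar>det (matrix (h' x))\<bar> *\<^sub>R G (h x)) has_integral I) S"
    using integrable_integral[OF set_lebesgue_integral_eq_integral(1)[OF change(1)]]
    unfolding change(2) I_def .
  from has_integral_linear[OF this bl]
  have int2: "((\<lambda>x. J x * g (\<phi> (vec_complex x))) has_integral I $ 1) S"
    by (simp add: o_def G_def det) (simp add: h_def)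
  have meas [measurable]: "vec_complex \<in> borel_measurable borel" "B \<in> sets borel" "\<phi> ` B \<in> sets borel"
    using B cont_\<phi> by (auto intro!: borel_compact compact_continuous_image
        borel_measurable_continuous_onI[OF continuous_on_vec_complex])
  have ind: "indicator (\<phi> ` B) (vec_complex x) = (indicator (h ` S) x :: ennreal)"
      "indicator B (vec_complex x) = (indicator S x :: ennreal)" for x
    using hS mem_S by (auto simp: indicator_def)
  have meas_g: "(\<lambda>w. ennreal (g w) * indicator (\<phi> ` B) w) \<in> borel_measurable borel"
    using meas(3) g by (rule borel_measurable_ennreal_continuous_on)
  have meas_f: "(\<lambda>\<zeta>. ennreal ((cmod (\<phi>' \<zeta>))\<^sup>2 * g (\<phi> \<zeta>)) * indicator B \<zeta>) \<in> borel_measurable borel"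
    by (intro borel_measurable_ennreal_continuous_on meas continuous_intros cont
        continuous_on_compose2[OF g] cont_\<phi>) auto
  have "(\<integral>\<^sup>+ w. ennreal (g w) * indicator (\<phi> ` B) w \<partial>lborel) =
      (\<integral>\<^sup>+ x. ennreal (g (vec_complex x)) * indicator (h ` S) x \<partial>lborel)"
    using meas_g by (subst distr_vec_complex[symmetric], subst nn_integral_distr) (auto simp: ind)
  also have "\<dots> = ennreal (I $ 1)"
    using hS nonneg int1 by (intro nn_integral_has_integral_lebesgue') auto
  also have "\<dots> = (\<integral>\<^sup>+ x. ennreal (J x * g (\<phi> (vec_complex x))) * indicator S x \<partial>lborel)"
    using mem_S nonneg int2 by (intro nn_integral_has_integral_lebesgue'[symmetric]) (auto simp: J_def)
  also have "\<dots> = (\<integral>\<^sup>+ \<zeta>. ennreal ((cmod (\<phi>' \<zeta>))\<^sup>2 * g (\<phi> \<zeta>)) * indicator B \<zeta> \<partial>lborel)"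
    using meas_f by (subst distr_vec_complex[symmetric], subst nn_integral_distr) (auto simp: ind J_def)
  finally show ?thesis .
qed

section \<open>Calculus on the Heisenberg group\<close>

lemma has_derivative_at_imp_continuous_on:
  assumes "\<And>x. x \<in> S \<Longrightarrow> (f has_derivative D x) (at x)"
  shows "continuous_on S f"
  by (rule has_derivative_continuous_on[OF has_derivative_at_withinI[OF assms]])

text \<open>The planar map will be \<open>hproj \<circ> f \<circ> hsection\<close>, so its
  regularity rests on this chain rule.\<close>

lemma C2_on_compose:
  assumes f: "C2_on f S" and g: "C2_on g T" and sub: "f ` S \<subseteq> T"
  shows "C2_on (g \<circ> f) S"
proof -
  obtain f' f'' where f': "\<And>x. x \<in> S \<Longrightarrow> (f has_derivative blinfun_apply (f' x)) (at x)"
    "\<And>x. x \<in> S \<Longrightarrow> (f' has_derivative blinfun_apply (f'' x)) (at x)" "continuous_on S f''"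
    using f unfolding C2_on_def by blast
  obtain g' g'' where g': "\<And>x. x \<in> T \<Longrightarrow> (g has_derivative blinfun_apply (g' x)) (at x)"
    "\<And>x. x \<in> T \<Longrightarrow> (g' has_derivative blinfun_apply (g'' x)) (at x)" "continuous_on T g''"
    using g unfolding C2_on_def by blast
  define h' where "h' x = g' (f x) o\<^sub>L f' x" for x
  note bb = bounded_bilinear_blinfun_compose
  \<comment> \<open>Product rule for the bilinear composition: one summand differentiates the outer
    derivative, the other the inner one.\<close>
  define h'' where "h'' x = (bounded_bilinear.prod_left (o\<^sub>L) (f' x) o\<^sub>L (g'' (f x) o\<^sub>L f' x)) +
      (bounded_bilinear.prod_right (o\<^sub>L) (g' (f x)) o\<^sub>L f'' x)" for x
  have cf: "continuous_on S f" "continuous_on S f'"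
    using has_derivative_at_imp_continuous_on[OF f'(1)] has_derivative_at_imp_continuous_on[OF f'(2)] by auto
  have cg: "continuous_on T g'"
    by (rule has_derivative_at_imp_continuous_on[OF g'(2)])
  have "(g \<circ> f has_derivative blinfun_apply (h' x)) (at x)" if "x \<in> S" for x
    using diff_chain_at[OF f'(1)[OF that] g'(1)] sub that
    by (auto simp: h'_def o_def blinfun_compose.rep_eq)
  moreover have "(h' has_derivative blinfun_apply (h'' x)) (at x)" if "x \<in> S" for x
  proof -
    have "(g' \<circ> f has_derivative blinfun_apply (g'' (f x)) \<circ> blinfun_apply (f' x)) (at x)"
      using diff_chain_at[OF f'(1)[OF that] g'(2)] sub that by auto
    then have "((\<lambda>x. g' (f x) o\<^sub>L f' x) has_derivative
        (\<lambda>v. (g' (f x) o\<^sub>L f'' x v) + (g'' (f x) (f' x v) o\<^sub>L f' x))) (at x)"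
      using f'(2)[OF that]
      by (intro bounded_bilinear.FDERIV[OF bounded_bilinear_blinfun_compose]) (auto simp: o_def)
    moreover have "(\<lambda>v. (g' (f x) o\<^sub>L f'' x v) + (g'' (f x) (f' x v) o\<^sub>L f' x)) = blinfun_apply (h'' x)"
      by (auto simp: h''_def fun_eq_iff blinfun.add_left bounded_bilinear.prod_left.rep_eq[OF bb]
          bounded_bilinear.prod_right.rep_eq[OF bb] intro!: blinfun_eqI)
    moreover have "h' = (\<lambda>x. g' (f x) o\<^sub>L f' x)"
      unfolding h'_def ..
    ultimately show ?thesis
      by simp
  qed
  moreover have "continuous_on S h''"
    unfolding h''_def using sub
    by (intro continuous_intros f'(3) cf continuous_on_compose2[OF g'(3) cf(1)]
        continuous_on_compose2[OF cg cf(1)]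
        bounded_linear.continuous_on[OF bounded_bilinear.bounded_linear_prod_left[OF bb]]
        bounded_linear.continuous_on[OF bounded_bilinear.bounded_linear_prod_right[OF bb]]) auto
  ultimately show ?thesis
    unfolding C2_on_def by blast
qed

lemma C2_on_bounded_linear:
  assumes "bounded_linear f"
  shows "C2_on f S"
proof -
  have "(f has_derivative blinfun_apply (Blinfun f)) (at x)" for x
    using assms by (simp add: bounded_linear_Blinfun_apply bounded_linear_imp_has_derivative)
  then show ?thesis
    unfolding C2_on_def by (intro exI[of _ "\<lambda>_. Blinfun f"] exI[of _ "\<lambda>_. 0"])
      (auto simp: zero_blinfun.rep_eq)
qed

lemma C2_on_add:
  assumes f: "C2_on f S" and g: "C2_on g S"
  shows "C2_on (\<lambda>x. f x + g x) S"
proof -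
  obtain f' f'' where f': "\<And>x. x \<in> S \<Longrightarrow> (f has_derivative blinfun_apply (f' x)) (at x)"
    "\<And>x. x \<in> S \<Longrightarrow> (f' has_derivative blinfun_apply (f'' x)) (at x)" "continuous_on S f''"
    using f unfolding C2_on_def by blast
  obtain g' g'' where g': "\<And>x. x \<in> S \<Longrightarrow> (g has_derivative blinfun_apply (g' x)) (at x)"
    "\<And>x. x \<in> S \<Longrightarrow> (g' has_derivative blinfun_apply (g'' x)) (at x)" "continuous_on S g''"
    using g unfolding C2_on_def by blast
  show ?thesis
    unfolding C2_on_def
    by (intro exI[of _ "\<lambda>x. f' x + g' x"] exI[of _ "\<lambda>x. f'' x + g'' x"] conjI ballI continuous_on_add f'(3) g'(3))
      (auto intro!: has_derivative_eq_rhs[OF has_derivative_add[OF f'(1) g'(1)]]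
        has_derivative_eq_rhs[OF has_derivative_add[OF f'(2) g'(2)]] simp: blinfun.add_left)
qed

lemma C2_on_imp_continuous_on:
  assumes "C2_on f S"
  shows "continuous_on S f"
proof -
  obtain f' where f': "\<And>x. x \<in> S \<Longrightarrow> (f has_derivative blinfun_apply (f' x)) (at x)"
    using assms unfolding C2_on_def by blast
  show ?thesis
    by (rule has_derivative_at_imp_continuous_on[OF f'])
qed

lemma C2_on_imp_has_derivative:
  assumes "C2_on f S" "x \<in> S"
  shows "(f has_derivative frechet_derivative f (at x)) (at x)"
  using assms unfolding C2_on_def by (metis differentiableI frechet_derivative_works)

lemma C2_on_imp_continuous_frechet_derivative:
  assumes "C2_on f S"
  shows "continuous_on S (\<lambda>x. frechet_derivative f (at x) v)"
proof -
  obtain f' f'' where f': "\<And>x. x \<in> S \<Longrightarrow> (f has_derivative blinfun_apply (f' x)) (at x)"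
    "\<And>x. x \<in> S \<Longrightarrow> (f' has_derivative blinfun_apply (f'' x)) (at x)"
    using assms unfolding C2_on_def by blast
  have "continuous_on S f'"
    by (rule has_derivative_at_imp_continuous_on[OF f'(2)])
  then have "continuous_on S (\<lambda>x. f' x v)"
    by (intro continuous_intros)
  moreover have "f' x v = frechet_derivative f (at x) v" if "x \<in> S" for x
    unfolding frechet_derivative_at[OF f'(1)[OF that], symmetric] ..
  ultimately show ?thesis
    by (simp cong: continuous_on_cong)
qed

lemma C2_on_norm_square: "C2_on (\<lambda>z::'a::real_inner. (norm z)\<^sup>2) S"
proof -
  define f' :: "'a \<Rightarrow> 'a \<Rightarrow>\<^sub>L real" where "f' z = 2 *\<^sub>R blinfun_inner_left z" for z
  define f'' :: "'a \<Rightarrow> 'a \<Rightarrow>\<^sub>L ('a \<Rightarrow>\<^sub>L real)" where "f'' z = 2 *\<^sub>R Blinfun blinfun_inner_left" for z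
  have bl: "bounded_linear (blinfun_inner_left :: 'a \<Rightarrow> _)"
    by (rule bounded_linear_blinfun_inner_left)
  have "((\<lambda>z. (norm z)\<^sup>2) has_derivative f' z) (at z)" for z
    unfolding power2_norm_eq_inner f'_def
    by (auto intro!: derivative_eq_intros simp: blinfun.scaleR_left inner_commute fun_eq_iff)
  moreover have "(f' has_derivative f'' z) (at z)" for z
    unfolding f'_def f''_def
    by (auto intro!: derivative_eq_intros bounded_linear_imp_has_derivative[OF bl] simp: blinfun.scaleR_left
        bounded_linear_Blinfun_apply[OF bl] fun_eq_iff)
  ultimately show ?thesis
    unfolding C2_on_def by (intro exI[of _ f'] exI[of _ f'']) (auto simp: f''_def)
qed

lemma C2_on_sqrt: "C2_on sqrt {0<..}"
proof -
  define f' where "f' x = blinfun_scaleR_left (inverse (sqrt x) / 2)" for x :: real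
  define f'' where "f'' x = blinfun_scaleR_left (blinfun_scaleR_left (- (inverse (sqrt x) ^ 3) / 4))" for x :: real
  show ?thesis
    unfolding C2_on_def
  proof (intro exI[of _ f'] exI[of _ f''] conjI ballI)
    fix x :: real assume x: "x \<in> {0<..}"
    then show "(sqrt has_derivative f' x) (at x)"
      by (auto intro!: derivative_eq_intros simp: f'_def fun_eq_iff)
    have "((\<lambda>x. inverse (sqrt x) / 2) has_derivative (\<lambda>v. v * (- (inverse (sqrt x) ^ 3) / 4))) (at x)"
      using x by (auto intro!: derivative_eq_intros simp: fun_eq_iff field_simps power3_eq_cube)
    from bounded_linear.has_derivative[OF bounded_linear_blinfun_scaleR_left this]
    show "(f' has_derivative f'' x) (at x)"
      unfolding f'_def
      by (rule has_derivative_eq_rhs) (auto simp: f''_def fun_eq_iff blinfun.scaleR_left intro!: blinfun_eqI)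
  next
    show "continuous_on {0<..} f''"
      unfolding f''_def by (intro continuous_intros bounded_linear.continuous_on[OF bounded_linear_blinfun_scaleR_left]) auto
  qed
qed

lemma C2_on_hproj: "C2_on hproj S"
proof -
  have "C2_on (\<lambda>p::heis. Complex (snd p) 0) S"
    by (intro C2_on_bounded_linear linear_conv_bounded_linear[THEN iffD1] linearI) (auto simp: complex_eq_iff)
  moreover have "C2_on ((\<lambda>x. Complex 0 x) \<circ> ((\<lambda>z. (norm z)\<^sup>2) \<circ> fst)) S"
    by (intro C2_on_compose[OF C2_on_compose[OF _ C2_on_norm_square[of UNIV]], of _ _ _ UNIV]
        C2_on_bounded_linear bounded_linear_fst linear_conv_bounded_linear[THEN iffD1] linearI) (auto simp: complex_eq_iff)
  ultimately have "C2_on (\<lambda>p. Complex (snd p) 0 + ((\<lambda>x. Complex 0 x) \<circ> ((\<lambda>z. (norm z)\<^sup>2) \<circ> fst)) p) S"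
    by (rule C2_on_add)
  also have "(\<lambda>p. Complex (snd p) 0 + ((\<lambda>x. Complex 0 x) \<circ> ((\<lambda>z. (norm z)\<^sup>2) \<circ> fst)) p) = hproj"
    by (auto simp: fun_eq_iff complex_eq_iff)
  finally show ?thesis .
qed

text \<open>The fibre over \<open>w\<close> is a circle of radius \<open>sqrt (Im w)\<close>; its
  positive real point gives a global C2 section over the upper half-plane.\<close>

definition hsection :: "complex \<Rightarrow> heis" where
  "hsection w = (of_real (sqrt (Im w)), Re w)"

lemma hproj_hsection: "w \<in> upper_half_plane \<Longrightarrow> hproj (hsection w) = w"
  by (auto simp: hsection_def upper_half_plane_def complex_eq_iff)

lemma C2_on_hsection: "C2_on hsection upper_half_plane"
proof -
  have "C2_on ((\<lambda>x. (complex_of_real x, 0::real)) \<circ> (sqrt \<circ> Im)) upper_half_plane"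
    by (rule C2_on_compose[OF C2_on_compose[OF _ C2_on_sqrt], of _ _ _ UNIV])
      (auto simp: upper_half_plane_def intro!: C2_on_bounded_linear bounded_linear_Im linear_conv_bounded_linear[THEN iffD1] linearI simp: scaleR_conv_of_real)
  moreover have "C2_on (\<lambda>w. (0::complex, Re w)) upper_half_plane"
    by (auto intro!: C2_on_bounded_linear linear_conv_bounded_linear[THEN iffD1] linearI)
  ultimately have "C2_on (\<lambda>w. ((\<lambda>x. (complex_of_real x, 0::real)) \<circ> (sqrt \<circ> Im)) w + (0, Re w)) upper_half_plane"
    by (rule C2_on_add)
  then show ?thesis
    by (simp add: hsection_def[abs_def])
qed

lemma has_vector_derivative_horizontal_line:
  assumes "(F has_field_derivative F') (at (Complex x y))"
  shows "((\<lambda>x. F (Complex x y)) has_vector_derivative F') (at x)"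
proof -
  have "((\<lambda>x. Complex x y) has_vector_derivative 1) (at x)"
    by (auto intro!: derivative_eq_intros simp: complex_eq_iff Complex_eq has_vector_derivative_def)
  from field_vector_diff_chain_at[OF this assms] show ?thesis
    by (simp add: o_def)
qed

lemma has_vector_derivative_vertical_line:
  assumes "(F has_field_derivative F') (at (Complex x y))"
  shows "((\<lambda>y. F (Complex x y)) has_vector_derivative \<i> * F') (at y)"
proof -
  have "((\<lambda>y. Complex x y) has_vector_derivative \<i>) (at y)"
    by (auto intro!: derivative_eq_intros simp: complex_eq_iff Complex_eq has_vector_derivative_def)
  from field_vector_diff_chain_at[OF this assms] show ?thesis
    by (simp add: o_def)
qed

lemmas Re_vector_derivative = bounded_linear.has_vector_derivative[OF bounded_linear_Re, folded has_real_derivative_iff_has_vector_derivative]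
lemmas Im_vector_derivative = bounded_linear.has_vector_derivative[OF bounded_linear_Im, folded has_real_derivative_iff_has_vector_derivative]

text \<open>A non-empty open set is not negligible. With continuity this turns relations assumed
  almost everywhere into pointwise ones.\<close>

lemma AE_lebesgue_on_open_ex:
  fixes S A :: "'a::euclidean_space set"
  assumes S: "open S" and A: "open A" "A \<subseteq> S" "A \<noteq> {}" and P: "AE x in lebesgue_on S. P x"
  shows "\<exists>x\<in>A. P x"
proof (rule ccontr)
  assume *: "\<not> (\<exists>x\<in>A. P x)"
  have "AE x in lebesgue. x \<in> S \<longrightarrow> P x"
    using P S by (subst (asm) AE_restrict_space_iff) auto
  then have "AE x in lebesgue. x \<notin> A"
    by eventually_elim (use * A in auto)
  then have "negligible A"
    using A by (simp add: negligible_iff_null_sets AE_iff_null_sets[of A] lmeasurable_open)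
  then show False
    using A open_not_negligible by blast
qed

section \<open>The contact form and horizontal vectors\<close>

lemma contact_form_eq:
  "contact_form p v = of_real (snd v + 2 * Im (cnj (fst p) * fst v))"
  by (simp add: contact_form_def complex_eq_iff algebra_simps)

lemma hproj_has_derivative:
  "(hproj has_derivative (\<lambda>v. Complex (snd v) (2 * Re (cnj (fst p) * fst v)))) (at p)"
proof -
  have "((\<lambda>p. of_real (snd p) + \<i> * of_real (fst p \<bullet> fst p)) has_derivative
      (\<lambda>v. Complex (snd v) (2 * Re (cnj (fst p) * fst v)))) (at p)"
    by (auto intro!: derivative_eq_intros simp: fun_eq_iff complex_eq_iff inner_complex_def algebra_simps)
  moreover have "(\<lambda>p. of_real (snd p) + \<i> * of_real (fst p \<bullet> fst p)) = hproj"
    by (auto simp: fun_eq_iff complex_eq_iff power2_norm_eq_inner)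
  ultimately show ?thesis by simp
qed

text \<open>The second component is the one forced by \<open>contact_form p v = 0\<close>, so a
  horizontal vector is encoded by its complex first component.\<close>

definition hor :: "heis \<Rightarrow> complex \<Rightarrow> heis" where
  "hor p \<zeta> = (\<zeta>, - 2 * Im (cnj (fst p) * \<zeta>))"

lemma fst_hor [simp]: "fst (hor p \<zeta>) = \<zeta>" and snd_hor [simp]: "snd (hor p \<zeta>) = - 2 * Im (cnj (fst p) * \<zeta>)"
  by (simp_all add: hor_def)

lemma contact_form_eq_0_iff: "contact_form p v = 0 \<longleftrightarrow> v = hor p (fst v)"
  by (auto simp: contact_form_eq hor_def prod_eq_iff simp del: of_real_add of_real_mult)

lemma hproj_derivative_hor:
  "Complex (snd (hor p \<zeta>)) (2 * Re (cnj (fst p) * fst (hor p \<zeta>))) = 2 * \<i> * cnj (fst p) * \<zeta>"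
  by (simp add: complex_eq_iff)

text \<open>As a vector, \<open>hor p \<zeta>\<close> is \<zeta> Z + cnj \<zeta> Zbar: the vertical
  parts of the two fields add up to \<open>- 2 * Im (cnj (fst p) * \<zeta>)\<close>.\<close>

lemma frechet_derivative_hor:
  assumes "(h has_derivative D) (at p)"
  shows "D (hor p \<zeta>) = Zop h p * \<zeta> + Zbar_op h p * cnj \<zeta>"
proof -
  interpret D: bounded_linear D
    using assms by (rule has_derivative_bounded_linear)
  have "hor p \<zeta> = Re \<zeta> *\<^sub>R (1, 0) + Im \<zeta> *\<^sub>R (\<i>, 0) + (- 2 * Im (cnj (fst p) * \<zeta>)) *\<^sub>R (0, 1)"
    by (simp add: hor_def complex_eq_iff)
  then have "D (hor p \<zeta>) = of_real (Re \<zeta>) * D (1, 0) + of_real (Im \<zeta>) * D (\<i>, 0)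
      + of_real (- 2 * Im (cnj (fst p) * \<zeta>)) * D (0, 1)"
    by (simp only: D.add D.scaleR scaleR_conv_of_real)
  moreover have "D = frechet_derivative h (at p)"
    using assms by (rule frechet_derivative_at)
  ultimately show ?thesis
    by (simp add: Zop_def Zbar_op_def Let_def complex_eq_iff field_simps)
qed

section \<open>Charts on rectangles and extremal densities\<close>

lemma rect_eq_box: "rect a b = box 0 (Complex a b)"
  by (auto simp: rect_def in_box_complex_iff)

lemma closure_rect: "0 < a \<Longrightarrow> 0 < b \<Longrightarrow> closure (rect a b) = cbox 0 (Complex a b)"
  unfolding rect_eq_box by (rule closure_box) (auto simp: box_ne_empty Basis_complex_def)

lemma open_rect: "open (rect a b)"
  unfolding rect_eq_box by (rule open_box)

lemma convex_rect: "convex (rect a b)"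
  unfolding rect_eq_box by (rule convex_box)

lemma upper_half_plane_measurable [measurable]: "upper_half_plane \<in> sets borel"
  unfolding upper_half_plane_def by measurable

locale rectangle_chart =
  fixes \<phi> :: "complex \<Rightarrow> complex" and a b :: real and \<Omega> :: "complex set"
  assumes a_pos: "0 < a" and b_pos: "0 < b" and chart: "rect_chart \<phi> a b \<Omega>"
begin

definition \<Phi> :: "complex \<Rightarrow> complex" where "\<Phi> = inv_into (rect a b) \<phi>"

lemma bij: "bij_betw \<phi> (rect a b) \<Omega>" and hol: "\<phi> holomorphic_on rect a b"
  and hol_inv: "\<Phi> holomorphic_on \<Omega>" and domain: "is_domain \<Omega>"
  and sub: "\<Omega> \<subseteq> upper_half_plane"
  using chart by (auto simp: rect_chart_def biholomorphic_def \<Phi>_def)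

lemma open_\<Omega>: "open \<Omega>"
  using domain by (simp add: is_domain_def)

lemma inj: "inj_on \<phi> (rect a b)"
  using bij by (rule bij_betw_imp_inj_on)

lemma image: "\<phi> ` rect a b = \<Omega>"
  using bij by (rule bij_betw_imp_surj_on)

lemma map_in [simp]: "\<zeta> \<in> rect a b \<Longrightarrow> \<phi> \<zeta> \<in> \<Omega>"
  using image by blast

lemma inv_in [simp]: "w \<in> \<Omega> \<Longrightarrow> \<Phi> w \<in> rect a b"
  unfolding \<Phi>_def using image inv_into_into by metis

lemma inv_map [simp]: "\<zeta> \<in> rect a b \<Longrightarrow> \<Phi> (\<phi> \<zeta>) = \<zeta>"
  unfolding \<Phi>_def using inj by (rule inv_into_f_f)

lemma map_inv [simp]: "w \<in> \<Omega> \<Longrightarrow> \<phi> (\<Phi> w) = w"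
  unfolding \<Phi>_def using image f_inv_into_f by metis

lemma Im_pos: "w \<in> \<Omega> \<Longrightarrow> 0 < Im w"
  using sub by (auto simp: upper_half_plane_def)

lemma has_deriv: "\<zeta> \<in> rect a b \<Longrightarrow> (\<phi> has_field_derivative deriv \<phi> \<zeta>) (at \<zeta>)"
  using holomorphic_derivI[OF hol open_rect] .

lemma deriv_nonzero: "\<zeta> \<in> rect a b \<Longrightarrow> deriv \<phi> \<zeta> \<noteq> 0"
  using holomorphic_injective_imp_regular[OF hol open_rect inj] .

lemma hol_deriv: "deriv \<phi> holomorphic_on rect a b"
  by (rule holomorphic_deriv[OF hol open_rect])

lemma has_deriv_inv:
  assumes w: "w \<in> \<Omega>"
  shows "(\<Phi> has_field_derivative inverse (deriv \<phi> (\<Phi> w))) (at w)"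
proof -
  have "(\<phi> has_field_derivative deriv \<phi> (\<Phi> w)) (at (\<Phi> w))"
    using has_deriv w by simp
  then show ?thesis
    using w deriv_nonzero open_rect hol
    by (intro has_field_derivative_inverse_strong_x[where f = \<phi> and g = \<Phi> and y = w and S = "rect a b"])
      (auto simp: holomorphic_on_imp_continuous_on)
qed

lemma continuous_inv: "continuous_on \<Omega> \<Phi>"
  using hol_inv by (rule holomorphic_on_imp_continuous_on)

lemma continuous_deriv: "continuous_on (rect a b) (deriv \<phi>)"
  using hol_deriv by (rule holomorphic_on_imp_continuous_on)

lemma continuous_deriv_inv: "continuous_on \<Omega> (\<lambda>w. deriv \<phi> (\<Phi> w))"
  using continuous_deriv continuous_inv by (rule continuous_on_compose2) auto

lemma homeo: obtains h where "homeomorphism (cbox 0 (Complex a b)) (closure \<Omega>) \<phi> h"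
  using chart a_pos b_pos by (auto simp: rect_chart_def closure_rect)

lemma inj_closed: "inj_on \<phi> (cbox 0 (Complex a b))"
  using homeo by (metis homeomorphism_def inj_on_inverseI)

lemma continuous_closed: "continuous_on (cbox 0 (Complex a b)) \<phi>"
  using homeo by (metis homeomorphism_def)

lemma image_closed: "\<phi> ` cbox 0 (Complex a b) = closure \<Omega>"
  using homeo by (metis homeomorphism_def)

lemma compact_closure: "compact (closure \<Omega>)"
  unfolding image_closed[symmetric] by (intro compact_continuous_image continuous_closed compact_cbox)

lemma boundary_notin: "\<zeta> \<in> cbox 0 (Complex a b) \<Longrightarrow> \<zeta> \<notin> rect a b \<Longrightarrow> \<phi> \<zeta> \<notin> \<Omega>"
proof
  assume \<zeta>: "\<zeta> \<in> cbox 0 (Complex a b)" "\<zeta> \<notin> rect a b" and "\<phi> \<zeta> \<in> \<Omega>"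
  then obtain \<xi> where \<xi>: "\<xi> \<in> rect a b" "\<phi> \<zeta> = \<phi> \<xi>"
    using image by blast
  then have "\<xi> \<in> cbox 0 (Complex a b)"
    unfolding rect_eq_box using box_subset_cbox by blast
  with \<zeta> \<xi> show False
    using inj_onD[OF inj_closed] by blast
qed

lemma open_lift: "open (hproj -` \<Omega>)"
  by (rule open_vimage[OF open_\<Omega> continuous_on_hproj])

lemma fst_nonzero: "hproj p \<in> \<Omega> \<Longrightarrow> fst p \<noteq> 0"
  using Im_pos[of "hproj p"] by auto

lemma bounded_lift: "bounded (hproj -` \<Omega>)"
proof -
  have "bounded \<Omega>"
    using compact_closure by (meson bounded_subset closure_subset compact_imp_bounded)
  then obtain B where B: "\<And>w. w \<in> \<Omega> \<Longrightarrow> cmod w \<le> B"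
    by (auto simp: bounded_iff)
  have "hproj -` \<Omega> \<subseteq> cball 0 (sqrt B) \<times> {-B..B}"
  proof (intro subsetI)
    fix p assume p: "p \<in> hproj -` \<Omega>"
    then have "\<bar>Re (hproj p)\<bar> \<le> B" "\<bar>Im (hproj p)\<bar> \<le> B"
      using B[of "hproj p"] abs_Re_le_cmod[of "hproj p"] abs_Im_le_cmod[of "hproj p"] by auto
    then show "p \<in> cball 0 (sqrt B) \<times> {-B..B}"
      by (cases p) (auto simp: real_le_rsqrt)
  qed
  then show ?thesis
    by (rule bounded_subset[rotated]) (intro bounded_Times bounded_cball bounded_closed_interval)
qed

lemma rect_density_eq:
  assumes "w \<in> \<Omega>"
  shows "rect_density \<phi> a b w = ennreal (1 / (a * cmod (deriv \<phi> (\<Phi> w))))"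
proof -
  have der: "(\<phi> has_derivative (*) (deriv \<phi> (\<Phi> w))) (at (\<Phi> w))"
    using has_deriv assms by (simp add: has_field_derivative_def)
  have "frechet_derivative \<phi> (at (\<Phi> w)) = (*) (deriv \<phi> (\<Phi> w))"
    using frechet_derivative_at[OF der] by simp
  then have "Wirt \<phi> (\<Phi> w) = deriv \<phi> (\<Phi> w)" "Wirt_bar \<phi> (\<Phi> w) = 0"
    by (auto simp: Wirt_def Wirt_bar_def Let_def algebra_simps)
  then show ?thesis
    using deriv_nonzero[of "\<Phi> w"] assms a_pos
    by (simp add: rect_density_def pushforward_C_def Let_def \<Phi>_def[symmetric] divide_ennreal mult.commute)
qed

text \<open>Times \<open>a\<close>, this is the factor by which the composition of
  \<open>hproj\<close> with the inverse chart \<Phi> scales horizontal vectors.\<close>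

definition dens :: "heis \<Rightarrow> real" where
  "dens p = 2 * cmod (fst p) / (a * cmod (deriv \<phi> (\<Phi> (hproj p))))"

lemma dens_nonneg [simp]: "0 \<le> dens p"
  using a_pos by (simp add: dens_def)

lemma pullback_eq: "hproj p \<in> \<Omega> \<Longrightarrow> pullback_hproj (rect_density \<phi> a b) p = ennreal (dens p)"
  by (simp add: pullback_hproj_def rect_density_eq dens_def ennreal_mult[symmetric] a_pos less_imp_le)

lemma continuous_dens: "continuous_on (hproj -` \<Omega>) dens"
proof -
  have "continuous_on (hproj -` \<Omega>) (\<lambda>p. deriv \<phi> (\<Phi> (hproj p)))"
    by (rule continuous_on_compose2[OF continuous_deriv_inv continuous_on_hproj]) auto
  then show ?thesis
    unfolding dens_def using a_pos deriv_nonzero by (intro continuous_intros) auto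
qed

text \<open>Differentiating the projection of a horizontal lift in two ways shows that the speed of
  its first coordinate is determined by the projected segment and the modulus of that
  coordinate.\<close>

lemma lifted_familyE:
  assumes "(I, \<gamma>) \<in> lifted_family \<phi> a b"
  obtains y where "0 < y" "y < b" "I = {0<..<a}"
    "\<And>s. s \<in> {0<..<a} \<Longrightarrow> hproj (\<gamma> s) = \<phi> (Complex s y)"
    "\<And>s. s \<in> {0<..<a} \<Longrightarrow> 2 * cmod (fst (\<gamma> s)) * cmod (fst (vector_derivative \<gamma> (at s))) = cmod (deriv \<phi> (Complex s y))"
proof -
  obtain y where y: "0 < y" "y < b" "I = {0<..<a}" "\<And>s. s \<in> I \<Longrightarrow> hproj (\<gamma> s) = \<phi> (Complex s y)"
    and hor: "horizontal_curve (I, \<gamma>)"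
    using assms by (auto simp: lifted_family_def horizontal_lifts_def image_family_def horizontal_segments_def)
  have "2 * cmod (fst (\<gamma> s)) * cmod (fst (vector_derivative \<gamma> (at s))) = cmod (deriv \<phi> (Complex s y))"
    if s: "s \<in> I" for s
  proof -
    define v where "v = vector_derivative \<gamma> (at s)"
    have v: "(\<gamma> has_vector_derivative v) (at s)"
      using hor s unfolding horizontal_curve_def C1_differentiable_on_eq v_def
      by (auto simp: vector_derivative_works)
    have "v = hor (\<gamma> s) (fst v)"
      using hor s by (auto simp: horizontal_curve_def hor_def v_def prod_eq_iff)
    with vector_derivative_diff_chain_within[of \<gamma> v s UNIV hproj, OF _ has_derivative_at_withinI[OF hproj_has_derivative]] v
    have 1: "((\<lambda>s. hproj (\<gamma> s)) has_vector_derivative 2 * \<i> * cnj (fst (\<gamma> s)) * fst v) (at s)"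
      by (metis (no_types, lifting) comp_def has_vector_derivative_eq_rhs hproj_derivative_hor ext)
    have "Complex s y \<in> rect a b"
      using s y by (auto simp: rect_def)
    from has_vector_derivative_horizontal_line[OF has_deriv[OF this]]
    have "((\<lambda>s. \<phi> (Complex s y)) has_vector_derivative deriv \<phi> (Complex s y)) (at s)" .
    moreover have "open I" using y by simp
    ultimately have 2: "((\<lambda>s. hproj (\<gamma> s)) has_vector_derivative deriv \<phi> (Complex s y)) (at s)"
      by (rule has_vector_derivative_transform_within_open) (use s y in auto)
    have "2 * \<i> * cnj (fst (\<gamma> s)) * fst v = deriv \<phi> (Complex s y)"
      using 1 2 by (rule vector_derivative_unique_at)
    then show ?thesis
      by (metis (no_types, opaque_lifting) complex_mod_cnj mult.right_neutral norm_ii norm_mult norm_numeral v_def)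
  qed
  with y show ?thesis by (auto intro!: that)
qed

text \<open>Images of the horizontal segments have diameter bounded below and the lifted domain is bounded, so
  a large constant density is admissible.\<close>

lemma modulus_finite: "modulus (hproj -` \<Omega>) (lifted_family \<phi> a b) < \<infinity>"
proof -
  \<comment> \<open>Interior abscissas keep the fundamental theorem of calculus inside the open
    rectangle, while \<open>y\<close> ranges over the closed interval so that the minimum of
    \<open>l\<close> exists and is positive by injectivity.\<close>
  define l where "l y = dist (\<phi> (Complex (a/4) y)) (\<phi> (Complex (3*a/4) y))" for y
  have "continuous_on {0..b} l"
    unfolding l_def Complex_eq
    by (intro continuous_intros continuous_on_compose2[OF continuous_closed])
      (use a_pos in \<open>auto simp: in_cbox_complex_iff\<close>)
  then obtain y0 where y0: "y0 \<in> {0..b}" "\<And>y. y \<in> {0..b} \<Longrightarrow> l y0 \<le> l y"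
    using continuous_attains_inf[of "{0..b}" l] b_pos by auto
  have "\<phi> (Complex (a/4) y0) \<noteq> \<phi> (Complex (3*a/4) y0)"
    using y0 a_pos inj_on_eq_iff[OF inj_closed, of "Complex (a/4) y0" "Complex (3*a/4) y0"]
    by (auto simp: in_cbox_complex_iff)
  then have l_pos: "0 < l y0"
    by (simp add: l_def)
  obtain B where B: "B > 0" "\<And>p. p \<in> hproj -` \<Omega> \<Longrightarrow> norm p \<le> B"
    using bounded_lift by (meson bounded_pos)
  \<comment> \<open>The speed identity and |z| \<le> B give |\<phi>'| \<le> 2 B times the speed of
    the lift, so this constant makes every line integral at least 1.\<close>
  define c where "c = 2 * B / l y0"
  have c: "0 < c" using B l_pos by (simp add: c_def)
  have adm: "(\<lambda>_. ennreal c) \<in> adm (hproj -` \<Omega>) (lifted_family \<phi> a b)"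
    unfolding adm_def
  proof (intro CollectI conjI ballI, simp, clarify)
    fix I \<gamma> assume "(I, \<gamma>) \<in> lifted_family \<phi> a b"
    from lifted_familyE[OF this] obtain y where y: "0 < y" "y < b" "I = {0<..<a}"
      "\<And>s. s \<in> {0<..<a} \<Longrightarrow> hproj (\<gamma> s) = \<phi> (Complex s y)"
      "\<And>s. s \<in> {0<..<a} \<Longrightarrow> 2 * cmod (fst (\<gamma> s)) * cmod (fst (vector_derivative \<gamma> (at s))) = cmod (deriv \<phi> (Complex s y))"
      by blast
    have R: "s \<in> {0<..<a} \<Longrightarrow> Complex s y \<in> rect a b" for s
      using y by (auto simp: rect_def)
    define S where "S = {a/4..3*a/4}"
    have S: "S \<subseteq> {0<..<a}" using a_pos by (auto simp: S_def)
    have der: "((\<lambda>s. \<phi> (Complex s y)) has_vector_derivative deriv \<phi> (Complex s y)) (at s within S)" if "s \<in> S" for s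
      by (rule has_vector_derivative_at_within[OF has_vector_derivative_horizontal_line[OF has_deriv[OF R]]])
        (use that S in auto)
    have "((\<lambda>s. deriv \<phi> (Complex s y)) has_integral (\<phi> (Complex (3*a/4) y) - \<phi> (Complex (a/4) y))) S"
      unfolding S_def using der a_pos by (intro fundamental_theorem_of_calculus) (auto simp: S_def)
    moreover have cont: "continuous_on S (\<lambda>s. cmod (deriv \<phi> (Complex s y)))"
      unfolding Complex_eq using R S
      by (intro continuous_intros continuous_on_compose2[OF continuous_deriv]) (auto simp: Complex_eq)
    then have int: "(\<lambda>s. cmod (deriv \<phi> (Complex s y))) integrable_on S"
      unfolding S_def by (rule integrable_continuous_interval)
    ultimately have "l y \<le> integral S (\<lambda>s. cmod (deriv \<phi> (Complex s y)))"
      unfolding l_def dist_norm norm_minus_commute[of "\<phi> (Complex (a/4) y)"]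
      by (metis (no_types, lifting) has_integral_iff integral_norm_bound_integral order_refl)
    moreover have "l y0 \<le> l y" using y0 y by auto
    ultimately have "1 \<le> integral S (\<lambda>s. cmod (deriv \<phi> (Complex s y))) / l y0"
      using l_pos by (simp add: field_simps)
    then have "1 \<le> ennreal (integral S (\<lambda>s. cmod (deriv \<phi> (Complex s y))) / l y0)"
      by (metis ennreal_1 ennreal_leI)
    also have "\<dots> = (\<integral>\<^sup>+ s. ennreal (cmod (deriv \<phi> (Complex s y)) / l y0) * indicator S s \<partial>lborel)"
      using l_pos int
      by (intro nn_integral_has_integral_lebesgue'[symmetric] has_integral_divide integrable_integral) auto
    also have "\<dots> \<le> (\<integral>\<^sup>+ s. ennreal c * ennreal (cmod (fst (vector_derivative \<gamma> (at s)))) * indicator I s \<partial>lborel)"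
    proof (intro nn_integral_mono)
      fix s
      show "ennreal (cmod (deriv \<phi> (Complex s y)) / l y0) * indicator S s
        \<le> ennreal c * ennreal (cmod (fst (vector_derivative \<gamma> (at s)))) * indicator I s"
      proof (cases "s \<in> S")
        case True
        then have s: "s \<in> {0<..<a}" using S by auto
        have "cmod (fst (\<gamma> s)) \<le> B"
          using B(2)[of "\<gamma> s"] norm_fst_le[of "fst (\<gamma> s)" "snd (\<gamma> s)"] y(4)[OF s] R[OF s] by simp
        then have "cmod (deriv \<phi> (Complex s y)) / l y0 \<le> c * cmod (fst (vector_derivative \<gamma> (at s)))"
        proof -
          have "cmod (deriv \<phi> (Complex s y)) \<le> 2 * B * cmod (fst (vector_derivative \<gamma> (at s)))"
            unfolding y(5)[OF s, symmetric] using \<open>cmod (fst (\<gamma> s)) \<le> B\<close> by (intro mult_right_mono) auto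
          then show ?thesis
            using l_pos by (simp add: c_def divide_right_mono)
        qed
        then show ?thesis
          using True s y(3) c by (simp add: ennreal_mult[symmetric] ennreal_leI)
      qed simp
    qed
    finally show "1 \<le> (\<integral>\<^sup>+ s\<in>I. (ennreal c * ennreal (cmod (fst (vector_derivative \<gamma> (at s))))) \<partial>lborel)" .
  qed
  have "modulus (hproj -` \<Omega>) (lifted_family \<phi> a b) \<le> (\<integral>\<^sup>+ p\<in>hproj -` \<Omega>. (ennreal c) ^ 4 \<partial>lborel)"
    unfolding modulus_def using adm by (rule INF_lower2) simp
  also have "\<dots> = ennreal c ^ 4 * emeasure lborel (hproj -` \<Omega>)"
    using open_lift by (subst nn_integral_cmult_indicator) auto
  also have "\<dots> < \<infinity>"
    using emeasure_bounded_finite[OF bounded_lift] c by (simp add: ennreal_mult_less_top ennreal_power less_imp_le)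
  finally show ?thesis .
qed

end

section \<open>Extremality and the weight along horizontal segments\<close>

context rectangle_chart
begin

text \<open>Its inverse square root is the density of the hyperbolic metric of the half-plane,
  pulled back by \<phi>. Up to a constant, \<open>J\<close> is also the energy density of the
  pulled-back density as seen in the rectangle.\<close>

definition J :: "complex \<Rightarrow> real" where
  "J \<zeta> = (Im (\<phi> \<zeta>) / cmod (deriv \<phi> \<zeta>))\<^sup>2"

lemma continuous_J: "continuous_on (rect a b) J"
  unfolding J_def using deriv_nonzero
  by (intro continuous_intros continuous_deriv holomorphic_on_imp_continuous_on[OF hol]) auto

lemma J_pos: "\<zeta> \<in> rect a b \<Longrightarrow> 0 < J \<zeta>"
  using Im_pos[of "\<phi> \<zeta>"] deriv_nonzero by (auto simp: J_def zero_less_power2)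

abbreviation J_mass :: "complex set \<Rightarrow> ennreal" where
  "J_mass X \<equiv> \<integral>\<^sup>+ \<eta>. ennreal (J \<eta>) * indicator X \<eta> \<partial>lborel"

text \<open>The fourth power of \<open>dens\<close> as a function of the projected point: the factor
  \<open>2 |z|\<close> becomes \<open>16 * (Im w)\<^sup>2\<close> because \<open>Im w\<close> is
  |z|^2.\<close>

definition G :: "complex \<Rightarrow> real" where
  "G w = 16 * (Im w)\<^sup>2 / (a * cmod (deriv \<phi> (\<Phi> w))) ^ 4"

lemma dens_power4: "dens p ^ 4 = G (hproj p)"
  by (simp add: dens_def G_def power_divide power_mult_distrib flip: power_mult)

lemma continuous_G: "continuous_on \<Omega> G"
  unfolding G_def using a_pos deriv_nonzero
  by (intro continuous_intros continuous_deriv_inv) auto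

lemma G_nonneg [simp]: "0 \<le> G w"
  using a_pos by (simp add: G_def)

lemma G_map: "\<zeta> \<in> rect a b \<Longrightarrow> (cmod (deriv \<phi> \<zeta>))\<^sup>2 * G (\<phi> \<zeta>) = 16 / a ^ 4 * J \<zeta>"
  using deriv_nonzero[of \<zeta>] a_pos
  by (simp add: G_def J_def field_simps eval_nat_numeral)

text \<open>The projection contributes the factor \<open>pi\<close>, and the Jacobian |\<phi>'|^2
  turns \<open>G\<close> into a multiple of \<open>J\<close>.\<close>

lemma nn_integral_G:
  assumes B: "compact B" "B \<subseteq> rect a b"
  shows "(\<integral>\<^sup>+ p. ennreal (G (hproj p)) * indicator (\<phi> ` B) (hproj p) \<partial>lborel) =
    ennreal (16 * pi / a ^ 4) * J_mass B"
proof -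
  have cont: "continuous_on B \<phi>"
    using hol B(2) by (meson continuous_on_subset holomorphic_on_imp_continuous_on)
  have sub_\<Omega>: "\<phi> ` B \<subseteq> \<Omega>" using B(2) image by blast
  have meas: "\<phi> ` B \<in> sets borel"
    using compact_continuous_image[OF cont B(1)] by (rule borel_compact)
  have cont_G: "continuous_on (\<phi> ` B) G"
    using continuous_G sub_\<Omega> by (rule continuous_on_subset)
  have "(\<lambda>w. ennreal (G w) * indicator (\<phi> ` B) w) \<in> borel_measurable borel"
    using meas cont_G by (rule borel_measurable_ennreal_continuous_on)
  then have "(\<integral>\<^sup>+ p. ennreal (G (hproj p)) * indicator (\<phi> ` B) (hproj p) \<partial>lborel) =
      ennreal pi * (\<integral>\<^sup>+ w. ennreal (G w) * indicator (\<phi> ` B) w \<partial>lborel)"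
    using sub_\<Omega> sub by (intro nn_integral_hproj[where g = "\<lambda>w. ennreal (G w) * indicator (\<phi> ` B) w"]) (auto simp: indicator_def)
  also have "(\<integral>\<^sup>+ w. ennreal (G w) * indicator (\<phi> ` B) w \<partial>lborel) =
      (\<integral>\<^sup>+ \<zeta>. ennreal ((cmod (deriv \<phi> \<zeta>))\<^sup>2 * G (\<phi> \<zeta>)) * indicator B \<zeta> \<partial>lborel)"
    using B inj_on_subset[OF inj B(2)] has_deriv continuous_on_subset[OF continuous_deriv B(2)] cont_G
    by (intro nn_integral_conformal_image) auto
  also have "\<dots> = (\<integral>\<^sup>+ \<zeta>. ennreal (16 / a ^ 4) * (ennreal (J \<zeta>) * indicator B \<zeta>) \<partial>lborel)"
    using B(2) G_map J_pos by (intro nn_integral_cong) (auto simp: indicator_def ennreal_mult[symmetric] less_imp_le)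
  also have "\<dots> = ennreal (16 / a ^ 4) * J_mass B"
  proof (rule nn_integral_cmult)
    show "(\<lambda>w. ennreal (J w) * indicator B w) \<in> borel_measurable lborel"
      using borel_measurable_ennreal_continuous_on[OF borel_compact[OF B(1)] continuous_on_subset[OF continuous_J B(2)]]
      by simp
  qed
  finally show ?thesis
    by (simp add: mult.assoc[symmetric] ennreal_mult[symmetric] ac_simps)
qed

definition square :: "complex \<Rightarrow> real \<Rightarrow> complex set" where
  "square \<zeta> r = cbox (\<zeta> - Complex r r) (\<zeta> + Complex r r)"

lemma mem_square: "\<xi> \<in> square \<zeta> r \<longleftrightarrow> \<bar>Re \<xi> - Re \<zeta>\<bar> \<le> r \<and> \<bar>Im \<xi> - Im \<zeta>\<bar> \<le> r"
  by (auto simp: square_def in_cbox_complex_iff)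

lemma emeasure_square: "0 \<le> r \<Longrightarrow> emeasure lborel (square \<zeta> r) = ennreal (4 * r\<^sup>2)"
  unfolding square_def by (subst emeasure_lborel_cbox) (auto simp: Basis_complex_def power2_eq_square)

lemma square_image_measurable:
  assumes "square \<eta> r \<subseteq> rect a b"
  shows "\<phi> ` square \<eta> r \<in> sets borel"
  using continuous_on_subset[OF holomorphic_on_imp_continuous_on[OF hol] assms]
  by (intro borel_compact compact_continuous_image) (auto simp: square_def)

definition shift_factor :: "complex set \<Rightarrow> complex set \<Rightarrow> real \<Rightarrow> complex \<Rightarrow> real" where
  "shift_factor A B e w = 1 + e * indicator (\<phi> ` A) w - e * indicator (\<phi> ` B) w"

text \<open>At equal height and size, a horizontal segment meets both squares in intervals of the
  same length or misses both. Gain and loss cancel, and the line integral stays equal to 1.\<close>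

lemma shift_factor_adm:
  assumes sq: "square \<zeta> r \<subseteq> rect a b" "square \<xi> r \<subseteq> rect a b" and Im: "Im \<zeta> = Im \<xi>" and r: "0 < r"
    and e: "0 \<le> e" "e \<le> 1"
  shows "(\<lambda>p. ennreal (dens p * shift_factor (square \<zeta> r) (square \<xi> r) e (hproj p)))
    \<in> adm (hproj -` \<Omega>) (lifted_family \<phi> a b)"
  unfolding adm_def
proof (intro CollectI conjI ballI, goal_cases)
  case 1
  have [measurable]: "dens \<in> borel_measurable (restrict_space borel (hproj -` \<Omega>))"
    using continuous_dens by (rule borel_measurable_continuous_on_restrict)
  have [measurable]: "hproj \<in> restrict_space borel (hproj -` \<Omega>) \<rightarrow>\<^sub>M borel"
    by (rule measurable_restrict_space1) simp
  have [measurable]: "shift_factor (square \<zeta> r) (square \<xi> r) e \<in> borel_measurable borel"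
    unfolding shift_factor_def using sq[THEN square_image_measurable] by measurable
  show ?case by measurable
next
  case (2 x)
  then obtain I \<gamma> where x: "x = (I, \<gamma>)" "(I, \<gamma>) \<in> lifted_family \<phi> a b" by (cases x) auto
  from lifted_familyE[OF this(2)] obtain y where y: "0 < y" "y < b" "I = {0<..<a}"
    "\<And>s. s \<in> {0<..<a} \<Longrightarrow> hproj (\<gamma> s) = \<phi> (Complex s y)"
    "\<And>s. s \<in> {0<..<a} \<Longrightarrow> 2 * cmod (fst (\<gamma> s)) * cmod (fst (vector_derivative \<gamma> (at s))) = cmod (deriv \<phi> (Complex s y))"
    by blast
  have R: "s \<in> {0<..<a} \<Longrightarrow> Complex s y \<in> rect a b" for s
    using y by (auto simp: rect_def)
  define m where "m s = shift_factor (square \<zeta> r) (square \<xi> r) e (\<phi> (Complex s y))" for s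
  define T where "T \<eta> = {s. Complex s y \<in> square \<eta> r}" for \<eta>
  have T_eq: "T \<eta> = (if \<bar>y - Im \<eta>\<bar> \<le> r then {Re \<eta> - r..Re \<eta> + r} else {})" for \<eta>
    by (auto simp: T_def mem_square)
  have T_sub: "T \<eta> \<subseteq> I" if "square \<eta> r \<subseteq> rect a b" for \<eta>
    using that y(3) by (auto simp: T_def rect_def)
  have m_eq: "m s = 1 + e * indicator (T \<zeta>) s - e * indicator (T \<xi>) s" if "s \<in> I" for s
  proof -
    have "\<phi> (Complex s y) \<in> \<phi> ` square \<eta> r \<longleftrightarrow> Complex s y \<in> square \<eta> r" if "square \<eta> r \<subseteq> rect a b" for \<eta>
      using inj_on_image_mem_iff[OF inj _ that] R \<open>s \<in> I\<close> y by auto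
    then show ?thesis
      using sq by (auto simp: m_def shift_factor_def T_def indicator_def)
  qed
  have m_nonneg: "0 \<le> m s" if "s \<in> I" for s
    using e m_eq[OF that] by (auto simp: indicator_def)
  have [measurable]: "T \<eta> \<in> sets borel" for \<eta>
    by (simp add: T_eq)
  have [measurable]: "I \<in> sets borel" using y by simp
  define N where "N = (\<integral>\<^sup>+ s. ennreal (m s / a) * indicator I s \<partial>lborel)"
  have part: "(\<integral>\<^sup>+ s. ennreal (e / a) * indicator (T \<eta>) s \<partial>lborel) = ennreal (e / a * (if \<bar>y - Im \<eta>\<bar> \<le> r then 2 * r else 0))" for \<eta>
    using r e a_pos by (subst nn_integral_cmult_indicator) (auto simp: T_eq ennreal_mult[symmetric])
  \<comment> \<open>The loss is added on the left instead of being subtracted on the right, because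
    subtraction of extended non-negative numbers truncates.\<close>
  have "(\<integral>\<^sup>+ s. ennreal (m s / a) * indicator I s + ennreal (e / a) * indicator (T \<xi>) s \<partial>lborel) =
      (\<integral>\<^sup>+ s. ennreal (1 / a) * indicator I s + ennreal (e / a) * indicator (T \<zeta>) s \<partial>lborel)"
    using T_sub sq e a_pos m_nonneg
    by (intro nn_integral_cong)
      (auto simp: m_eq indicator_def ennreal_plus[symmetric] add_divide_distrib[symmetric] simp del: ennreal_plus)
  moreover have "(\<lambda>s. ennreal (m s / a) * indicator I s) \<in> borel_measurable borel"
  proof -
    have "(\<lambda>s. ennreal ((1 + e * indicator (T \<zeta>) s - e * indicator (T \<xi>) s) / a) * indicator I s) \<in> borel_measurable borel"
      by measurable
    also have "(\<lambda>s. ennreal ((1 + e * indicator (T \<zeta>) s - e * indicator (T \<xi>) s) / a) * indicator I s) =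
        (\<lambda>s. ennreal (m s / a) * indicator I s)"
      using m_eq by (auto simp: fun_eq_iff indicator_def)
    finally show ?thesis .
  qed
  moreover have "(\<integral>\<^sup>+ s. ennreal (1 / a) * indicator I s \<partial>lborel) = 1"
    using a_pos y by (subst nn_integral_cmult_indicator) (auto simp: ennreal_mult[symmetric])
  ultimately have "N + (\<integral>\<^sup>+ s. ennreal (e / a) * indicator (T \<xi>) s \<partial>lborel) = 1 + (\<integral>\<^sup>+ s. ennreal (e / a) * indicator (T \<zeta>) s \<partial>lborel)"
    by (simp add: nn_integral_add N_def)
  then have "N = 1"
    unfolding part Im by (auto simp: add.commute[of _ "ennreal _"] ennreal_add_left_cancel)
  have "(\<integral>\<^sup>+ s\<in>I. (ennreal (dens (\<gamma> s) * shift_factor (square \<zeta> r) (square \<xi> r) e (hproj (\<gamma> s))) *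
      ennreal (cmod (fst (vector_derivative \<gamma> (at s))))) \<partial>lborel) = N"
    unfolding N_def
  proof (intro nn_integral_cong)
    fix s
    show "ennreal (dens (\<gamma> s) * shift_factor (square \<zeta> r) (square \<xi> r) e (hproj (\<gamma> s))) *
      ennreal (cmod (fst (vector_derivative \<gamma> (at s)))) * indicator I s = ennreal (m s / a) * indicator I s"
    proof (cases "s \<in> I")
      case True
      then have s: "s \<in> {0<..<a}" using y by simp
      have "dens (\<gamma> s) * cmod (fst (vector_derivative \<gamma> (at s))) = 1 / a"
        using y(5)[OF s] deriv_nonzero[OF R[OF s]] a_pos by (simp add: dens_def y(4)[OF s] R[OF s])
      then have "dens (\<gamma> s) * m s * cmod (fst (vector_derivative \<gamma> (at s))) = m s / a"
        by (simp add: field_simps)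
      then show ?thesis
        using True m_nonneg y(4)[OF s] by (simp add: m_def[symmetric] ennreal_mult[symmetric])
    qed simp
  qed
  then show ?case
    using x \<open>N = 1\<close> by simp
qed

text \<open>The perturbed density cannot have less energy than the extremal one, so the energy saved
  on the square at \<xi> is at most the energy added on the square at \<zeta>.\<close>

lemma extremal_squares:
  assumes ext: "extremal_density (hproj -` \<Omega>) (lifted_family \<phi> a b) \<rho>"
    and \<rho>: "AE p in lebesgue_on (hproj -` \<Omega>). \<rho> p = pullback_hproj (rect_density \<phi> a b) p"
    and sq: "square \<zeta> r \<subseteq> rect a b" "square \<xi> r \<subseteq> rect a b" and Im: "Im \<zeta> = Im \<xi>" and r: "0 < r"
    and e: "0 \<le> e" "e \<le> 1" and disj: "square \<zeta> r \<inter> square \<xi> r = {}"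
  shows "ennreal (1 - (1 - e) ^ 4) * J_mass (square \<xi> r) \<le>
    ennreal ((1 + e) ^ 4 - 1) * J_mass (square \<zeta> r)"
proof -
  let ?m = "shift_factor (square \<zeta> r) (square \<xi> r) e"
  define W where "W = hproj -` \<Omega>"
  define \<sigma> where "\<sigma> p = dens p * ?m (hproj p)" for p
  define X where "X = (\<integral>\<^sup>+ p. ennreal (G (hproj p)) * indicator W p \<partial>lborel)"
  define Y where "Y \<eta> = (\<integral>\<^sup>+ p. ennreal (G (hproj p)) * indicator (\<phi> ` square \<eta> r) (hproj p) \<partial>lborel)" for \<eta>
  have W [measurable]: "W \<in> sets borel" unfolding W_def using open_lift by simp
  have "AE p in lebesgue. p \<in> W \<longrightarrow> \<rho> p = pullback_hproj (rect_density \<phi> a b) p"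
    using \<rho> W unfolding W_def by (subst (asm) AE_restrict_space_iff) auto
  then have "AE p in lborel. p \<in> W \<longrightarrow> \<rho> p = pullback_hproj (rect_density \<phi> a b) p"
    by (simp add: AE_completion_iff)
  then have "AE p in lborel. \<rho> p ^ 4 * indicator W p = ennreal (G (hproj p)) * indicator W p"
    by eventually_elim (auto simp: indicator_def W_def pullback_eq dens_power4[symmetric] ennreal_power)
  then have X: "modulus W (lifted_family \<phi> a b) = X"
    using ext nn_integral_cong_AE[of "\<lambda>p. \<rho> p ^ 4 * indicator W p" "\<lambda>p. ennreal (G (hproj p)) * indicator W p" lborel]
    by (simp add: extremal_density_def X_def W_def)
  have "modulus W (lifted_family \<phi> a b) \<le> (\<integral>\<^sup>+ p. ennreal (\<sigma> p) ^ 4 * indicator W p \<partial>lborel)"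
    unfolding modulus_def using shift_factor_adm[OF sq Im r e]
    by (intro INF_lower) (simp add: W_def \<sigma>_def[abs_def])
  then have le: "X \<le> (\<integral>\<^sup>+ p. ennreal (\<sigma> p) ^ 4 * indicator W p \<partial>lborel)"
    unfolding X .
  have meas_G: "(\<lambda>p. ennreal (G (hproj p)) * indicator W p) \<in> borel_measurable borel"
    using W unfolding W_def
    by (intro borel_measurable_ennreal_continuous_on continuous_on_compose2[OF continuous_G continuous_on_hproj]) auto
  have meas_B: "(\<lambda>p. ennreal (G (hproj p)) * indicator (\<phi> ` square \<eta> r) (hproj p)) \<in> borel_measurable borel"
    if "square \<eta> r \<subseteq> rect a b" for \<eta>
  proof -
    have "(\<lambda>p. (ennreal (G (hproj p)) * indicator W p) * indicator (\<phi> ` square \<eta> r) (hproj p)) \<in> borel_measurable borel"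
      using meas_G square_image_measurable[OF that] by measurable
    also have "(\<lambda>p. (ennreal (G (hproj p)) * indicator W p) * indicator (\<phi> ` square \<eta> r) (hproj p)) =
        (\<lambda>p. ennreal (G (hproj p)) * indicator (\<phi> ` square \<eta> r) (hproj p))"
      using that by (auto simp: fun_eq_iff indicator_def W_def)
    finally show ?thesis .
  qed
  have disj': "\<not> (w \<in> \<phi> ` square \<zeta> r \<and> w \<in> \<phi> ` square \<xi> r)" for w
    using inj_on_image_Int[OF inj sq] disj by auto
  \<comment> \<open>Pointwise energy balance, again arranged with sums only: the saving stands on
    the left, the extra energy on the right.\<close>
  have pw: "ennreal (\<sigma> p) ^ 4 * indicator W p +
      ennreal (1 - (1 - e) ^ 4) * (ennreal (G (hproj p)) * indicator (\<phi> ` square \<xi> r) (hproj p)) =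
    ennreal (G (hproj p)) * indicator W p +
      ennreal ((1 + e) ^ 4 - 1) * (ennreal (G (hproj p)) * indicator (\<phi> ` square \<zeta> r) (hproj p))" for p
  proof (cases "p \<in> W")
    case False
    then have "hproj p \<notin> \<phi> ` square \<xi> r" "hproj p \<notin> \<phi> ` square \<zeta> r"
      using sq by (auto simp: W_def)
    then show ?thesis using False by simp
  next
    case True
    have e4: "(1 - e) ^ 4 \<le> 1" "1 \<le> (1 + e) ^ 4"
      using e by (auto intro: power_le_one one_le_power)
    have sf: "0 \<le> ?m w" for w
      using e by (auto simp: shift_factor_def indicator_def)
    have \<sigma>4: "ennreal (\<sigma> p) ^ 4 = ennreal (G (hproj p) * ?m (hproj p) ^ 4)"
      using sf by (simp add: \<sigma>_def ennreal_power power_mult_distrib dens_power4)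
    consider "hproj p \<in> \<phi> ` square \<zeta> r" "hproj p \<notin> \<phi> ` square \<xi> r"
      | "hproj p \<notin> \<phi> ` square \<zeta> r" "hproj p \<in> \<phi> ` square \<xi> r"
      | "hproj p \<notin> \<phi> ` square \<zeta> r" "hproj p \<notin> \<phi> ` square \<xi> r"
      using disj' by blast
    moreover have "0 \<le> G (hproj p) * (1 + e) ^ 4 - G (hproj p)" "0 \<le> G (hproj p) - G (hproj p) * (1 - e) ^ 4"
      "0 \<le> G (hproj p) * (1 - e) ^ 4"
      using mult_left_mono[OF e4(1), of "G (hproj p)"] mult_left_mono[OF e4(2), of "G (hproj p)"] e by auto
    ultimately show ?thesis
      using True e e4 unfolding \<sigma>4
      by cases (simp_all add: shift_factor_def ennreal_mult[symmetric] ennreal_plus[symmetric] algebra_simps del: ennreal_plus)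
  qed
  have meas_\<sigma>: "(\<lambda>p. ennreal (\<sigma> p) ^ 4 * indicator W p) \<in> borel_measurable borel"
  proof -
    have "(\<lambda>p. ennreal (G (hproj p)) * indicator W p * ennreal (?m (hproj p) ^ 4)) \<in> borel_measurable borel"
      unfolding shift_factor_def using meas_G sq[THEN square_image_measurable] by measurable
    also have "(\<lambda>p. ennreal (G (hproj p)) * indicator W p * ennreal (?m (hproj p) ^ 4)) =
        (\<lambda>p. ennreal (\<sigma> p) ^ 4 * indicator W p)"
    proof
      fix p
      have sf: "0 \<le> ?m w" for w
        using e by (auto simp: shift_factor_def indicator_def)
      then show "ennreal (G (hproj p)) * indicator W p * ennreal (?m (hproj p) ^ 4) =
          ennreal (\<sigma> p) ^ 4 * indicator W p"
        by (simp add: \<sigma>_def ennreal_power power_mult_distrib dens_power4 ennreal_mult mult_ac)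
    qed
    finally show ?thesis .
  qed
  have "(\<integral>\<^sup>+ p. ennreal (\<sigma> p) ^ 4 * indicator W p \<partial>lborel) + ennreal (1 - (1 - e) ^ 4) * Y \<xi> =
      (\<integral>\<^sup>+ p. ennreal (\<sigma> p) ^ 4 * indicator W p +
      ennreal (1 - (1 - e) ^ 4) * (ennreal (G (hproj p)) * indicator (\<phi> ` square \<xi> r) (hproj p)) \<partial>lborel)"
    unfolding Y_def using meas_\<sigma> meas_B[OF sq(2)] by (simp add: nn_integral_add nn_integral_cmult)
  also have "\<dots> = X + ennreal ((1 + e) ^ 4 - 1) * Y \<zeta>"
    unfolding pw Y_def X_def using meas_G meas_B[OF sq(1)] by (simp add: nn_integral_add nn_integral_cmult)
  finally have "(\<integral>\<^sup>+ p. ennreal (\<sigma> p) ^ 4 * indicator W p \<partial>lborel) + ennreal (1 - (1 - e) ^ 4) * Y \<xi> =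
    X + ennreal ((1 + e) ^ 4 - 1) * Y \<zeta>" .
  then have "X + ennreal (1 - (1 - e) ^ 4) * Y \<xi> \<le> X + ennreal ((1 + e) ^ 4 - 1) * Y \<zeta>"
    using add_right_mono[OF le] by (rule ord_le_eq_trans[rotated])
  \<comment> \<open>Finiteness of the modulus is what permits cancelling \<open>X\<close>.\<close>
  moreover have "X < \<infinity>"
    using modulus_finite X by (simp add: W_def)
  ultimately have "ennreal (1 - (1 - e) ^ 4) * Y \<xi> \<le> ennreal ((1 + e) ^ 4 - 1) * Y \<zeta>"
    by (auto simp: ennreal_add_left_cancel_le)
  moreover have "Y \<eta> = ennreal (16 * pi / a ^ 4) * J_mass (square \<eta> r)"
    if "square \<eta> r \<subseteq> rect a b" for \<eta>
    unfolding Y_def using that by (intro nn_integral_G) (auto simp: square_def)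
  ultimately have "ennreal (16 * pi / a ^ 4) * (ennreal (1 - (1 - e) ^ 4) * J_mass (square \<xi> r))
    \<le> ennreal (16 * pi / a ^ 4) * (ennreal ((1 + e) ^ 4 - 1) * J_mass (square \<zeta> r))"
    using sq by (simp add: mult_ac)
  then show ?thesis
    using a_pos by (subst (asm) ennreal_mult_le_mult_iff) auto
qed

text \<open>If \<open>J \<xi>\<close> exceeded \<open>J \<zeta>\<close>, moving a little mass from
  near \<xi> to near \<zeta> would lower the energy: to first order in \<open>e\<close> the change
  is proportional to \<open>4 * e * (J \<zeta> - J \<xi>)\<close>.\<close>

lemma extremal_J_le:
  assumes ext: "extremal_density (hproj -` \<Omega>) (lifted_family \<phi> a b) \<rho>"
    and \<rho>: "AE p in lebesgue_on (hproj -` \<Omega>). \<rho> p = pullback_hproj (rect_density \<phi> a b) p"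
    and R: "\<zeta> \<in> rect a b" "\<xi> \<in> rect a b" and Im: "Im \<zeta> = Im \<xi>"
  shows "J \<xi> \<le> J \<zeta>"
proof (rule ccontr)
  assume "\<not> J \<xi> \<le> J \<zeta>"
  then have lt: "J \<zeta> < J \<xi>" by simp
  \<comment> \<open>A third of the gap: oscillations below \<open>d\<close> on both squares still
    leave a gap of size \<open>d\<close>, which also makes the squares disjoint.\<close>
  define d where "d = (J \<xi> - J \<zeta>) / 3"
  have d: "0 < d" using lt by (simp add: d_def)
  have near: "\<exists>r>0. square \<eta> r \<subseteq> rect a b \<and> (\<forall>\<eta>'\<in>square \<eta> r. \<bar>J \<eta>' - J \<eta>\<bar> < d)" if \<eta>: "\<eta> \<in> rect a b" for \<eta>
  proof -
    have "isCont J \<eta>"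
      using continuous_J \<eta> open_rect by (simp add: continuous_on_eq_continuous_at)
    then obtain s where s: "s > 0" "\<And>\<eta>'. dist \<eta>' \<eta> < s \<Longrightarrow> \<bar>J \<eta>' - J \<eta>\<bar> < d"
      using d unfolding continuous_at_eps_delta dist_real_def by metis
    obtain t where t: "t > 0" "ball \<eta> t \<subseteq> rect a b"
      using open_rect \<eta> by (meson openE)
    define r where "r = min s t / 4"
    have "dist \<eta>' \<eta> < min s t" if "\<eta>' \<in> square \<eta> r" for \<eta>'
    proof -
      have "dist \<eta>' \<eta> \<le> \<bar>Re \<eta>' - Re \<eta>\<bar> + \<bar>Im \<eta>' - Im \<eta>\<bar>"
        using cmod_le[of "\<eta>' - \<eta>"] by (simp add: dist_norm)
      also have "\<dots> < min s t"
        using that s t by (auto simp: mem_square r_def)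
      finally show ?thesis .
    qed
    then show ?thesis
      using s t by (intro exI[of _ r]) (auto simp: r_def dist_commute subset_iff)
  qed
  obtain r1 r2 where r12: "0 < r1" "square \<zeta> r1 \<subseteq> rect a b" "\<And>\<eta>. \<eta> \<in> square \<zeta> r1 \<Longrightarrow> \<bar>J \<eta> - J \<zeta>\<bar> < d"
    "0 < r2" "square \<xi> r2 \<subseteq> rect a b" "\<And>\<eta>. \<eta> \<in> square \<xi> r2 \<Longrightarrow> \<bar>J \<eta> - J \<xi>\<bar> < d"
    using near[OF R(1)] near[OF R(2)] by blast
  define r where "r = min r1 r2"
  have sub_r: "square \<eta> r \<subseteq> square \<eta> r1" "square \<eta> r \<subseteq> square \<eta> r2" for \<eta>
    by (auto simp: mem_square r_def)
  have r: "0 < r" "square \<zeta> r \<subseteq> rect a b" "square \<xi> r \<subseteq> rect a b"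
    using r12(1,4) subset_trans[OF sub_r(1) r12(2)] subset_trans[OF sub_r(2) r12(5)] by (auto simp: r_def)
  have J_near: "J \<eta> \<le> J \<zeta> + d" if "\<eta> \<in> square \<zeta> r" for \<eta>
    using r12(3)[OF subsetD[OF sub_r(1) that]] by (simp add: abs_less_iff)
  have J_near': "J \<xi> - d \<le> J \<eta>" if "\<eta> \<in> square \<xi> r" for \<eta>
    using r12(6)[OF subsetD[OF sub_r(2) that]] by (simp add: abs_less_iff)
  have gap: "J \<zeta> + d < J \<xi> - d" using d by (simp add: d_def field_simps)
  define m1 where "m1 = J \<zeta> + d"
  define m2 where "m2 = J \<xi> - d"
  have m: "0 < m1" "m1 < m2"
    using gap J_pos[OF R(1)] d by (auto simp: m1_def m2_def)
  have disj: "square \<zeta> r \<inter> square \<xi> r = {}"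
    using J_near J_near' gap by fastforce
  \<comment> \<open>The bounds used below are \<open>1 - (1 - e) ^ 4 \<ge> e * (4 - 6 * e)\<close>
    and \<open>(1 + e) ^ 4 - 1 \<le> e * (4 + 11 * e)\<close>, where 11 is 6 + 4 + 1. They yield
    \<open>4 * (m2 - m1) \<le> e * (11 * m1 + 6 * m2)\<close>, and this \<open>e\<close> makes the
    right side only \<open>m2 - m1\<close>.\<close>
  define e where "e = (m2 - m1) / (11 * m1 + 6 * m2)"
  have e: "0 < e" "e \<le> 1" using m by (auto simp: e_def)
  define A where "A = 4 * r\<^sup>2"
  have A: "0 < A" using r by (simp add: A_def)
  have e4: "(1 - e) ^ 4 \<le> 1" "1 \<le> (1 + e) ^ 4"
    using e by (auto intro: power_le_one one_le_power)
  have "ennreal ((1 - (1 - e) ^ 4) * (m2 * A)) = ennreal (1 - (1 - e) ^ 4) * (\<integral>\<^sup>+ \<eta>. ennreal m2 * indicator (square \<xi> r) \<eta> \<partial>lborel)"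
    using m A e4 r(1) by (subst nn_integral_cmult_indicator) (auto simp: square_def[symmetric] emeasure_square A_def ennreal_mult[symmetric], simp add: square_def)
  also have "\<dots> \<le> ennreal (1 - (1 - e) ^ 4) * J_mass (square \<xi> r)"
    using J_near' by (intro mult_left_mono nn_integral_mono) (auto simp: indicator_def m2_def ennreal_leI)
  also have "\<dots> \<le> ennreal ((1 + e) ^ 4 - 1) * J_mass (square \<zeta> r)"
    using extremal_squares[OF ext \<rho> r(2,3) Im r(1) _ e(2) disj] e by simp
  also have "\<dots> \<le> ennreal ((1 + e) ^ 4 - 1) * (\<integral>\<^sup>+ \<eta>. ennreal m1 * indicator (square \<zeta> r) \<eta> \<partial>lborel)"
    using J_near by (intro mult_left_mono nn_integral_mono) (auto simp: indicator_def m1_def ennreal_leI)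
  also have "\<dots> = ennreal (((1 + e) ^ 4 - 1) * (m1 * A))"
    using m A e4 r(1) by (subst nn_integral_cmult_indicator) (auto simp: square_def[symmetric] emeasure_square A_def ennreal_mult[symmetric], simp add: square_def)
  finally have "(1 - (1 - e) ^ 4) * (m2 * A) \<le> ((1 + e) ^ 4 - 1) * (m1 * A)"
    using m A e4 by (subst (asm) ennreal_le_iff) auto
  then have "(1 - (1 - e) ^ 4) * m2 \<le> ((1 + e) ^ 4 - 1) * m1"
    using A by (simp add: mult.assoc[symmetric])
  moreover have "e * (4 - 6 * e) \<le> 1 - (1 - e) ^ 4"
  proof -
    have "1 - (1 - e) ^ 4 - e * (4 - 6 * e) = e ^ 3 * (4 - e)"
      by (simp add: eval_nat_numeral algebra_simps)
    moreover have "0 \<le> e ^ 3 * (4 - e)" using e by simp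
    ultimately show ?thesis by linarith
  qed
  moreover have "(1 + e) ^ 4 - 1 \<le> e * (4 + 11 * e)"
  proof -
    have "e * (4 + 11 * e) - ((1 + e) ^ 4 - 1) = e\<^sup>2 * (5 - 4 * e - e\<^sup>2)"
      by (simp add: eval_nat_numeral algebra_simps)
    moreover have "e\<^sup>2 \<le> 1" using e by (simp add: power_le_one)
    then have "0 \<le> e\<^sup>2 * (5 - 4 * e - e\<^sup>2)" using e by (intro mult_nonneg_nonneg) auto
    ultimately show ?thesis by linarith
  qed
  ultimately have "e * (4 - 6 * e) * m2 \<le> e * (4 + 11 * e) * m1"
    using m mult_right_mono[of "e * (4 - 6 * e)" "1 - (1 - e) ^ 4" m2]
      mult_right_mono[of "(1 + e) ^ 4 - 1" "e * (4 + 11 * e)" m1] by linarith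
  then have "e * (4 * (m2 - m1)) \<le> e * (e * (11 * m1 + 6 * m2))"
    by (simp add: algebra_simps)
  then have "4 * (m2 - m1) \<le> e * (11 * m1 + 6 * m2)"
    using e by simp
  then show False
    using m by (simp add: e_def)
qed

lemma extremal_J_eq:
  assumes "extremal_density (hproj -` \<Omega>) (lifted_family \<phi> a b) \<rho>"
    and "AE p in lebesgue_on (hproj -` \<Omega>). \<rho> p = pullback_hproj (rect_density \<phi> a b) p"
    and "\<zeta> \<in> rect a b" "\<xi> \<in> rect a b" "Im \<zeta> = Im \<xi>"
  shows "J \<xi> = J \<zeta>"
  using extremal_J_le[OF assms(1-5)] extremal_J_le[OF assms(1,2,4,3) assms(5)[symmetric]] by simp

end

section \<open>Straightening coordinates\<close>

lemma has_vector_derivative_hproj_hor: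
  assumes "(\<gamma> has_vector_derivative hor (\<gamma> s) \<zeta>) (at s)"
  shows "((\<lambda>s. hproj (\<gamma> s)) has_vector_derivative 2 * \<i> * cnj (fst (\<gamma> s)) * \<zeta>) (at s)"
  using vector_derivative_diff_chain_within[of \<gamma> "hor (\<gamma> s) \<zeta>" s UNIV hproj,
      OF _ has_derivative_at_withinI[OF hproj_has_derivative]] assms
  by (simp only: hproj_derivative_hor o_def)

lemma has_vector_derivative_divide_complex:
  fixes u v :: "real \<Rightarrow> complex"
  assumes "(u has_vector_derivative u') (at s)" "(v has_vector_derivative v') (at s)" "v s \<noteq> 0"
  shows "((\<lambda>s. u s / v s) has_vector_derivative (u' * v s - u s * v') / (v s * v s)) (at s)"
  using assms unfolding has_vector_derivative_def
  by (auto intro!: derivative_eq_intros simp: fun_eq_iff field_simps scaleR_conv_of_real)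

lemma has_vector_derivative_exp:
  fixes u :: "real \<Rightarrow> complex"
  assumes "(u has_vector_derivative u') (at s)"
  shows "((\<lambda>s. exp (u s)) has_vector_derivative exp (u s) * u') (at s)"
  using field_vector_diff_chain_at[OF assms DERIV_exp] by (simp add: o_def mult.commute)

text \<open>The derivative of a horizontal lift and the modulus of its first coordinate are determined by the
  projected curve, so the quotient of the first coordinates of two lifts is constant.\<close>

lemma horizontal_lift_unique:
  assumes I: "open I" "convex I"
    and \<gamma>: "\<And>s. s \<in> I \<Longrightarrow> (\<gamma> has_vector_derivative hor (\<gamma> s) (\<gamma>' s)) (at s)"
    and \<delta>: "\<And>s. s \<in> I \<Longrightarrow> (\<delta> has_vector_derivative hor (\<delta> s) (\<delta>' s)) (at s)"
    and eq: "\<And>s. s \<in> I \<Longrightarrow> hproj (\<gamma> s) = hproj (\<delta> s)"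
    and nz: "\<And>s. s \<in> I \<Longrightarrow> hproj (\<gamma> s) \<in> upper_half_plane"
    and s0: "s0 \<in> I" "\<gamma> s0 = \<delta> s0" and s: "s \<in> I"
  shows "\<gamma> s = \<delta> s"
proof -
  have norm_eq: "cmod (fst (\<gamma> s)) = cmod (fst (\<delta> s))" and \<gamma>_nz: "fst (\<gamma> s) \<noteq> 0" and \<delta>_nz: "fst (\<delta> s) \<noteq> 0" if "s \<in> I" for s
  proof -
    show *: "cmod (fst (\<gamma> s)) = cmod (fst (\<delta> s))"
      using arg_cong[OF eq[OF that], of Im] by simp
    show "fst (\<gamma> s) \<noteq> 0"
      using nz[OF that] by (auto simp: upper_half_plane_def)
    with * show "fst (\<delta> s) \<noteq> 0"
      by auto
  qed
  have "((\<lambda>s. fst (\<gamma> s) / fst (\<delta> s)) has_vector_derivative 0) (at s within I)" if s: "s \<in> I" for s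
  proof -
    have d1: "((\<lambda>s. fst (\<gamma> s)) has_vector_derivative \<gamma>' s) (at s)"
      using bounded_linear.has_vector_derivative[OF bounded_linear_fst \<gamma>[OF s]] by simp
    have d2: "((\<lambda>s. fst (\<delta> s)) has_vector_derivative \<delta>' s) (at s)"
      using bounded_linear.has_vector_derivative[OF bounded_linear_fst \<delta>[OF s]] by simp
    have "((\<lambda>s. hproj (\<gamma> s)) has_vector_derivative 2 * \<i> * cnj (fst (\<delta> s)) * \<delta>' s) (at s)"
      by (rule has_vector_derivative_transform_within_open[OF has_vector_derivative_hproj_hor[OF \<delta>[OF s]] I(1) s])
        (simp add: eq)
    from vector_derivative_unique_at[OF has_vector_derivative_hproj_hor[OF \<gamma>[OF s]] this]
    have *: "cnj (fst (\<gamma> s)) * \<gamma>' s = cnj (fst (\<delta> s)) * \<delta>' s" by simp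
    have sq: "fst (\<delta> s) * cnj (fst (\<delta> s)) = fst (\<gamma> s) * cnj (fst (\<gamma> s))"
      by (simp add: complex_norm_square[symmetric] norm_eq[OF s])
    \<comment> \<open>After multiplication by a non-zero conjugate, the numerator of the quotient
      rule vanishes by \<open>*\<close> (equal projected velocities) and \<open>sq\<close> (equal
      moduli).\<close>
    have "cnj (fst (\<delta> s)) * (\<gamma>' s * fst (\<delta> s) - fst (\<gamma> s) * \<delta>' s) =
        \<gamma>' s * (fst (\<delta> s) * cnj (fst (\<delta> s))) - fst (\<gamma> s) * (cnj (fst (\<delta> s)) * \<delta>' s)"
      by (simp add: algebra_simps)
    also have "\<dots> = 0"
      unfolding sq *[symmetric] by simp
    finally have "cnj (fst (\<delta> s)) * (\<gamma>' s * fst (\<delta> s) - fst (\<gamma> s) * \<delta>' s) = 0" .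
    then have 0: "\<gamma>' s * fst (\<delta> s) - fst (\<gamma> s) * \<delta>' s = 0"
      using \<delta>_nz[OF s] by simp
    have "((\<lambda>s. fst (\<gamma> s) / fst (\<delta> s)) has_vector_derivative
        (\<gamma>' s * fst (\<delta> s) - fst (\<gamma> s) * \<delta>' s) / (fst (\<delta> s) * fst (\<delta> s))) (at s)"
      by (rule has_vector_derivative_divide_complex[OF d1 d2 \<delta>_nz[OF s]])
    then show ?thesis
      unfolding 0 by (simp add: has_vector_derivative_at_within)
  qed
  then obtain c where "\<And>s. s \<in> I \<Longrightarrow> fst (\<gamma> s) / fst (\<delta> s) = c"
    using has_vector_derivative_zero_constant[OF I(2)] by blast
  then have "fst (\<gamma> s) / fst (\<delta> s) = fst (\<gamma> s0) / fst (\<delta> s0)"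
    using s0 s by metis
  then have "fst (\<gamma> s) = fst (\<delta> s)"
    using s0 \<delta>_nz s by simp
  moreover have "snd (\<gamma> s) = snd (\<delta> s)"
    using arg_cong[OF eq[OF s], of Re] by simp
  ultimately show ?thesis by (simp add: prod_eq_iff)
qed

section \<open>Coordinates adapted to the lifted segments\<close>

locale straight_chart = rectangle_chart +
  assumes J_eq: "\<And>\<zeta> \<xi>. \<zeta> \<in> rect a b \<Longrightarrow> \<xi> \<in> rect a b \<Longrightarrow> Im \<zeta> = Im \<xi> \<Longrightarrow> J \<zeta> = J \<xi>"
begin

text \<open>A branch of half the logarithm of \<phi>', which exists since \<phi>' has no zeros on a
  convex set. The half appears because the first coordinate of a lift has squared modulus
  \<open>Im \<phi>\<close>.\<close>

definition L :: "complex \<Rightarrow> complex" where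
  "L = (SOME l. l holomorphic_on rect a b \<and> (\<forall>\<zeta>\<in>rect a b. exp (2 * l \<zeta>) = deriv \<phi> \<zeta>))"

lemma Complex_in_rect [simp]: "Complex x y \<in> rect a b \<longleftrightarrow> 0 < x \<and> x < a \<and> 0 < y \<and> y < b"
  by (auto simp: rect_def)

lemma L: "L holomorphic_on rect a b" "\<And>\<zeta>. \<zeta> \<in> rect a b \<Longrightarrow> exp (2 * L \<zeta>) = deriv \<phi> \<zeta>"
proof -
  obtain l where "l holomorphic_on rect a b" "\<And>\<zeta>. \<zeta> \<in> rect a b \<Longrightarrow> exp (l \<zeta>) = deriv \<phi> \<zeta>"
    using holomorphic_logarithm_exists[OF convex_rect open_rect hol_deriv deriv_nonzero, of "Complex (a/2) (b/2)"] a_pos b_pos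
    by auto
  then have "(\<lambda>\<zeta>. l \<zeta> / 2) holomorphic_on rect a b \<and> (\<forall>\<zeta>\<in>rect a b. exp (2 * (l \<zeta> / 2)) = deriv \<phi> \<zeta>)"
    by (auto intro!: holomorphic_intros)
  then have "L holomorphic_on rect a b \<and> (\<forall>\<zeta>\<in>rect a b. exp (2 * L \<zeta>) = deriv \<phi> \<zeta>)"
    unfolding L_def by (rule someI[where P = "\<lambda>l. l holomorphic_on rect a b \<and> (\<forall>\<zeta>\<in>rect a b. exp (2 * l \<zeta>) = deriv \<phi> \<zeta>)"])
  then show "L holomorphic_on rect a b" "\<And>\<zeta>. \<zeta> \<in> rect a b \<Longrightarrow> exp (2 * L \<zeta>) = deriv \<phi> \<zeta>"
    by auto
qed

lemma cmod_deriv: "\<zeta> \<in> rect a b \<Longrightarrow> cmod (deriv \<phi> \<zeta>) = exp (2 * Re (L \<zeta>))"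
  using L(2)[of \<zeta>] norm_exp_eq_Re[of "2 * L \<zeta>"] by simp

text \<open>This is the logarithm of \<open>Im \<phi>\<close> / |\<phi>'| at height
  \<open>y\<close>; by \<open>J_eq\<close> it can be read off at any abscissa, here the
  midpoint.\<close>

definition ee :: "real \<Rightarrow> real" where "ee y = ln (J (Complex (a / 2) y)) / 2"

lemma Im_map:
  assumes "\<zeta> \<in> rect a b"
  shows "Im (\<phi> \<zeta>) = exp (ee (Im \<zeta>) + 2 * Re (L \<zeta>))"
proof -
  have "J (Complex (a / 2) (Im \<zeta>)) = J \<zeta>"
    using assms by (intro J_eq) (auto simp: rect_def)
  moreover have "J \<zeta> = (Im (\<phi> \<zeta>) / exp (2 * Re (L \<zeta>)))\<^sup>2"
    using assms by (simp add: J_def cmod_deriv)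
  moreover have "0 < Im (\<phi> \<zeta>)"
    using assms Im_pos by simp
  ultimately have "ee (Im \<zeta>) = ln (Im (\<phi> \<zeta>) / exp (2 * Re (L \<zeta>)))"
    by (simp add: ee_def ln_realpow)
  then have "exp (ee (Im \<zeta>)) = Im (\<phi> \<zeta>) / exp (2 * Re (L \<zeta>))"
    using \<open>0 < Im (\<phi> \<zeta>)\<close> by simp
  then show ?thesis
    by (simp add: exp_add)
qed

lemma J_exp: "\<zeta> \<in> rect a b \<Longrightarrow> J \<zeta> = exp (2 * ee (Im \<zeta>))"
  by (simp add: J_def cmod_deriv Im_map exp_add exp_double)

lemma L_has_deriv: "\<zeta> \<in> rect a b \<Longrightarrow> (L has_field_derivative deriv L \<zeta>) (at \<zeta>)"
  using holomorphic_derivI[OF L(1) open_rect] .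

lemma deriv_has_deriv: "\<zeta> \<in> rect a b \<Longrightarrow> (deriv \<phi> has_field_derivative 2 * deriv L \<zeta> * deriv \<phi> \<zeta>) (at \<zeta>)"
proof -
  assume \<zeta>: "\<zeta> \<in> rect a b"
  have "((\<lambda>\<zeta>. exp (2 * L \<zeta>)) has_field_derivative 2 * deriv L \<zeta> * deriv \<phi> \<zeta>) (at \<zeta>)"
    using L_has_deriv[OF \<zeta>] L(2)[OF \<zeta>] by (auto intro!: derivative_eq_intros)
  then show ?thesis
    by (rule has_field_derivative_transform_within_open[OF _ open_rect \<zeta>]) (simp add: L(2))
qed

lemma deriv_L_has_deriv: "\<zeta> \<in> rect a b \<Longrightarrow> (deriv L has_field_derivative deriv (deriv L) \<zeta>) (at \<zeta>)"
  by (rule holomorphic_derivI[OF holomorphic_deriv[OF L(1) open_rect] open_rect])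

lemma ln_Im_map: "\<zeta> \<in> rect a b \<Longrightarrow> ln (Im (\<phi> \<zeta>)) - 2 * Re (L \<zeta>) = ee (Im \<zeta>)"
  by (simp add: Im_map)

text \<open>This is the derivative of \<open>ln_Im_map\<close> in the \<open>x\<close> direction,
  along which its right-hand side is constant.\<close>

lemma Im_deriv:
  assumes "\<zeta> \<in> rect a b"
  shows "Im (deriv \<phi> \<zeta>) = 2 * Im (\<phi> \<zeta>) * Re (deriv L \<zeta>)"
proof -
  obtain x y where \<zeta>: "\<zeta> = Complex x y" by (cases \<zeta>)
  have xy: "x \<in> {0<..<a}" "0 < y" "y < b" using assms by (auto simp: \<zeta>)
  have pos: "0 < Im (\<phi> (Complex x y))" using assms Im_pos \<zeta> by simp
  have "((\<lambda>x. ln (Im (\<phi> (Complex x y))) - 2 * Re (L (Complex x y))) has_real_derivative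
      Im (deriv \<phi> \<zeta>) / Im (\<phi> \<zeta>) - 2 * Re (deriv L \<zeta>)) (at x)"
    using has_vector_derivative_horizontal_line[OF has_deriv[OF assms, unfolded \<zeta>]]
      has_vector_derivative_horizontal_line[OF L_has_deriv[OF assms, unfolded \<zeta>]] pos
    unfolding \<zeta> by (auto intro!: derivative_eq_intros simp: divide_inverse)
  moreover have "((\<lambda>x. ln (Im (\<phi> (Complex x y))) - 2 * Re (L (Complex x y))) has_real_derivative 0) (at x)"
    by (rule DERIV_cong_ev[OF refl _ refl, THEN iffD2, OF _ DERIV_const[of "ee y"]])
      (use xy in \<open>auto simp: ln_Im_map intro!: eventually_nhds_in_open[THEN eventually_mono, of "{0<..<a}"]\<close>)
  ultimately have "Im (deriv \<phi> \<zeta>) / Im (\<phi> \<zeta>) - 2 * Re (deriv L \<zeta>) = 0"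
    by (rule DERIV_unique)
  then show ?thesis
    using pos by (simp add: \<zeta> field_simps)
qed

definition ee' :: "real \<Rightarrow> real" where
  "ee' y = (let \<zeta> = Complex (a / 2) y in Re (deriv \<phi> \<zeta>) / Im (\<phi> \<zeta>) + 2 * Im (deriv L \<zeta>))"

lemma ee_has_derivative_aux:
  assumes "\<zeta> \<in> rect a b"
  shows "(ee has_real_derivative Re (deriv \<phi> \<zeta>) / Im (\<phi> \<zeta>) + 2 * Im (deriv L \<zeta>)) (at (Im \<zeta>))"
proof -
  obtain x y where \<zeta>: "\<zeta> = Complex x y" by (cases \<zeta>)
  have xy: "y \<in> {0<..<b}" "0 < x" "x < a" using assms by (auto simp: \<zeta>)
  have pos: "0 < Im (\<phi> (Complex x y))" using assms Im_pos \<zeta> by simp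
  have "((\<lambda>y. ln (Im (\<phi> (Complex x y))) - 2 * Re (L (Complex x y))) has_real_derivative
      Re (deriv \<phi> \<zeta>) / Im (\<phi> \<zeta>) + 2 * Im (deriv L \<zeta>)) (at y)"
    using has_vector_derivative_vertical_line[OF has_deriv[OF assms, unfolded \<zeta>]]
      has_vector_derivative_vertical_line[OF L_has_deriv[OF assms, unfolded \<zeta>]] pos
    unfolding \<zeta> by (auto intro!: derivative_eq_intros simp: divide_inverse)
  then show ?thesis
    unfolding \<zeta> complex.sel
    by (rule DERIV_cong_ev[OF refl _ refl, THEN iffD2, rotated])
      (use xy in \<open>auto simp: ln_Im_map intro!: eventually_nhds_in_open[THEN eventually_mono, of "{0<..<b}"]\<close>)
qed

lemma ee'_eq:
  assumes "\<zeta> \<in> rect a b"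
  shows "ee' (Im \<zeta>) = Re (deriv \<phi> \<zeta>) / Im (\<phi> \<zeta>) + 2 * Im (deriv L \<zeta>)"
proof -
  have "Complex (a / 2) (Im \<zeta>) \<in> rect a b"
    using assms by (auto simp: rect_def)
  from DERIV_unique[OF ee_has_derivative_aux[OF this, unfolded complex.sel] ee_has_derivative_aux[OF assms]]
  show ?thesis by (simp add: ee'_def Let_def)
qed

lemma ee_has_derivative:
  assumes "0 < y" "y < b"
  shows "(ee has_real_derivative ee' y) (at y)"
  using ee_has_derivative_aux[of "Complex (a/2) y"] ee'_eq[of "Complex (a/2) y"] assms a_pos by simp

lemma ee'_has_derivative:
  assumes "0 < y" "y < b"
  shows "(ee' has_real_derivative - exp (- 2 * ee y)) (at y)"
proof -
  define \<zeta> where "\<zeta> = Complex (a/2) y"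
  have \<zeta>: "\<zeta> \<in> rect a b" using assms a_pos by (simp add: \<zeta>_def)
  have pos: "0 < Im (\<phi> \<zeta>)" using \<zeta> Im_pos by simp
  define D where "D = - Im (2 * deriv L \<zeta> * deriv \<phi> \<zeta>) / Im (\<phi> \<zeta>) - (Re (deriv \<phi> \<zeta>) / Im (\<phi> \<zeta>))\<^sup>2 + 2 * Re (deriv (deriv L) \<zeta>)"
  have "((\<lambda>y. Re (deriv \<phi> (Complex (a/2) y)) / Im (\<phi> (Complex (a/2) y)) + 2 * Im (deriv L (Complex (a/2) y)))
      has_real_derivative D) (at y)"
    using has_vector_derivative_vertical_line[OF deriv_has_deriv[OF \<zeta>, unfolded \<zeta>_def]]
      has_vector_derivative_vertical_line[OF has_deriv[OF \<zeta>, unfolded \<zeta>_def]]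
      has_vector_derivative_vertical_line[OF deriv_L_has_deriv[OF \<zeta>, unfolded \<zeta>_def]] pos
    unfolding D_def \<zeta>_def by (auto intro!: derivative_eq_intros simp: field_simps power2_eq_square)
  moreover have "(\<lambda>y. Re (deriv \<phi> (Complex (a/2) y)) / Im (\<phi> (Complex (a/2) y)) + 2 * Im (deriv L (Complex (a/2) y))) = ee'"
    by (simp add: ee'_def fun_eq_iff Let_def)
  ultimately have D: "(ee' has_real_derivative D) (at y)" by simp
  \<comment> \<open>Differentiating \<open>Im_deriv\<close> once more along \<open>x\<close>
    expresses the second derivative of \<open>L\<close> by first-order terms. The vertical second
    derivative contains the same term, since the real part of \<open>L\<close> is harmonic.\<close>
  have K: "2 * Re (deriv (deriv L) \<zeta>) = Im (2 * deriv L \<zeta> * deriv \<phi> \<zeta>) / Im (\<phi> \<zeta>) - (Im (deriv \<phi> \<zeta>) / Im (\<phi> \<zeta>))\<^sup>2"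
  proof -
    have "((\<lambda>x. Im (deriv \<phi> (Complex x y)) / Im (\<phi> (Complex x y)) - 2 * Re (deriv L (Complex x y))) has_real_derivative
        Im (2 * deriv L \<zeta> * deriv \<phi> \<zeta>) / Im (\<phi> \<zeta>) - (Im (deriv \<phi> \<zeta>) / Im (\<phi> \<zeta>))\<^sup>2 - 2 * Re (deriv (deriv L) \<zeta>)) (at (a/2))"
      using has_vector_derivative_horizontal_line[OF deriv_has_deriv[OF \<zeta>, unfolded \<zeta>_def]]
        has_vector_derivative_horizontal_line[OF has_deriv[OF \<zeta>, unfolded \<zeta>_def]]
        has_vector_derivative_horizontal_line[OF deriv_L_has_deriv[OF \<zeta>, unfolded \<zeta>_def]] pos
      unfolding \<zeta>_def by (auto intro!: derivative_eq_intros simp: field_simps power2_eq_square)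
    moreover have "Im (deriv \<phi> (Complex x y)) / Im (\<phi> (Complex x y)) - 2 * Re (deriv L (Complex x y)) = 0"
      if "x \<in> {0<..<a}" for x
    proof -
      have "Complex x y \<in> rect a b" using that assms by simp
      then show ?thesis using Im_deriv[of "Complex x y"] Im_pos[of "\<phi> (Complex x y)"] by simp
    qed
    then have "((\<lambda>x. Im (deriv \<phi> (Complex x y)) / Im (\<phi> (Complex x y)) - 2 * Re (deriv L (Complex x y))) has_real_derivative 0) (at (a/2))"
      by (intro DERIV_cong_ev[OF refl _ refl, THEN iffD2, OF _ DERIV_const[of 0]])
        (use a_pos in \<open>auto intro!: eventually_nhds_in_open[THEN eventually_mono, of "{0<..<a}"]\<close>)
    ultimately show ?thesis
      using DERIV_unique by fastforce
  qed
  moreover have "(cmod (deriv \<phi> \<zeta>) / Im (\<phi> \<zeta>))\<^sup>2 = exp (- 2 * ee y)"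
  proof -
    have "(cmod (deriv \<phi> \<zeta>) / Im (\<phi> \<zeta>))\<^sup>2 = inverse (J \<zeta>)"
      by (simp add: J_def field_simps)
    then show ?thesis
      using J_exp[OF \<zeta>] by (simp add: \<zeta>_def exp_minus)
  qed
  moreover have "(cmod (deriv \<phi> \<zeta>) / Im (\<phi> \<zeta>))\<^sup>2 = (Re (deriv \<phi> \<zeta>) / Im (\<phi> \<zeta>))\<^sup>2 + (Im (deriv \<phi> \<zeta>) / Im (\<phi> \<zeta>))\<^sup>2"
    by (simp add: cmod_power2 power_divide add_divide_distrib)
  ultimately have "D = - exp (- 2 * ee y)"
    unfolding D_def K minus_divide_left[symmetric] by linarith
  then show ?thesis
    using D by simp
qed

text \<open>The argument of the first coordinate is chosen so that \<open>\<lambda>x. E x y \<theta>\<close> is horizontal. It is explicit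
  because $\log \Im\phi - \log |\phi'|$ is the function \<open>ee\<close> of \<open>y\<close> alone; as $\log |\phi'|$ is harmonic,
  the second derivative of \<open>ee\<close> is $-|\phi'|^2 / (\Im\phi)^2$.\<close>

definition E :: "real \<Rightarrow> real \<Rightarrow> real \<Rightarrow> heis" where
  "E x y \<theta> = (exp (L (Complex x y) + of_real (ee y / 2) + \<i> * of_real (\<theta> - x * ee' y / 2)), Re (\<phi> (Complex x y)))"

lemma hproj_E:
  assumes "Complex x y \<in> rect a b"
  shows "hproj (E x y \<theta>) = \<phi> (Complex x y)"
proof -
  have "(cmod (fst (E x y \<theta>)))\<^sup>2 = exp (2 * Re (L (Complex x y)) + ee y)"
    by (simp add: E_def power2_eq_square exp_add[symmetric])
  then show ?thesis
    using Im_map[OF assms] by (simp add: complex_eq_iff add.commute) (simp add: E_def)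
qed

lemma fst_E_nonzero [simp]: "fst (E x y \<theta>) \<noteq> 0"
  by (simp add: E_def)

text \<open>Points over the same \<open>w\<close> have first coordinates of equal modulus, so they
  differ by a rotation, which the parameter \<theta> provides.\<close>

lemma E_surj:
  assumes "hproj p \<in> \<Omega>"
  obtains x y \<theta> where "Complex x y \<in> rect a b" "\<Phi> (hproj p) = Complex x y" "p = E x y \<theta>"
proof -
  obtain x y where xy: "\<Phi> (hproj p) = Complex x y" by (cases "\<Phi> (hproj p)")
  then have R: "Complex x y \<in> rect a b" using inv_in[OF assms] by simp
  have \<phi>: "\<phi> (Complex x y) = hproj p" using map_inv[OF assms] xy by simp
  have "cmod (fst p) = cmod (fst (E x y 0))"
    using hproj_E[OF R, of 0] \<phi> arg_cong[of _ _ Im] by (metis abs_norm_cancel hproj_sel(2) power2_eq_iff_nonneg norm_ge_zero)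
  then have "cmod (fst p / fst (E x y 0)) = 1"
    by (simp add: norm_divide)
  then obtain \<theta> where "fst p / fst (E x y 0) = exp (\<i> * of_real \<theta>)"
    using complex_norm_eq_1_exp by metis
  then have "fst p = fst (E x y 0) * exp (\<i> * of_real \<theta>)"
    by (simp add: field_simps)
  also have "\<dots> = fst (E x y \<theta>)"
    by (simp add: E_def exp_add[symmetric] algebra_simps)
  finally have "fst p = fst (E x y \<theta>)" .
  moreover have "snd p = snd (E x y \<theta>)"
    using arg_cong[OF \<phi>, of Re] by (simp add: E_def)
  ultimately show ?thesis
    using that[OF R xy, of \<theta>] by (simp add: prod_eq_iff)
qed

lemma E_has_derivative:
  assumes R: "Complex x y \<in> rect a b"
  shows "((\<lambda>x. E x y \<theta>) has_vector_derivative
    hor (E x y \<theta>) (fst (E x y \<theta>) * (deriv L (Complex x y) - \<i> * of_real (ee' y / 2)))) (at x)"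
proof -
  let ?\<zeta> = "Complex x y"
  have 1: "((\<lambda>x. fst (E x y \<theta>)) has_vector_derivative
      fst (E x y \<theta>) * (deriv L ?\<zeta> - \<i> * of_real (ee' y / 2))) (at x)"
    unfolding E_def fst_conv
    by (rule has_vector_derivative_exp, rule has_vector_derivative_eq_rhs)
      (auto intro!: derivative_eq_intros has_vector_derivative_horizontal_line[OF L_has_deriv[OF R]])
  have 2: "((\<lambda>x. snd (E x y \<theta>)) has_vector_derivative Re (deriv \<phi> ?\<zeta>)) (at x)"
    unfolding E_def using Re_vector_derivative[OF has_vector_derivative_horizontal_line[OF has_deriv[OF R]]]
    by (simp add: has_real_derivative_iff_has_vector_derivative)
  \<comment> \<open>Horizontality is exactly \<open>ee'_eq\<close> multiplied by
    \<open>Im \<phi>\<close>; this is the origin of the term \<open>x * ee' y / 2\<close> in the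
    phase.\<close>
  have "Re (deriv \<phi> ?\<zeta>) = - 2 * Im (cnj (fst (E x y \<theta>)) * (fst (E x y \<theta>) * (deriv L ?\<zeta> - \<i> * of_real (ee' y / 2))))"
  proof -
    have "cnj (fst (E x y \<theta>)) * (fst (E x y \<theta>) * (deriv L ?\<zeta> - \<i> * of_real (ee' y / 2))) =
        of_real (Im (\<phi> ?\<zeta>)) * (deriv L ?\<zeta> - \<i> * of_real (ee' y / 2))"
      using arg_cong[OF hproj_E[OF R, of \<theta>], of Im] complex_norm_square[of "fst (E x y \<theta>)"]
      by (simp add: mult_ac)
    show ?thesis
      unfolding \<open>_ = of_real _ * _\<close> using ee'_eq[OF R] Im_pos[OF map_in[OF R]] by (simp add: field_simps)
  qed
  then show ?thesis
    using has_vector_derivative_Pair[OF 1 2] by (simp add: hor_def)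
qed

end

section \<open>Maps between lifted domains\<close>

lemma AE_lebesgue_on_imp_le_0:
  fixes u :: "'a::euclidean_space \<Rightarrow> real"
  assumes S: "open S" and u: "continuous_on S u" and AE: "AE x in lebesgue_on S. u x \<le> 0" and x: "x \<in> S"
  shows "u x \<le> 0"
proof (rule ccontr)
  assume "\<not> u x \<le> 0"
  moreover have "open (S \<inter> u -` {0<..})"
    using continuous_on_open_vimage[OF S] u open_greaterThan by (metis Int_commute)
  ultimately show False
    using AE_lebesgue_on_open_ex[OF S _ _ _ AE, of "S \<inter> u -` {0<..}"] x by force
qed

lemma AE_lebesgue_on_negligible:
  fixes S :: "'a::euclidean_space set"
  assumes "open S" "AE x in lebesgue_on S. P x"
  shows "negligible {x \<in> S. \<not> P x}"
proof -
  have "AE x in lebesgue. x \<in> S \<longrightarrow> P x"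
    using assms by (subst (asm) AE_restrict_space_iff) auto
  then obtain N where "{x \<in> space lebesgue. \<not> (x \<in> S \<longrightarrow> P x)} \<subseteq> N" "N \<in> null_sets lebesgue"
    unfolding eventually_ae_filter by blast
  then show ?thesis
    using negligible_subset[of N "{x \<in> S. \<not> P x}"] by (auto simp: negligible_iff_null_sets)
qed

lemma AE_lebesgue_on_not_in:
  fixes S :: "'a::euclidean_space set"
  assumes "open S" "negligible N"
  shows "AE x in lebesgue_on S. x \<notin> N"
proof -
  have "AE x in lebesgue. x \<notin> N"
    using assms(2) by (simp add: AE_not_in negligible_iff_null_sets)
  then have "AE x in lebesgue. x \<in> S \<longrightarrow> x \<notin> N"
    by eventually_elim simp
  then show ?thesis
    using assms(1) by (subst AE_restrict_space_iff) auto
qed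

locale chart_pair = src: rectangle_chart \<phi> a b \<Omega> + tgt: rectangle_chart \<psi> a' b' \<Omega>'
  for \<phi> a b \<Omega> \<psi> a' b' \<Omega>' +
  fixes f :: "heis \<Rightarrow> heis"
  assumes f: "f \<in> qc_class \<phi> a b \<Omega> \<psi> a' b' \<Omega>'"
begin

abbreviation W where "W \<equiv> hproj -` \<Omega>"
abbreviation W' where "W' \<equiv> hproj -` \<Omega>'"

definition A where "A = Zop (\<lambda>r. fst (f r))"
definition B where "B = Zbar_op (\<lambda>r. fst (f r))"
definition Df where "Df p = frechet_derivative f (at p)"
definition finv where "finv = inv_into W f"

lemma qc: "metric_qc hdist f W W'" "C2_on f W" "contact_on f W" "orientation_preserving_H f W"
  using f by (auto simp: qc_class_def quasiconformal_H_def)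

lemma homeomorphism_f: "homeomorphism W W' f finv"
proof -
  obtain h where h: "homeomorphism W W' f h"
    using qc(1) by (auto simp: metric_qc_def)
  then have inj: "inj_on f W"
    by (metis homeomorphism_def inj_on_inverseI)
  have "finv q = h q" if "q \<in> W'" for q
    using h that inj unfolding finv_def homeomorphism_def by (metis image_eqI inv_into_f_f)
  then show ?thesis
    using h by (auto intro: homeomorphism_cong)
qed

lemma f_in: "p \<in> W \<Longrightarrow> f p \<in> W'" and finv_in: "q \<in> W' \<Longrightarrow> finv q \<in> W"
  and finv_f: "p \<in> W \<Longrightarrow> finv (f p) = p" and f_finv: "q \<in> W' \<Longrightarrow> f (finv q) = q"
  using homeomorphism_f unfolding homeomorphism_def by blast+

lemma has_derivative_f: "p \<in> W \<Longrightarrow> (f has_derivative Df p) (at p)"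
  unfolding Df_def using C2_on_imp_has_derivative[OF qc(2)] .

lemma linear_Df: "p \<in> W \<Longrightarrow> bounded_linear (Df p)"
  using has_derivative_f has_derivative_bounded_linear by blast

lemma fst_has_derivative: "p \<in> W \<Longrightarrow> ((\<lambda>r. fst (f r)) has_derivative (\<lambda>v. fst (Df p v))) (at p)"
  using has_derivative_f by (rule has_derivative_fst)

lemma Df_hor_fst: "p \<in> W \<Longrightarrow> fst (Df p (hor p \<zeta>)) = A p * \<zeta> + B p * cnj \<zeta>"
  unfolding A_def B_def using frechet_derivative_hor[OF fst_has_derivative] .

lemma contact_Df:
  obtains \<kappa> where "\<And>p. p \<in> W \<Longrightarrow> \<kappa> p \<noteq> 0"
    "\<And>p v. p \<in> W \<Longrightarrow> contact_form (f p) (Df p v) = complex_of_real (\<kappa> p) * contact_form p v"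
  using qc(3) unfolding contact_on_def Df_def by metis

lemma contact_Df_iff: "p \<in> W \<Longrightarrow> contact_form (f p) (Df p v) = 0 \<longleftrightarrow> contact_form p v = 0"
  by (metis contact_Df mult_eq_0_iff of_real_eq_0_iff)

lemma contact_hor [simp]: "contact_form p (hor p \<zeta>) = 0"
  by (simp add: contact_form_eq_0_iff)

text \<open>A contact map preserves the horizontal planes, so on them its differential is determined
  by the derivatives of the first component.\<close>

lemma Df_hor: "p \<in> W \<Longrightarrow> Df p (hor p \<zeta>) = hor (f p) (A p * \<zeta> + B p * cnj \<zeta>)"
  using contact_Df_iff[of p "hor p \<zeta>"] by (simp add: contact_form_eq_0_iff Df_hor_fst)

lemma continuous_A: "continuous_on W A" and continuous_B: "continuous_on W B"
proof -
  have *: "continuous_on W (\<lambda>p. fst (Df p v))" for v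
    unfolding Df_def by (intro continuous_on_fst C2_on_imp_continuous_frechet_derivative qc)
  have eq: "frechet_derivative (\<lambda>r. fst (f r)) (at p) = (\<lambda>v. fst (Df p v))" if "p \<in> W" for p
    using frechet_derivative_at[OF fst_has_derivative[OF that]] by simp
  have A: "A p = (fst (Df p (1, 0)) - \<i> * fst (Df p (\<i>, 0))) / 2 + \<i> * cnj (fst p) * fst (Df p (0, 1))"
    and B: "B p = (fst (Df p (1, 0)) + \<i> * fst (Df p (\<i>, 0))) / 2 - \<i> * fst p * fst (Df p (0, 1))" if "p \<in> W" for p
    using that by (simp_all add: A_def B_def Zop_def Zbar_op_def eq Let_def)
  have "continuous_on W (\<lambda>p. (fst (Df p (1, 0)) - \<i> * fst (Df p (\<i>, 0))) / 2 + \<i> * cnj (fst p) * fst (Df p (0, 1)))"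
    "continuous_on W (\<lambda>p. (fst (Df p (1, 0)) + \<i> * fst (Df p (\<i>, 0))) / 2 - \<i> * fst p * fst (Df p (0, 1)))"
    by (auto intro!: continuous_intros *)
  then show "continuous_on W A" "continuous_on W B"
    using continuous_on_cong[OF refl A, of W] continuous_on_cong[OF refl B, of W] by auto
qed

lemma beltrami:
  obtains k where "0 \<le> k" "k < 1" "\<And>p. p \<in> W \<Longrightarrow> cmod (B p) \<le> k * cmod (A p)"
proof -
  obtain \<mu> k where k: "k < 1" "AE p in lebesgue_on W. cmod (\<mu> p) \<le> k" "AE p in lebesgue_on W. B p = \<mu> p * A p"
    using qc(4) unfolding orientation_preserving_H_def beltrami_coeff_def A_def B_def by auto
  have "AE p in lebesgue_on W. cmod (B p) - max 0 k * cmod (A p) \<le> 0"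
    using k(2,3)
  proof eventually_elim
    case (elim p)
    have "cmod (\<mu> p) * cmod (A p) \<le> max 0 k * cmod (A p)"
      using elim by (intro mult_right_mono) auto
    with elim show ?case by (simp add: norm_mult)
  qed
  then have "cmod (B p) - max 0 k * cmod (A p) \<le> 0" if "p \<in> W" for p
    by (rule AE_lebesgue_on_imp_le_0[OF src.open_lift, rotated])
      (use that in \<open>auto intro!: continuous_intros continuous_A continuous_B\<close>)
  then show ?thesis
    using k by (intro that[of "max 0 k"]) auto
qed

lemma pushforward_pointwise:
  assumes push: "AE q in lebesgue_on W'. pushforward_H f W \<rho>\<^sub>\<phi> q = \<rho>\<^sub>\<psi> q"
    and \<rho>: "AE p in lebesgue_on W. \<rho>\<^sub>\<phi> p = pullback_hproj (rect_density \<phi> a b) p"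
    and \<rho>': "AE q in lebesgue_on W'. \<rho>\<^sub>\<psi> q = pullback_hproj (rect_density \<psi> a' b') q"
    and p: "p \<in> W"
  shows "src.dens p = (cmod (A p) - cmod (B p)) * tgt.dens (f p)"
proof (rule ccontr)
  assume ne: "src.dens p \<noteq> (cmod (A p) - cmod (B p)) * tgt.dens (f p)"
  define u where "u p = src.dens p - (cmod (A p) - cmod (B p)) * tgt.dens (f p)" for p
  have "continuous_on W u"
    unfolding u_def
    by (intro continuous_intros src.continuous_dens continuous_A continuous_B
        continuous_on_compose2[OF tgt.continuous_dens C2_on_imp_continuous_on[OF qc(2)]]) (use f_in in auto)
  then have open_U: "open (W \<inter> u -` (- {0}))"
    using continuous_on_open_vimage[OF src.open_lift] by (metis Int_commute open_Compl closed_singleton)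
  define U where "U = W \<inter> u -` (- {0})"
  have U: "U \<subseteq> W" "p \<in> U" using ne p by (auto simp: U_def u_def)
  have "open (f ` U)"
    using homeomorphism_imp_open_map[OF homeomorphism_f, of U] open_U U
    by (simp add: openin_open_eq[OF src.open_lift] openin_open_eq[OF tgt.open_lift] U_def[symmetric])
  moreover have "f ` U \<subseteq> W'" "f ` U \<noteq> {}" using U f_in by auto
  moreover define N where "N = {p \<in> W. \<rho>\<^sub>\<phi> p \<noteq> pullback_hproj (rect_density \<phi> a b) p}"
  have "negligible N"
    unfolding N_def by (rule AE_lebesgue_on_negligible[OF src.open_lift \<rho>])
  \<comment> \<open>Differentiability of \<open>f\<close> carries the exceptional set of the source
    to a negligible set of the target.\<close>
  then have "negligible (f ` N)"
    using has_derivative_f by (intro negligible_differentiable_image_negligible)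
      (auto simp: N_def differentiable_on_def differentiable_def intro: has_derivative_at_withinI)
  then have "AE q in lebesgue_on W'. q \<notin> f ` N"
    by (rule AE_lebesgue_on_not_in[OF tgt.open_lift])
  with push \<rho>' have "AE q in lebesgue_on W'. pushforward_H f W \<rho>\<^sub>\<phi> q = pullback_hproj (rect_density \<psi> a' b') q \<and> q \<notin> f ` N"
    by eventually_elim auto
  ultimately obtain q where q: "q \<in> f ` U" "pushforward_H f W \<rho>\<^sub>\<phi> q = pullback_hproj (rect_density \<psi> a' b') q" "q \<notin> f ` N"
    using AE_lebesgue_on_open_ex[OF tgt.open_lift] by blast
  then obtain p' where p': "p' \<in> U" "q = f p'" by auto
  then have W: "p' \<in> W" using U by auto
  have "\<rho>\<^sub>\<phi> p' = ennreal (src.dens p')"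
  proof -
    have "p' \<notin> N" using q(3) p'(2) by blast
    then show ?thesis using W src.pullback_eq[of p'] by (simp add: N_def)
  qed
  moreover have "inv_into W f q = p'"
    using finv_f[OF W] by (simp add: finv_def p')
  ultimately have eq: "ennreal (src.dens p') / ennreal (cmod (A p') - cmod (B p')) = ennreal (tgt.dens (f p'))"
    using q(2) f_in[OF W] tgt.pullback_eq by (simp add: pushforward_H_def Let_def A_def B_def p')
  have pos: "0 < src.dens p'"
    using W src.fst_nonzero src.deriv_nonzero src.a_pos by (auto simp: src.dens_def)
  \<comment> \<open>A non-positive difference is turned into 0 by \<open>ennreal\<close>, and
    dividing a positive number by 0 gives \<open>top\<close>, which the finite right side
    excludes.\<close>
  have "0 < cmod (A p') - cmod (B p')"
  proof (rule ccontr)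
    assume "\<not> 0 < cmod (A p') - cmod (B p')"
    with eq pos have "(top::ennreal) = ennreal (tgt.dens (f p'))"
      by (simp add: ennreal_neg ennreal_divide_zero)
    then show False by simp
  qed
  with eq pos have "src.dens p' / (cmod (A p') - cmod (B p')) = tgt.dens (f p')"
    by (simp add: divide_ennreal)
  then have "u p' = 0"
    using \<open>0 < cmod (A p') - cmod (B p')\<close> by (simp add: u_def field_simps)
  with p' show False by (simp add: U_def)
qed

end

section \<open>Differentiability and contraction of the inverse map\<close>

locale straight_chart_pair = chart_pair +
  src: straight_chart \<phi> a b \<Omega> + tgt: straight_chart \<psi> a' b' \<Omega>' +
  assumes push: "\<And>p. p \<in> W \<Longrightarrow> src.dens p = (cmod (A p) - cmod (B p)) * tgt.dens (f p)"
begin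

lemma A_gt_B: "p \<in> W \<Longrightarrow> cmod (B p) < cmod (A p)"
proof -
  assume p: "p \<in> W"
  have "0 < src.dens p"
    using p src.fst_nonzero src.deriv_nonzero src.a_pos by (auto simp: src.dens_def)
  then have "0 < (cmod (A p) - cmod (B p)) * tgt.dens (f p)"
    using push[OF p] by simp
  then show ?thesis
    using tgt.dens_nonneg[of "f p"] by (simp add: zero_less_mult_iff)
qed

text \<open>A vector killed by \<open>Df\<close> is horizontal by the contact condition, and |B| <
  |A| makes the differential injective on horizontal vectors. In finite dimension it is then
  invertible.\<close>

lemma finv_has_derivative:
  assumes q: "q \<in> W'"
  obtains G' where "(finv has_derivative G') (at q)" "\<And>v. Df (finv q) (G' v) = v"
proof -
  define p where "p = finv q"
  have p: "p \<in> W" "f p = q" using q finv_in f_finv by (auto simp: p_def)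
  interpret Df: bounded_linear "Df p" using linear_Df p by simp
  have "inj (Df p)"
    unfolding linear_injective_0[OF Df.linear_axioms]
  proof (intro allI impI)
    fix v assume v: "Df p v = 0"
    then have "contact_form p v = 0"
      using contact_Df_iff[OF p(1), of v] by (simp add: contact_form_eq)
    then have v_hor: "v = hor p (fst v)" by (simp add: contact_form_eq_0_iff)
    then have "A p * fst v + B p * cnj (fst v) = 0"
      using v Df_hor_fst[OF p(1), of "fst v"] by simp
    then have "cmod (A p) * cmod (fst v) = cmod (B p) * cmod (fst v)"
      by (metis add_eq_0_iff complex_mod_cnj norm_minus_cancel norm_mult)
    then have "fst v = 0" using A_gt_B[OF p(1)] by auto
    then show "v = 0" using v_hor by (simp add: hor_def zero_prod_def)
  qed
  then have "surj (Df p)"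
    by (rule linear_injective_imp_surjective[OF Df.linear_axioms]) simp
  then obtain G' where G': "linear G'" "Df p \<circ> G' = id"
    using linear_surjective_right_inverse[OF Df.linear_axioms] by auto
  have "(finv has_derivative G') (at q)"
    using src.open_lift p has_derivative_f finv_f G' C2_on_imp_continuous_on[OF qc(2)]
    by (intro has_derivative_inverse_strong_x[of W finv q f "Df p" G']) (auto simp: p_def)
  then show ?thesis
    using that G' by (metis comp_apply id_apply p_def)
qed

text \<open>On horizontal vectors \<open>Df\<close> stretches at least by |A| - |B|. The identity of
  densities converts this into a contraction of the inverse, measured with \<open>dens\<close> on
  both sides.\<close>

lemma finv_horizontal:
  assumes \<gamma>: "(\<gamma> has_vector_derivative hor (\<gamma> s) \<eta>) (at s)" and q: "\<gamma> s \<in> W'"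
  obtains \<zeta> where "((\<lambda>s. finv (\<gamma> s)) has_vector_derivative hor (finv (\<gamma> s)) \<zeta>) (at s)"
    "src.dens (finv (\<gamma> s)) * cmod \<zeta> \<le> tgt.dens (\<gamma> s) * cmod \<eta>"
proof -
  obtain G' where G': "(finv has_derivative G') (at (\<gamma> s))" "\<And>v. Df (finv (\<gamma> s)) (G' v) = v"
    using finv_has_derivative[OF q] by blast
  define p where "p = finv (\<gamma> s)"
  have p: "p \<in> W" "f p = \<gamma> s" using q finv_in f_finv by (auto simp: p_def)
  define v where "v = G' (hor (\<gamma> s) \<eta>)"
  have Dv: "Df p v = hor (\<gamma> s) \<eta>" using G'(2) by (simp add: v_def p_def)
  then have "contact_form p v = 0"
    using contact_Df_iff[OF p(1), of v] p by simp
  then have v: "v = hor p (fst v)" by (simp add: contact_form_eq_0_iff)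
  have "((\<lambda>s. finv (\<gamma> s)) has_vector_derivative v) (at s)"
    using vector_derivative_diff_chain_within[of \<gamma> _ s UNIV finv, OF \<gamma> has_derivative_at_withinI[OF G'(1)]]
    by (simp add: v_def o_def)
  moreover have "A p * fst v + B p * cnj (fst v) = \<eta>"
    using Df_hor_fst[OF p(1), of "fst v"] Dv v by simp
  then have "(cmod (A p) - cmod (B p)) * cmod (fst v) \<le> cmod \<eta>"
    using norm_diff_ineq[of "A p * fst v" "B p * cnj (fst v)"] by (simp add: norm_mult algebra_simps)
  then have "(cmod (A p) - cmod (B p)) * cmod (fst v) * tgt.dens (\<gamma> s) \<le> cmod \<eta> * tgt.dens (\<gamma> s)"
    by (rule mult_right_mono) simp
  then have "src.dens p * cmod (fst v) \<le> tgt.dens (\<gamma> s) * cmod \<eta>"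
    using push[OF p(1)] p by (simp add: mult_ac)
  ultimately show ?thesis
    using that[of "fst v"] v by (simp add: p_def)
qed

end

section \<open>Preimages of horizontal segments\<close>

lemma lipschitz_of_vector_derivative:
  fixes v :: "real \<Rightarrow> complex"
  assumes "\<And>t. t \<in> I \<Longrightarrow> (v has_vector_derivative v' t) (at t)" "\<And>t. t \<in> I \<Longrightarrow> cmod (v' t) \<le> l"
    and "convex I" "s \<in> I" "t \<in> I"
  shows "cmod (v t - v s) \<le> l * \<bar>t - s\<bar>"
proof -
  have "norm (v t - v s) \<le> l * norm (t - s)"
  proof (rule differentiable_bound[OF assms(3) _ _ assms(5,4)])
    fix x assume x: "x \<in> I"
    show "(v has_derivative (\<lambda>h. h *\<^sub>R v' x)) (at x within I)"
      by (rule has_derivative_at_withinI[OF assms(1)[OF x, unfolded has_vector_derivative_def]])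
    show "onorm (\<lambda>h. h *\<^sub>R v' x) \<le> l"
    proof (rule onorm_le)
      fix h
      show "norm (h *\<^sub>R v' x) \<le> l * norm h"
        using mult_left_mono[OF assms(2)[OF x], of "\<bar>h\<bar>"] by (simp add: mult.commute)
    qed
  qed
  then show ?thesis by simp
qed

text \<open>A path with Lipschitz constant \<open>l\<close> whose real part must cover
  \<open>l * T\<close> in time \<open>T\<close> has no slack. Boundary values are required only
  along sequences, since the boundary correspondence gives no more at this stage.\<close>

lemma shortest_crossing:
  fixes v :: "real \<Rightarrow> complex"
  assumes lip: "\<And>s t. s \<in> {0<..<T} \<Longrightarrow> t \<in> {0<..<T} \<Longrightarrow> cmod (v t - v s) \<le> l * \<bar>t - s\<bar>"
    and T: "0 < T"
    and left: "\<And>n. \<sigma> n \<in> {0<..<T}" "\<sigma> \<longlonglongrightarrow> 0" "(\<lambda>n. Re (v (\<sigma> n))) \<longlonglongrightarrow> 0"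
    and right: "\<And>n. \<tau> n \<in> {0<..<T}" "\<tau> \<longlonglongrightarrow> T" "(\<lambda>n. Re (v (\<tau> n))) \<longlonglongrightarrow> l * T"
    and s: "s \<in> {0<..<T}" and t: "t \<in> {0<..<T}"
  shows "Re (v s) = l * s" "Im (v s) = Im (v t)"
proof -
  have Re: "Re (v s) = l * s" if s: "s \<in> {0<..<T}" for s
  proof (rule antisym)
    have "Re (v s) \<le> Re (v (\<sigma> n)) + l * \<bar>s - \<sigma> n\<bar>" for n
      using lip[OF left(1)[of n] s] complex_Re_le_cmod[of "v s - v (\<sigma> n)"] by simp
    moreover have "(\<lambda>n. Re (v (\<sigma> n)) + l * \<bar>s - \<sigma> n\<bar>) \<longlonglongrightarrow> 0 + l * \<bar>s - 0\<bar>"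
      by (intro tendsto_intros left)
    ultimately have "Re (v s) \<le> 0 + l * \<bar>s - 0\<bar>"
      by (intro LIMSEQ_le_const) auto
    then show "Re (v s) \<le> l * s" using s by simp
    have "Re (v (\<tau> n)) - l * \<bar>\<tau> n - s\<bar> \<le> Re (v s)" for n
      using lip[OF s right(1)[of n]] complex_Re_le_cmod[of "v (\<tau> n) - v s"] by simp
    moreover have "(\<lambda>n. Re (v (\<tau> n)) - l * \<bar>\<tau> n - s\<bar>) \<longlonglongrightarrow> l * T - l * \<bar>T - s\<bar>"
      by (intro tendsto_intros right)
    ultimately have "l * T - l * \<bar>T - s\<bar> \<le> Re (v s)"
      by (intro LIMSEQ_le_const2) auto
    then show "l * s \<le> Re (v s)" using s by (simp add: algebra_simps)
  qed
  show "Re (v s) = l * s" using Re[OF s] .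
  \<comment> \<open>The real part already exhausts the Lipschitz bound and leaves nothing for the
    imaginary part.\<close>
  have "(cmod (v t - v s))\<^sup>2 \<le> (l * \<bar>t - s\<bar>)\<^sup>2"
    using lip[OF s t] by (rule power_mono) simp
  then have "(Im (v t - v s))\<^sup>2 \<le> 0"
    using Re[OF s] Re[OF t] by (simp add: cmod_power2 power_mult_distrib right_diff_distrib[symmetric])
  then show "Im (v s) = Im (v t)" by simp
qed

section \<open>Boundary behaviour of preimages\<close>

context rectangle_chart
begin

lemma boundary_subset_sides:
  assumes "\<zeta> \<in> cbox 0 (Complex a b)" "\<zeta> \<notin> rect a b"
  shows "\<zeta> \<in> left_side a b \<union> right_side a b \<union> bottom_side a b \<union> top_side a b"
  using assms by (auto simp: in_cbox_complex_iff rect_def left_side_def right_side_def bottom_side_def top_side_def)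

lemma sides_subset:
  "left_side a b \<union> right_side a b \<union> bottom_side a b \<union> top_side a b \<subseteq> cbox 0 (Complex a b)"
  using a_pos b_pos by (auto simp: in_cbox_complex_iff left_side_def right_side_def bottom_side_def top_side_def)

end

context chart_pair
begin

abbreviation side_pairs :: "(complex set \<times> complex set) set" where
  "side_pairs \<equiv> {(left_side a b, left_side a' b'), (right_side a b, right_side a' b'),
    (bottom_side a b, bottom_side a' b'), (top_side a b, top_side a' b')}"

lemma extension:
  obtains F where "continuous_on (closure W) F" "\<And>p. p \<in> W \<Longrightarrow> F p = f p"
    "\<And>S S'. (S, S') \<in> side_pairs \<Longrightarrow>
      F ` (hproj -` \<phi> ` S) = hproj -` \<psi> ` S'"
proof -
  obtain F where F: "continuous_on (closure W) F" "\<forall>p\<in>W. F p = f p"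
    "F ` (hproj -` \<phi> ` left_side a b) = hproj -` \<psi> ` left_side a' b'"
    "F ` (hproj -` \<phi> ` right_side a b) = hproj -` \<psi> ` right_side a' b'"
    "F ` (hproj -` \<phi> ` bottom_side a b) = hproj -` \<psi> ` bottom_side a' b'"
    "F ` (hproj -` \<phi> ` top_side a b) = hproj -` \<psi> ` top_side a' b'"
    using f unfolding qc_class_def mem_Collect_eq by (elim conjE exE)
  show thesis
  proof (rule that[of F])
    fix S S'
    assume "(S, S') \<in> side_pairs"
    then show "F ` (hproj -` \<phi> ` S) = hproj -` \<psi> ` S'"
      by (elim insertE emptyE Pair_inject) (simp_all only: F(3-6))
  qed (use F(1,2) in auto)
qed

text \<open>A limit point of the sequence cannot lie over another side, because the extension of \<open>f\<close> respects
  the sides and \<open>\<psi> (Complex c' y)\<close> is not a corner.\<close>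

lemma side_limit:
  assumes p: "\<And>n. p n \<in> W" and lim: "(\<lambda>n. hproj (f (p n))) \<longlonglongrightarrow> \<psi> (Complex c' y)"
    and y: "0 < y" "y < b'" and c: "(c, c') = (0, 0) \<or> (c, c') = (a, a')"
  obtains r where "strict_mono r" "(\<lambda>n. Re (src.\<Phi> (hproj (p (r n))))) \<longlonglongrightarrow> c"
proof -
  obtain F where F: "continuous_on (closure W) F" "\<And>p. p \<in> W \<Longrightarrow> F p = f p"
    "\<And>S S'. (S, S') \<in> side_pairs \<Longrightarrow>
      F ` (hproj -` \<phi> ` S) = hproj -` \<psi> ` S'"
    using extension by blast
  have "compact (closure W)"
    using src.bounded_lift by (simp add: compact_closure)
  then obtain p0 r where r: "strict_mono r" "p0 \<in> closure W" "(\<lambda>n. p (r n)) \<longlonglongrightarrow> p0"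
    using p closure_subset unfolding compact_def o_def by (metis subsetD)
  have "(\<lambda>n. F (p (r n))) \<longlonglongrightarrow> F p0"
    using continuous_on_tendsto_compose[OF F(1) r(3,2)] subsetD[OF closure_subset p] by simp
  then have "(\<lambda>n. f (p (r n))) \<longlonglongrightarrow> F p0"
    using F(2) p by simp
  then have "(\<lambda>n. hproj (f (p (r n)))) \<longlonglongrightarrow> hproj (F p0)"
    by (rule continuous_on_tendsto_compose[OF continuous_on_hproj[of UNIV]]) auto
  moreover have "(\<lambda>n. hproj (f (p (r n)))) \<longlonglongrightarrow> \<psi> (Complex c' y)"
    using LIMSEQ_subseq_LIMSEQ[OF lim r(1)] by (simp add: o_def)
  ultimately have Fp0: "hproj (F p0) = \<psi> (Complex c' y)"
    by (rule LIMSEQ_unique)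
  have c'y: "Complex c' y \<in> cbox 0 (Complex a' b')" "Complex c' y \<notin> rect a' b'"
    using c y tgt.a_pos by (auto simp: in_cbox_complex_iff rect_def)
  have limp: "(\<lambda>n. hproj (p (r n))) \<longlonglongrightarrow> hproj p0"
    by (rule continuous_on_tendsto_compose[OF continuous_on_hproj[of UNIV] r(3)]) auto
  have cl: "hproj p0 \<in> closure \<Omega>"
    unfolding closure_sequential using p by (intro exI[of _ "\<lambda>n. hproj (p (r n))"]) (simp add: limp)
  obtain h where h: "homeomorphism (cbox 0 (Complex a b)) (closure \<Omega>) \<phi> h"
    using src.homeo by blast
  have h_eq: "h w = src.\<Phi> w" if "w \<in> \<Omega>" for w
  proof -
    have "src.\<Phi> w \<in> cbox 0 (Complex a b)"
      using src.inv_in[OF that] box_subset_cbox unfolding rect_eq_box by blast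
    then show ?thesis
      using homeomorphism_apply1[OF h, of "src.\<Phi> w"] src.map_inv[OF that] by simp
  qed
  have "(\<lambda>n. h (hproj (p (r n)))) \<longlonglongrightarrow> h (hproj p0)"
    using h subsetD[OF closure_subset[of \<Omega>], of "hproj (p (r _))"] p unfolding homeomorphism_def
    by (intro continuous_on_tendsto_compose[OF _ limp cl]) auto
  then have lim_h: "(\<lambda>n. src.\<Phi> (hproj (p (r n)))) \<longlonglongrightarrow> h (hproj p0)"
    using h_eq p by simp
  define \<zeta> where "\<zeta> = h (hproj p0)"
  have \<zeta>: "\<zeta> \<in> cbox 0 (Complex a b)" "\<phi> \<zeta> = hproj p0"
    using h cl unfolding homeomorphism_def \<zeta>_def by auto
  \<comment> \<open>Over an interior point \<open>F\<close> agrees with \<open>f\<close> and takes a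
    value over \<Omega>', whereas \<psi> sends boundary points outside \<Omega>'.\<close>
  have "\<zeta> \<notin> rect a b"
  proof
    assume "\<zeta> \<in> rect a b"
    then have p0: "p0 \<in> W" using \<zeta>(2) src.map_in by (metis vimageI2)
    then have "\<psi> (Complex c' y) \<in> \<Omega>'"
      using F(2)[OF p0] Fp0 f_in[OF p0] by auto
    then show False using tgt.boundary_notin c'y by blast
  qed
  have side: "Complex c' y \<in> S'" if "\<zeta> \<in> S" "(S, S') \<in> side_pairs" for S S'
  proof -
    have "p0 \<in> hproj -` \<phi> ` S" using that(1) \<zeta>(2) by (metis imageI vimageI2)
    then have "F p0 \<in> hproj -` \<psi> ` S'" using F(3)[OF that(2)] by blast
    then obtain \<xi> where \<xi>: "\<xi> \<in> S'" "\<psi> (Complex c' y) = \<psi> \<xi>" using Fp0 by auto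
    moreover have "\<xi> \<in> cbox 0 (Complex a' b')"
      using \<xi>(1) that(2) tgt.sides_subset by auto
    ultimately show ?thesis
      using inj_onD[OF tgt.inj_closed] c'y by metis
  qed
  have "Re \<zeta> = c"
  proof -
    have "\<zeta> \<in> left_side a b \<union> right_side a b \<union> bottom_side a b \<union> top_side a b"
      using src.boundary_subset_sides[OF \<zeta>(1) \<open>\<zeta> \<notin> rect a b\<close>] .
    moreover have "\<zeta> \<notin> bottom_side a b"
      using side[of "bottom_side a b" "bottom_side a' b'"] y by (auto simp: bottom_side_def)
    moreover have "\<zeta> \<notin> top_side a b"
      using side[of "top_side a b" "top_side a' b'"] y by (auto simp: top_side_def)
    moreover have "c' = 0" if "\<zeta> \<in> left_side a b"
      using side[of "left_side a b" "left_side a' b'"] that by (auto simp: left_side_def)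
    moreover have "c' = a'" if "\<zeta> \<in> right_side a b"
      using side[of "right_side a b" "right_side a' b'"] that by (auto simp: right_side_def)
    ultimately show ?thesis
      using c src.a_pos tgt.a_pos by (auto simp: left_side_def right_side_def)
  qed
  then have "(\<lambda>n. Re (src.\<Phi> (hproj (p (r n))))) \<longlonglongrightarrow> c"
    using tendsto_Re[OF lim_h] by (simp add: \<zeta>_def)
  with r(1) that show ?thesis by blast
qed

end

context straight_chart
begin

text \<open>The angle matters only modulo a full turn, so an arbitrary choice of it may later be
  replaced by a differentiable one.\<close>

lemma E_cong: "exp (\<i> * of_real \<theta>) = exp (\<i> * of_real \<theta>') \<Longrightarrow> E x y \<theta> = E x y \<theta>'"
proof -
  assume *: "exp (\<i> * of_real \<theta>) = exp (\<i> * complex_of_real \<theta>')"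
  have "fst (E x y \<theta>) = exp (L (Complex x y) + of_real (ee y / 2) - \<i> * of_real (x * ee' y / 2)) * exp (\<i> * of_real \<theta>)" for \<theta>
    by (simp add: E_def exp_add[symmetric] algebra_simps)
  with * show ?thesis by (simp add: prod_eq_iff) (simp add: E_def)
qed

text \<open>The \<open>x\<close>-lines project to horizontal segments traversed with unit speed in
  the chart, and \<open>a * dens\<close> measures chart speed.\<close>

lemma E_horizontal:
  assumes "Complex x y \<in> rect a b"
  obtains \<zeta> where "((\<lambda>x. E x y \<theta>) has_vector_derivative hor (E x y \<theta>) \<zeta>) (at x)" "dens (E x y \<theta>) * cmod \<zeta> = 1 / a"
proof -
  obtain \<zeta> where \<zeta>: "((\<lambda>x. E x y \<theta>) has_vector_derivative hor (E x y \<theta>) \<zeta>) (at x)"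
    using E_has_derivative[OF assms] by blast
  have "((\<lambda>x. hproj (E x y \<theta>)) has_vector_derivative deriv \<phi> (Complex x y)) (at x)"
    by (rule has_vector_derivative_transform_within_open[OF has_vector_derivative_horizontal_line[OF has_deriv[OF assms]], of "{0<..<a}"])
      (use assms hproj_E in auto)
  from vector_derivative_unique_at[OF has_vector_derivative_hproj_hor[OF \<zeta>] this]
  have "cmod (2 * \<i> * cnj (fst (E x y \<theta>)) * \<zeta>) = cmod (deriv \<phi> (Complex x y))" by simp
  then have "2 * cmod (fst (E x y \<theta>)) * cmod \<zeta> = cmod (deriv \<phi> (Complex x y))"
    by (simp add: norm_mult)
  then have "dens (E x y \<theta>) * cmod \<zeta> = 1 / a"
    using deriv_nonzero[OF assms] a_pos by (simp add: dens_def hproj_E[OF assms] inv_map[OF assms])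
  with \<zeta> that show ?thesis by blast
qed

end

section \<open>Segments are mapped to segments\<close>

context straight_chart_pair
begin

definition k :: real where "k = a' / a"

lemma k_pos: "0 < k"
  using src.a_pos tgt.a_pos by (simp add: k_def)

text \<open>The preimages of the lifted horizontal segments are at least as long as the lifted horizontal
  segments of the source, and at most as long by the pointwise identity of densities.\<close>

lemma preimage_of_segment:
  fixes \<theta> :: real
  assumes y: "0 < y" "y < b'" and s: "s \<in> {0<..<a'}" and t: "t \<in> {0<..<a'}"
  defines "v \<equiv> \<lambda>s. src.\<Phi> (hproj (finv (tgt.E s y \<theta>)))"
  shows "Re (v s) = s / k" "Im (v s) = Im (v t)"
    and "\<exists>\<zeta>. ((\<lambda>s. finv (tgt.E s y \<theta>)) has_vector_derivative hor (finv (tgt.E s y \<theta>)) \<zeta>) (at s)"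
proof -
  define \<gamma> where "\<gamma> s = tgt.E s y \<theta>" for s
  have R: "Complex s y \<in> rect a' b'" if "s \<in> {0<..<a'}" for s
    using that y by auto
  have \<gamma>_in: "\<gamma> s \<in> W'" if "s \<in> {0<..<a'}" for s
    using tgt.hproj_E[OF R[OF that]] R[OF that] by (simp add: \<gamma>_def)
  have der: "\<exists>v'. (v has_vector_derivative v') (at s) \<and> cmod v' \<le> 1 / k \<and>
      (\<exists>\<zeta>. ((\<lambda>s. finv (\<gamma> s)) has_vector_derivative hor (finv (\<gamma> s)) \<zeta>) (at s))" if s: "s \<in> {0<..<a'}" for s
  proof -
    obtain \<eta> where \<eta>: "(\<gamma> has_vector_derivative hor (\<gamma> s) \<eta>) (at s)" "tgt.dens (\<gamma> s) * cmod \<eta> = 1 / a'"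
      using tgt.E_horizontal[OF R[OF s], of \<theta>] unfolding \<gamma>_def by blast
    obtain \<zeta> where \<zeta>: "((\<lambda>s. finv (\<gamma> s)) has_vector_derivative hor (finv (\<gamma> s)) \<zeta>) (at s)"
      "src.dens (finv (\<gamma> s)) * cmod \<zeta> \<le> tgt.dens (\<gamma> s) * cmod \<eta>"
      using finv_horizontal[OF \<eta>(1) \<gamma>_in[OF s]] by blast
    define p where "p = finv (\<gamma> s)"
    have p: "hproj p \<in> \<Omega>" using finv_in[OF \<gamma>_in[OF s]] by (simp add: p_def)
    have "(v has_vector_derivative (2 * \<i> * cnj (fst p) * \<zeta>) * inverse (deriv \<phi> (src.\<Phi> (hproj p)))) (at s)"
      using field_vector_diff_chain_at[OF has_vector_derivative_hproj_hor[OF \<zeta>(1)] src.has_deriv_inv[OF p[unfolded p_def]]]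
      unfolding v_def \<gamma>_def[symmetric] p_def by (simp add: o_def)
    \<comment> \<open>Since \<open>a * dens\<close> is the chart speed of a horizontal unit vector,
      the density inequality of \<open>finv_horizontal\<close> becomes a speed bound.\<close>
    moreover have "cmod ((2 * \<i> * cnj (fst p) * \<zeta>) * inverse (deriv \<phi> (src.\<Phi> (hproj p)))) = a * (src.dens p * cmod \<zeta>)"
      using src.a_pos by (simp add: norm_mult norm_inverse src.dens_def divide_inverse)
    moreover have "a * (src.dens p * cmod \<zeta>) \<le> 1 / k"
      using mult_left_mono[OF \<zeta>(2), of a] src.a_pos unfolding \<eta>(2) p_def by (simp add: k_def)
    ultimately show ?thesis using \<zeta>(1) by auto
  qed
  then obtain v' where v': "\<And>s. s \<in> {0<..<a'} \<Longrightarrow> (v has_vector_derivative v' s) (at s)"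
    "\<And>s. s \<in> {0<..<a'} \<Longrightarrow> cmod (v' s) \<le> 1 / k"
    by metis
  have lip: "cmod (v t - v s) \<le> 1 / k * \<bar>t - s\<bar>" if "s \<in> {0<..<a'}" "t \<in> {0<..<a'}" for s t
    by (rule lipschitz_of_vector_derivative[OF v' _ that]) auto
  \<comment> \<open>Compactness yields limits only after passing to a subsequence, which is all that
    \<open>shortest_crossing\<close> asks for.\<close>
  have end_limit: "\<exists>\<tau>. (\<forall>n. \<tau> n \<in> {0<..<a'}) \<and> \<tau> \<longlonglongrightarrow> c' \<and> (\<lambda>n. Re (v (\<tau> n))) \<longlonglongrightarrow> c"
    if \<sigma>: "\<And>n. \<sigma> n \<in> {0<..<a'}" "\<sigma> \<longlonglongrightarrow> c'" and c: "(c, c') = (0, 0) \<or> (c, c') = (a, a')" for \<sigma> c c'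
  proof -
    have "hproj (f (finv (\<gamma> (\<sigma> n)))) = \<psi> (Complex (\<sigma> n) y)" for n
      using f_finv[OF \<gamma>_in[OF \<sigma>(1)]] tgt.hproj_E[OF R[OF \<sigma>(1)]] by (simp add: \<gamma>_def)
    moreover have "(\<lambda>n. \<psi> (Complex (\<sigma> n) y)) \<longlonglongrightarrow> \<psi> (Complex c' y)"
    proof (rule continuous_on_tendsto_compose[OF tgt.continuous_closed])
      show "(\<lambda>n. Complex (\<sigma> n) y) \<longlonglongrightarrow> Complex c' y"
        by (intro tendsto_intros \<sigma>)
      show "Complex c' y \<in> cbox 0 (Complex a' b')"
        using c y tgt.a_pos by (auto simp: in_cbox_complex_iff)
      have "Complex (\<sigma> n) y \<in> cbox 0 (Complex a' b')" for n
        using \<sigma>(1)[of n] y by (auto simp: in_cbox_complex_iff)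
      then show "\<forall>\<^sub>F n in sequentially. Complex (\<sigma> n) y \<in> cbox 0 (Complex a' b')" by simp
    qed
    ultimately have "(\<lambda>n. hproj (f (finv (\<gamma> (\<sigma> n))))) \<longlonglongrightarrow> \<psi> (Complex c' y)" by simp
    from side_limit[OF finv_in[OF \<gamma>_in[OF \<sigma>(1)]] this y c]
    obtain r where "strict_mono r" "(\<lambda>n. Re (src.\<Phi> (hproj (finv (\<gamma> (\<sigma> (r n))))))) \<longlonglongrightarrow> c" by blast
    then show ?thesis
      using \<sigma>(1) LIMSEQ_subseq_LIMSEQ[OF \<sigma>(2), of r] by (intro exI[of _ "\<sigma> \<circ> r"]) (auto simp: v_def \<gamma>_def)
  qed
  have "(\<lambda>n. a' * inverse (real (Suc n))) \<longlonglongrightarrow> a' * 0"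
    by (intro tendsto_intros LIMSEQ_inverse_real_of_nat)
  \<comment> \<open>The index is shifted once more because \<open>n = 0\<close> would otherwise give
    the endpoint \<open>a'\<close> itself.\<close>
  then have "(\<lambda>n. a' * inverse (real (Suc (Suc n)))) \<longlonglongrightarrow> 0"
    by (auto dest: LIMSEQ_Suc)
  moreover have in_I: "a' * inverse (real (Suc (Suc n))) \<in> {0<..<a'}" for n
    using tgt.a_pos by (auto simp: field_simps intro!: add_pos_nonneg)
  ultimately obtain \<sigma> where \<sigma>: "\<And>n. \<sigma> n \<in> {0<..<a'}" "\<sigma> \<longlonglongrightarrow> 0" "(\<lambda>n. Re (v (\<sigma> n))) \<longlonglongrightarrow> 0"
    using end_limit[of "\<lambda>n. a' * inverse (real (Suc (Suc n)))" 0 0] by blast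
  have "(\<lambda>n. a' - a' * inverse (real (Suc (Suc n)))) \<longlonglongrightarrow> a' - 0"
    by (intro tendsto_diff tendsto_const) fact
  moreover have "a' - a' * inverse (real (Suc (Suc n))) \<in> {0<..<a'}" for n
    using in_I[of n] by auto
  ultimately obtain \<tau> where \<tau>: "\<And>n. \<tau> n \<in> {0<..<a'}" "\<tau> \<longlonglongrightarrow> a'" "(\<lambda>n. Re (v (\<tau> n))) \<longlonglongrightarrow> a"
    using end_limit[of "\<lambda>n. a' - a' * inverse (real (Suc (Suc n)))" a' a] by auto
  have "1 / k * a' = a" using src.a_pos tgt.a_pos by (simp add: k_def)
  then show "Re (v s) = s / k" "Im (v s) = Im (v t)"
    using shortest_crossing[OF lip tgt.a_pos \<sigma> \<tau>(1,2) _ s t] \<tau>(3) by simp_all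
  show "\<exists>\<zeta>. ((\<lambda>s. finv (tgt.E s y \<theta>)) has_vector_derivative hor (finv (tgt.E s y \<theta>)) \<zeta>) (at s)"
    using der[OF s] unfolding \<gamma>_def by blast
qed

text \<open>Take the target segment through the image of the midpoint. Its preimage is a horizontal
  curve over the segment at height \<open>y\<close> and meets the source segment at the midpoint, so
  uniqueness of horizontal lifts identifies the two.\<close>

lemma f_maps_segments:
  assumes y: "0 < y" "y < b"
  shows "\<exists>h \<theta>'. 0 < h \<and> h < b' \<and> (\<forall>x\<in>{0<..<a}. f (src.E x y \<theta>) = tgt.E (k * x) h \<theta>')"
proof -
  define x0 where "x0 = a / 2"
  have R: "Complex x y \<in> rect a b" if "x \<in> {0<..<a}" for x
    using that y by auto
  have x0: "x0 \<in> {0<..<a}" using src.a_pos by (simp add: x0_def)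
  have W: "src.E x y \<theta> \<in> W" if "x \<in> {0<..<a}" for x
    using src.hproj_E[OF R[OF that]] src.map_in[OF R[OF that]] by simp
  obtain x' h \<theta>' where q: "Complex x' h \<in> rect a' b'" "f (src.E x0 y \<theta>) = tgt.E x' h \<theta>'"
    using tgt.E_surj[OF vimageD[OF f_in[OF W[OF x0]]]] by metis
  then have h: "0 < h" "h < b'" and x': "x' \<in> {0<..<a'}" by auto
  define \<delta> where "\<delta> = (\<lambda>s. finv (tgt.E s h \<theta>'))"
  define v where "v s = src.\<Phi> (hproj (\<delta> s))" for s
  have seg: "Re (v s) = s / k" "Im (v s) = Im (v t)" if "s \<in> {0<..<a'}" "t \<in> {0<..<a'}" for s t
    using preimage_of_segment(1,2)[where \<theta> = \<theta>', OF h that] unfolding v_def \<delta>_def by blast+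
  have \<delta>x': "\<delta> x' = src.E x0 y \<theta>"
    using finv_f[OF W[OF x0]] q by (simp add: \<delta>_def)
  then have vx': "v x' = Complex x0 y"
    by (simp add: v_def src.hproj_E[OF R[OF x0]] src.inv_map[OF R[OF x0]])
  have v: "v s = Complex (s / k) y" if "s \<in> {0<..<a'}" for s
    using seg(1)[OF that x'] seg(2)[OF that x'] vx' by (simp add: complex_eq_iff)
  have x0k: "k * x0 = x'"
    using v[OF x'] vx' k_pos by (simp add: field_simps)
  have in_I: "k * x \<in> {0<..<a'}" if "x \<in> {0<..<a}" for x
    using that k_pos src.a_pos tgt.a_pos by (auto simp: k_def field_simps)
  have \<delta>_in: "\<delta> s \<in> W" if "s \<in> {0<..<a'}" for s
    unfolding \<delta>_def using that h by (intro finv_in) (auto simp: tgt.hproj_E)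
  have eq: "\<delta> (k * x) = src.E x y \<theta>" if x: "x \<in> {0<..<a}" for x
  proof -
    have "\<exists>\<zeta>. ((\<lambda>x. \<delta> (k * x)) has_vector_derivative hor (\<delta> (k * x)) \<zeta>) (at x)" if x: "x \<in> {0<..<a}" for x
    proof -
      obtain \<zeta> where \<zeta>: "(\<delta> has_vector_derivative hor (\<delta> (k * x)) \<zeta>) (at (k * x))"
        using preimage_of_segment(3)[where \<theta> = \<theta>', OF h in_I[OF x] x'] unfolding \<delta>_def by blast
      have "((\<lambda>x. k * x) has_real_derivative k) (at x)"
        by (auto intro!: derivative_eq_intros)
      from vector_diff_chain_at[OF this[unfolded has_real_derivative_iff_has_vector_derivative] \<zeta>]
      have "((\<lambda>x. \<delta> (k * x)) has_vector_derivative k *\<^sub>R hor (\<delta> (k * x)) \<zeta>) (at x)"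
        by (simp add: o_def)
      moreover have "k *\<^sub>R hor (\<delta> (k * x)) \<zeta> = hor (\<delta> (k * x)) (k *\<^sub>R \<zeta>)"
        by (simp add: hor_def scaleR_conv_of_real algebra_simps)
      ultimately show ?thesis by auto
    qed
    then obtain d where d: "\<And>x. x \<in> {0<..<a} \<Longrightarrow> ((\<lambda>x. \<delta> (k * x)) has_vector_derivative hor (\<delta> (k * x)) (d x)) (at x)"
      by metis
    have proj: "hproj (\<delta> (k * x)) = \<phi> (Complex x y)" if x: "x \<in> {0<..<a}" for x
    proof -
      have "src.\<Phi> (hproj (\<delta> (k * x))) = Complex x y"
        using v[OF in_I[OF x]] k_pos by (simp add: v_def)
      then show ?thesis
        using src.map_inv[OF vimageD[OF \<delta>_in[OF in_I[OF x]]]] by simp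
    qed
    show ?thesis
    proof (rule horizontal_lift_unique[where I = "{0<..<a}", OF _ _ d src.E_has_derivative[OF R] _ _ x0 _ x])
      show "hproj (\<delta> (k * x)) = hproj (src.E x y \<theta>)" if "x \<in> {0<..<a}" for x
        using proj[OF that] src.hproj_E[OF R[OF that]] by simp
      show "hproj (\<delta> (k * x)) \<in> upper_half_plane" if "x \<in> {0<..<a}" for x
        using \<delta>_in[OF in_I[OF that]] src.sub by auto
      show "\<delta> (k * x0) = src.E x0 y \<theta>" using \<delta>x' x0k by simp
    qed auto
  qed
  have "f (src.E x y \<theta>) = tgt.E (k * x) h \<theta>'" if x: "x \<in> {0<..<a}" for x
  proof -
    have "tgt.E (k * x) h \<theta>' \<in> W'"
      using in_I[OF x] h by (auto simp: tgt.hproj_E)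
    then show ?thesis
      using eq[OF x] f_finv by (metis \<delta>_def)
  qed
  then show ?thesis using h by blast
qed

end

section \<open>The contact condition in straightening coordinates\<close>

lemma contact_form_linear: "contact_form p (v - c *\<^sub>R w) = contact_form p v - of_real c * contact_form p w"
  by (simp add: contact_form_eq algebra_simps)

context straight_chart
begin

text \<open>At fixed \<open>x\<close> the contact form is
  \<open>Im \<phi> * (x * exp (- 2 * ee y) dy + 2 d\<theta>)\<close>; its \<open>dy\<close>
  coefficient comes from the second derivative of \<open>ee\<close>. Paths are used because the
  image coordinates will be differentiated only along paths.\<close>

lemma E_along_path:
  assumes R: "Complex x (Y s) \<in> rect a b"
    and Y: "(Y has_real_derivative Y') (at s)" and T: "(T has_real_derivative T') (at s)"
  obtains v where "((\<lambda>s. E x (Y s) (T s)) has_vector_derivative v) (at s)"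
    "contact_form (E x (Y s) (T s)) v =
      of_real (Im (\<phi> (Complex x (Y s))) * (x * exp (- 2 * ee (Y s)) * Y' + 2 * T'))"
proof -
  define \<zeta> where "\<zeta> = Complex x (Y s)"
  have y: "0 < Y s" "Y s < b" using R by auto
  define z where "z = fst (E x (Y s) (T s))"
  define w where "w = of_real Y' * (\<i> * deriv L \<zeta>) + of_real (ee' (Y s) * Y' / 2)
    + \<i> * of_real (T' - x * (- exp (- 2 * ee (Y s)) * Y') / 2)"
  have Y': "(Y has_vector_derivative Y') (at s)"
    using Y by (simp add: has_real_derivative_iff_has_vector_derivative)
  have 1: "((\<lambda>s. L (Complex x (Y s))) has_vector_derivative of_real Y' * (\<i> * deriv L \<zeta>)) (at s)"
    using vector_diff_chain_at[OF Y' has_vector_derivative_vertical_line[OF L_has_deriv[OF R]]]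
    by (simp add: o_def \<zeta>_def scaleR_conv_of_real)
  have 2: "((\<lambda>s. ee (Y s)) has_real_derivative ee' (Y s) * Y') (at s)"
    using DERIV_chain2[OF ee_has_derivative[OF y] Y] .
  have 3: "((\<lambda>s. ee' (Y s)) has_real_derivative - exp (- 2 * ee (Y s)) * Y') (at s)"
    using DERIV_chain2[OF ee'_has_derivative[OF y] Y] .
  have "((\<lambda>s. ee (Y s) / 2) has_real_derivative ee' (Y s) * Y' / 2) (at s)"
    by (rule DERIV_cdivide[OF 2])
  moreover have "((\<lambda>s. T s - x * ee' (Y s) / 2) has_real_derivative T' - x * (- exp (- 2 * ee (Y s)) * Y') / 2) (at s)"
    by (rule DERIV_diff[OF T DERIV_cdivide[OF DERIV_cmult[OF 3]]])
  ultimately have 4: "((\<lambda>s. of_real (ee (Y s) / 2) + \<i> * of_real (T s - x * ee' (Y s) / 2)) has_vector_derivative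
      of_real (ee' (Y s) * Y' / 2) + \<i> * of_real (T' - x * (- exp (- 2 * ee (Y s)) * Y') / 2)) (at s)"
    by (intro has_vector_derivative_add has_vector_derivative_mult_right has_vector_derivative_of_real)
  have "((\<lambda>s. L (Complex x (Y s)) + (of_real (ee (Y s) / 2) + \<i> * of_real (T s - x * ee' (Y s) / 2))) has_vector_derivative w) (at s)"
    using has_vector_derivative_add[OF 1 4] unfolding w_def by (simp only: add.assoc)
  from has_vector_derivative_exp[OF this]
  have fst: "((\<lambda>s. fst (E x (Y s) (T s))) has_vector_derivative z * w) (at s)"
    by (simp add: E_def z_def add.assoc)
  have "((\<lambda>s. Re (\<phi> (Complex x (Y s)))) has_vector_derivative Re (of_real Y' * (\<i> * deriv \<phi> \<zeta>))) (at s)"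
    using bounded_linear.has_vector_derivative[OF bounded_linear_Re
        vector_diff_chain_at[OF Y' has_vector_derivative_vertical_line[OF has_deriv[OF R]]]]
    by (simp add: o_def \<zeta>_def)
  then have snd: "((\<lambda>s. snd (E x (Y s) (T s))) has_vector_derivative - Y' * Im (deriv \<phi> \<zeta>)) (at s)"
    by (simp add: E_def)
  have "((\<lambda>s. E x (Y s) (T s)) has_vector_derivative (z * w, - Y' * Im (deriv \<phi> \<zeta>))) (at s)"
    using has_vector_derivative_Pair[OF fst snd] by simp
  moreover have "contact_form (E x (Y s) (T s)) (z * w, - Y' * Im (deriv \<phi> \<zeta>)) =
      of_real (Im (\<phi> \<zeta>) * (x * exp (- 2 * ee (Y s)) * Y' + 2 * T'))"
  proof -
    have zz: "cnj z * (z * w) = of_real (Im (\<phi> \<zeta>)) * w"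
      using arg_cong[OF hproj_E[OF R, of "T s"], of Im] complex_norm_square[of z]
      by (simp add: mult_ac \<zeta>_def z_def)
    have "Im w = Y' * Re (deriv L \<zeta>) + T' + x * (exp (- 2 * ee (Y s)) * Y') / 2"
      by (simp add: w_def)
    then have "Im (cnj z * (z * w)) = Im (\<phi> \<zeta>) * (Y' * Re (deriv L \<zeta>) + T' + x * (exp (- 2 * ee (Y s)) * Y') / 2)"
      unfolding zz by simp
    then show ?thesis
      unfolding contact_form_eq fst_conv snd_conv z_def[symmetric]
      using Im_deriv[of \<zeta>] R by (simp add: \<zeta>_def[symmetric] algebra_simps)
  qed
  ultimately show ?thesis
    using that by (simp add: \<zeta>_def)
qed

end

section \<open>The height of the image and the contact identity\<close>

context straight_chart_pair
begin

text \<open>The abscissa \<open>a / 2\<close> is arbitrary: by \<open>f_E\<close> the same height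
  occurs along the whole segment.\<close>

definition h :: "real \<Rightarrow> real \<Rightarrow> real" where
  "h y \<theta> = Im (tgt.\<Phi> (hproj (f (src.E (a / 2) y \<theta>))))"

lemma kx_in: "x \<in> {0<..<a} \<Longrightarrow> k * x \<in> {0<..<a'}"
  using src.a_pos tgt.a_pos by (auto simp: k_def field_simps)

lemma f_E:
  assumes y: "0 < y" "y < b"
  obtains \<theta>' where "0 < h y \<theta>" "h y \<theta> < b'" "\<And>x. x \<in> {0<..<a} \<Longrightarrow> f (src.E x y \<theta>) = tgt.E (k * x) (h y \<theta>) \<theta>'"
proof -
  obtain h' \<theta>' where h': "0 < h'" "h' < b'" "\<And>x. x \<in> {0<..<a} \<Longrightarrow> f (src.E x y \<theta>) = tgt.E (k * x) h' \<theta>'"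
    using f_maps_segments[OF y] by blast
  have a2: "a / 2 \<in> {0<..<a}" using src.a_pos by simp
  have R: "Complex (k * (a / 2)) h' \<in> rect a' b'"
    using kx_in[OF a2] h' by simp
  have "h y \<theta> = h'"
    unfolding h_def h'(3)[OF a2] tgt.hproj_E[OF R] tgt.inv_map[OF R] by simp
  with h' that show ?thesis by blast
qed

lemma E_in_W: "x \<in> {0<..<a} \<Longrightarrow> 0 < y \<Longrightarrow> y < b \<Longrightarrow> src.E x y \<theta> \<in> W"
  by (simp add: src.hproj_E)

text \<open>\<open>f_E\<close> chooses the angle of the image pointwise, without any regularity;
  here it is replaced by a branch differentiable at \<open>s0\<close>. As \<open>h'\<close> and
  \<open>T'\<close> are the same for all \<open>x\<close>, the contact form of the image velocity is
  affine in \<open>x\<close> up to the factor |f_1|^2.\<close>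

lemma f_along_path:
  assumes I: "open I" "s0 \<in> I" and Y_in: "\<And>s. s \<in> I \<Longrightarrow> 0 < Y s \<and> Y s < b"
    and Y: "(Y has_real_derivative Y') (at s0)" and \<Theta>: "(\<Theta> has_real_derivative \<Theta>') (at s0)"
  shows "\<exists>h' T'. ((\<lambda>s. h (Y s) (\<Theta> s)) has_real_derivative h') (at s0) \<and>
    (\<forall>x\<in>{0<..<a}. \<forall>v. ((\<lambda>s. src.E x (Y s) (\<Theta> s)) has_vector_derivative v) (at s0) \<longrightarrow>
      contact_form (f (src.E x (Y s0) (\<Theta> s0))) (Df (src.E x (Y s0) (\<Theta> s0)) v) =
        of_real ((cmod (fst (f (src.E x (Y s0) (\<Theta> s0)))))\<^sup>2 *
          (k * x * exp (- 2 * tgt.ee (h (Y s0) (\<Theta> s0))) * h' + 2 * T')))"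
proof -
  define H where "H s = h (Y s) (\<Theta> s)" for s
  define x0 where "x0 = a / 2"
  have x0: "x0 \<in> {0<..<a}" using src.a_pos by (simp add: x0_def)
  have "\<exists>\<theta>'. \<forall>x\<in>{0<..<a}. f (src.E x (Y s) (\<Theta> s)) = tgt.E (k * x) (H s) \<theta>'" if "s \<in> I" for s
    using f_E[of "Y s" "\<Theta> s"] Y_in[OF that] unfolding H_def by metis
  then obtain \<tau> where \<tau>: "\<And>s x. s \<in> I \<Longrightarrow> x \<in> {0<..<a} \<Longrightarrow> f (src.E x (Y s) (\<Theta> s)) = tgt.E (k * x) (H s) (\<tau> s)"
    by metis
  have H_in: "0 < H s" "H s < b'" if "s \<in> I" for s
    using f_E[of "Y s" "\<Theta> s"] Y_in[OF that] unfolding H_def by metis+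
  have R': "Complex (k * x) (H s) \<in> rect a' b'" if "s \<in> I" "x \<in> {0<..<a}" for s x
    using H_in[OF that(1)] kx_in[OF that(2)] by simp
  have p_in: "src.E x (Y s) (\<Theta> s) \<in> W" if "s \<in> I" "x \<in> {0<..<a}" for s x
    using E_in_W[OF that(2)] Y_in[OF that(1)] by simp
  have f_path: "((\<lambda>s. f (src.E x (Y s) (\<Theta> s))) has_vector_derivative Df (src.E x (Y s0) (\<Theta> s0)) v) (at s0)"
    if "x \<in> {0<..<a}" "((\<lambda>s. src.E x (Y s) (\<Theta> s)) has_vector_derivative v) (at s0)" for x v
    using vector_derivative_diff_chain_within[OF that(2) has_derivative_at_withinI[OF has_derivative_f[OF p_in[OF I(2) that(1)]]]]
    by (simp add: o_def)
  have R: "Complex x0 (Y s0) \<in> rect a b" using x0 Y_in[OF I(2)] by simp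
  obtain v0 where v0: "((\<lambda>s. src.E x0 (Y s) (\<Theta> s)) has_vector_derivative v0) (at s0)"
    using src.E_along_path[of x0 Y s0, OF R Y \<Theta>] by blast
  define w where "w = Df (src.E x0 (Y s0) (\<Theta> s0)) v0"
  have w: "((\<lambda>s. f (src.E x0 (Y s) (\<Theta> s))) has_vector_derivative w) (at s0)"
    using f_path[OF x0 v0] by (simp add: w_def)
  obtain h' where h': "(H has_real_derivative h') (at s0)"
  proof -
    define q where "q = f (src.E x0 (Y s0) (\<Theta> s0))"
    have q: "hproj q \<in> \<Omega>'" using f_in[OF p_in[OF I(2) x0]] by (simp add: q_def)
    obtain u where u: "((\<lambda>s. hproj (f (src.E x0 (Y s) (\<Theta> s)))) has_vector_derivative u) (at s0)"
      using vector_derivative_diff_chain_within[OF w has_derivative_at_withinI[OF hproj_has_derivative]]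
      by (auto simp: o_def)
    from Im_vector_derivative[OF field_vector_diff_chain_at[OF u tgt.has_deriv_inv[OF q[unfolded q_def]]]]
    show ?thesis
      by (intro that) (simp add: H_def[abs_def] h_def x0_def o_def)
  qed
  \<comment> \<open>The phase is a quotient of first coordinates and thus differentiable, although
    nothing is known about the continuity of \<tau>.\<close>
  define M where "M s = fst (f (src.E x0 (Y s) (\<Theta> s))) / fst (tgt.E (k * x0) (H s) 0)" for s
  have M_exp: "M s = exp (\<i> * of_real (\<tau> s))" if "s \<in> I" for s
    unfolding M_def \<tau>[OF that x0] by (simp add: tgt.E_def exp_diff[symmetric]) (simp add: algebra_simps)
  obtain M' where M': "(M has_vector_derivative M') (at s0)"
  proof -
    obtain u where u: "((\<lambda>s. tgt.E (k * x0) (H s) 0) has_vector_derivative u) (at s0)"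
      using tgt.E_along_path[of "k * x0" H s0, OF R'[OF I(2) x0] h' DERIV_const] by blast
    have "((\<lambda>s. fst (tgt.E (k * x0) (H s) 0)) has_vector_derivative fst u) (at s0)"
      using bounded_linear.has_vector_derivative[OF bounded_linear_fst u] .
    moreover have "((\<lambda>s. fst (f (src.E x0 (Y s) (\<Theta> s)))) has_vector_derivative fst w) (at s0)"
      using bounded_linear.has_vector_derivative[OF bounded_linear_fst w] .
    ultimately show ?thesis
      using that has_vector_derivative_divide_complex[where s = s0] tgt.fst_E_nonzero unfolding M_def by blast
  qed
  \<comment> \<open>Dividing by \<open>M s0\<close> moves the argument of \<open>Ln\<close> to 1 at
    \<open>s0\<close>, away from the branch cut; differentiability is claimed at \<open>s0\<close>
    only.\<close>
  define T where "T s = Im (Ln (M s / M s0)) + \<tau> s0" for s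
  have M0: "M s0 \<noteq> 0" using M_exp[OF I(2)] by simp
  obtain T' where T': "(T has_real_derivative T') (at s0)"
  proof -
    have "((\<lambda>s. M s / M s0) has_vector_derivative M' / M s0) (at s0)"
      using M' by (rule has_vector_derivative_divide)
    moreover have "(Ln has_field_derivative inverse (M s0 / M s0)) (at (M s0 / M s0))"
      using M0 by (intro has_field_derivative_Ln) auto
    ultimately have "((\<lambda>s. Ln (M s / M s0)) has_vector_derivative M' / M s0 * inverse (M s0 / M s0)) (at s0)"
      by (rule field_vector_diff_chain_at[unfolded o_def])
    from Im_vector_derivative[OF this]
    have "(T has_real_derivative Im (M' / M s0 * inverse (M s0 / M s0)) + 0) (at s0)"
      unfolding T_def by (intro DERIV_add DERIV_const) (simp add: o_def)
    then show ?thesis by (rule that)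
  qed
  have exp_T: "exp (\<i> * of_real (T s)) = exp (\<i> * of_real (\<tau> s))" if s: "s \<in> I" for s
  proof -
    define u where "u = M s / M s0"
    have u: "cmod u = 1" "u \<noteq> 0"
      by (auto simp: u_def M_exp[OF s] M_exp[OF I(2)] norm_divide)
    then have "Ln u = \<i> * of_real (Im (Ln u))"
      by (simp add: complex_eq_iff Re_Ln)
    then have "exp (\<i> * of_real (Im (Ln u))) = u"
      using u exp_Ln by metis
    moreover have "exp (\<i> * of_real (T s)) = exp (\<i> * of_real (Im (Ln u))) * exp (\<i> * of_real (\<tau> s0))"
      by (simp add: T_def u_def[symmetric] exp_add[symmetric] distrib_left)
    ultimately have "exp (\<i> * of_real (T s)) = u * M s0"
      using M_exp[OF I(2)] by simp
    also have "\<dots> = M s" using M0 by (simp add: u_def)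
    finally show ?thesis using M_exp[OF s] by simp
  qed
  have f_eq: "f (src.E x (Y s) (\<Theta> s)) = tgt.E (k * x) (H s) (T s)" if "s \<in> I" "x \<in> {0<..<a}" for s x
    unfolding \<tau>[OF that] by (rule tgt.E_cong) (rule exp_T[OF that(1), symmetric])
  show ?thesis
  proof (intro exI conjI ballI allI impI)
    show "((\<lambda>s. h (Y s) (\<Theta> s)) has_real_derivative h') (at s0)"
      using h' by (simp add: H_def[abs_def])
  next
    fix x v
    assume x: "x \<in> {0<..<a}" and v: "((\<lambda>s. src.E x (Y s) (\<Theta> s)) has_vector_derivative v) (at s0)"
    obtain w' where w': "((\<lambda>s. tgt.E (k * x) (H s) (T s)) has_vector_derivative w') (at s0)"
      "contact_form (tgt.E (k * x) (H s0) (T s0)) w' =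
        of_real (Im (\<psi> (Complex (k * x) (H s0))) * (k * x * exp (- 2 * tgt.ee (H s0)) * h' + 2 * T'))"
      using tgt.E_along_path[of "k * x" H s0, OF R'[OF I(2) x] h' T'] by blast
    have "((\<lambda>s. f (src.E x (Y s) (\<Theta> s))) has_vector_derivative w') (at s0)"
      using w'(1) by (rule has_vector_derivative_transform_within_open[OF _ I]) (simp only: f_eq[OF _ x])
    from vector_derivative_unique_at[OF f_path[OF x v] this]
    have "contact_form (f (src.E x (Y s0) (\<Theta> s0))) (Df (src.E x (Y s0) (\<Theta> s0)) v) =
        of_real (Im (\<psi> (Complex (k * x) (H s0))) * (k * x * exp (- 2 * tgt.ee (H s0)) * h' + 2 * T'))"
      using w'(2) f_eq[OF I(2) x] by simp
    moreover have "Im (\<psi> (Complex (k * x) (H s0))) = (cmod (fst (f (src.E x (Y s0) (\<Theta> s0)))))\<^sup>2"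
      using arg_cong[OF tgt.hproj_E[OF R'[OF I(2) x], of "T s0"], of Im] f_eq[OF I(2) x] by simp
    ultimately show "contact_form (f (src.E x (Y s0) (\<Theta> s0))) (Df (src.E x (Y s0) (\<Theta> s0)) v) =
        of_real ((cmod (fst (f (src.E x (Y s0) (\<Theta> s0)))))\<^sup>2 * (k * x * exp (- 2 * tgt.ee (h (Y s0) (\<Theta> s0))) * h' + 2 * T'))"
      unfolding H_def by simp
  qed
qed

text \<open>The contact condition becomes a polynomial identity in \<open>x\<close> whose quadratic coefficient is a
  non-zero multiple of the derivative of \<open>h\<close> along the fibres.\<close>

lemma h_derivative_zero:
  assumes y: "0 < y" "y < b"
  shows "((\<lambda>\<theta>. h y \<theta>) has_real_derivative 0) (at \<theta>)"
proof -
  have y_in: "y \<in> {0<..<b}" "\<And>s. s \<in> {0<..<b} \<Longrightarrow> 0 < s \<and> s < b" "\<And>s::real. s \<in> UNIV \<Longrightarrow> 0 < y \<and> y < b"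
    using y by auto
  obtain hy Ty where "((\<lambda>y. h y \<theta>) has_real_derivative hy) (at y)"
    and hy: "\<And>x v. x \<in> {0<..<a} \<Longrightarrow> ((\<lambda>s. src.E x s \<theta>) has_vector_derivative v) (at y) \<Longrightarrow>
      contact_form (f (src.E x y \<theta>)) (Df (src.E x y \<theta>) v) =
        of_real ((cmod (fst (f (src.E x y \<theta>))))\<^sup>2 * (k * x * exp (- 2 * tgt.ee (h y \<theta>)) * hy + 2 * Ty))"
    using f_along_path[OF open_greaterThanLessThan y_in(1,2) DERIV_ident DERIV_const[of \<theta>]] by blast
  obtain ht Tt where ht: "((\<lambda>\<theta>. h y \<theta>) has_real_derivative ht) (at \<theta>)"
    "\<And>x v. x \<in> {0<..<a} \<Longrightarrow> ((\<lambda>s. src.E x y s) has_vector_derivative v) (at \<theta>) \<Longrightarrow>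
      contact_form (f (src.E x y \<theta>)) (Df (src.E x y \<theta>) v) =
        of_real ((cmod (fst (f (src.E x y \<theta>))))\<^sup>2 * (k * x * exp (- 2 * tgt.ee (h y \<theta>)) * ht + 2 * Tt))"
    using f_along_path[OF open_UNIV UNIV_I[of \<theta>] y_in(3) DERIV_const[of y] DERIV_ident] by blast
  define c where "c = exp (- 2 * src.ee y)"
  define c' where "c' = exp (- 2 * tgt.ee (h y \<theta>))"
  have id: "k * x * c' * hy + 2 * Ty = x * c / 2 * (k * x * c' * ht + 2 * Tt)" if x: "x \<in> {0<..<a}" for x
  proof -
    have R: "Complex x y \<in> rect a b" using x y by simp
    define p where "p = src.E x y \<theta>"
    have p: "p \<in> W" using E_in_W[OF x y] by (simp add: p_def)
    define m where "m = Im (\<phi> (Complex x y))"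
    obtain vy where vy: "((\<lambda>s. src.E x s \<theta>) has_vector_derivative vy) (at y)"
      "contact_form p vy = of_real (m * (x * c))"
      using src.E_along_path[of x "\<lambda>s. s" y 1 "\<lambda>_. \<theta>" 0] R unfolding p_def c_def m_def by auto
    obtain vt where vt: "((\<lambda>s. src.E x y s) has_vector_derivative vt) (at \<theta>)"
      "contact_form p vt = of_real (m * 2)"
      using src.E_along_path[of x "\<lambda>_. y" \<theta> 0 "\<lambda>s. s" 1] R unfolding p_def c_def m_def by auto
    define m' where "m' = (cmod (fst (f p)))\<^sup>2"
    have m': "0 < m'"
      using tgt.fst_nonzero[OF vimageD[OF f_in[OF p]]] by (simp add: m'_def)
    interpret Df: bounded_linear "Df p" using linear_Df[OF p] .
    \<comment> \<open>The multiple of the fibre direction is chosen so that the contact form of the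
      combination vanishes; contactness of \<open>f\<close> then relates the two image
      velocities.\<close>
    have "contact_form p (vy - (x * c / 2) *\<^sub>R vt) = 0"
      unfolding contact_form_linear vy(2) vt(2) by (simp add: complex_eq_iff)
    then have "contact_form (f p) (Df p (vy - (x * c / 2) *\<^sub>R vt)) = 0"
      using contact_Df_iff[OF p] by simp
    then have "contact_form (f p) (Df p vy) = of_real (x * c / 2) * contact_form (f p) (Df p vt)"
      unfolding Df.diff Df.scaleR contact_form_linear by simp
    then have "complex_of_real (m' * (k * x * c' * hy + 2 * Ty)) = of_real (x * c / 2 * (m' * (k * x * c' * ht + 2 * Tt)))"
      using hy[OF x vy(1)] ht(2)[OF x vt(1)] unfolding p_def[symmetric] c'_def[symmetric] m'_def[symmetric]
      by (simp only: of_real_mult)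
    then have "m' * (k * x * c' * hy + 2 * Ty) = m' * (x * c / 2 * (k * x * c' * ht + 2 * Tt))"
      unfolding of_real_eq_iff by (simp only: mult_ac)
    then show ?thesis
      using m' by (metis less_irrefl mult_left_cancel)
  qed
  \<comment> \<open>The identity is evaluated at \<alpha>, 2 \<alpha> and 3 \<alpha>, all inside the
    interval; the second difference isolates the quadratic coefficient.\<close>
  define \<alpha> where "\<alpha> = a / 4"
  have \<alpha>: "0 < \<alpha>" "\<alpha> \<in> {0<..<a}" "2 * \<alpha> \<in> {0<..<a}" "3 * \<alpha> \<in> {0<..<a}"
    using src.a_pos by (auto simp: \<alpha>_def)
  define P Q R where "P = k * \<alpha> * c' * hy" and "Q = \<alpha> * c * Tt" and "R = c * k * c' * ht * \<alpha>\<^sup>2"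
  have "P + 2 * Ty = R / 2 + Q" "2 * P + 2 * Ty = 2 * R + 2 * Q" "3 * P + 2 * Ty = 9 / 2 * R + 3 * Q"
    using id[OF \<alpha>(2)] id[OF \<alpha>(3)] id[OF \<alpha>(4)]
    by (simp_all add: P_def Q_def R_def power2_eq_square algebra_simps)
  then have "R = 0" by linarith
  then have "c * k * c' * ht * \<alpha>\<^sup>2 = 0" by (simp add: R_def)
  then have "ht = 0"
    using k_pos \<alpha>(1) by (simp add: c_def c'_def)
  with ht(1) show ?thesis by simp
qed

end

section \<open>The induced planar map\<close>

text \<open>Linearisation with error at most \<open>l / 2\<close> times the radius keeps image
  distances between \<open>l / 2\<close> and \<open>K * l + l / 2\<close> times the radius; the
  quotient of these constants is \<open>2 * K + 1\<close>.\<close>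

lemma dilatation_le:
  fixes g :: "'a::euclidean_space \<Rightarrow> 'a"
  assumes g: "(g has_derivative D) (at p)" and l: "0 < l"
    and lower: "\<And>v. l * norm v \<le> norm (D v)" and upper: "\<And>v. norm (D v) \<le> K * l * norm v"
  shows "dilatation dist S g p \<le> ennreal (2 * K + 1)"
proof -
  obtain d where d: "0 < d" "\<And>q. norm (q - p) < d \<Longrightarrow> norm (g q - g p - D (q - p)) \<le> l / 2 * norm (q - p)"
    using g l unfolding has_derivative_at_alt by (metis half_gt_zero)
  have "(SUP q\<in>{q\<in>S. dist p q = r}. ennreal (dist (g p) (g q))) / (INF q\<in>{q\<in>S. dist p q = r}. ennreal (dist (g p) (g q)))
    \<le> ennreal (2 * K + 1)" if r: "r \<in> {0<..<d}" for r
  proof -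
    have bounds: "l / 2 * r \<le> dist (g p) (g q)" "dist (g p) (g q) \<le> (K * l + l / 2) * r" if "dist p q = r" for q
    proof -
      have n: "norm (q - p) = r" using that by (simp add: dist_norm norm_minus_commute)
      have e: "norm (g q - g p - D (q - p)) \<le> l / 2 * r" using d(2)[of q] r n by simp
      show "l / 2 * r \<le> dist (g p) (g q)"
        using lower[of "q - p"] norm_triangle_ineq3[of "D (q - p)" "g q - g p"] e
        unfolding n dist_norm norm_minus_commute[of "g p"] by (simp add: norm_minus_commute)
      show "dist (g p) (g q) \<le> (K * l + l / 2) * r"
        using upper[of "q - p"] norm_triangle_ineq2[of "g q - g p" "D (q - p)"] e
        unfolding n dist_norm norm_minus_commute[of "g p"] by (simp add: algebra_simps)
    qed
    have "0 \<le> K * l"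
    proof -
      obtain u :: 'a where "norm u = 1" using vector_choose_size[of 1] by auto
      then show ?thesis using upper[of u] by (metis mult.right_neutral norm_ge_zero order_trans)
    qed
    have "(SUP q\<in>{q\<in>S. dist p q = r}. ennreal (dist (g p) (g q))) \<le> ennreal ((K * l + l / 2) * r)"
      using bounds(2) by (intro SUP_least ennreal_leI) auto
    moreover have INF: "ennreal (l / 2 * r) \<le> (INF q\<in>{q\<in>S. dist p q = r}. ennreal (dist (g p) (g q)))"
      using bounds(1) by (intro INF_greatest ennreal_leI) auto
    moreover have "ennreal ((K * l + l / 2) * r) = ennreal (2 * K + 1) * ennreal (l / 2 * r)"
      using \<open>0 \<le> K * l\<close> l r by (subst ennreal_mult[symmetric]) (auto simp: field_simps zero_le_mult_iff)
    ultimately have "(SUP q\<in>{q\<in>S. dist p q = r}. ennreal (dist (g p) (g q))) \<le>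
        ennreal (2 * K + 1) * (INF q\<in>{q\<in>S. dist p q = r}. ennreal (dist (g p) (g q)))"
      using mult_left_mono[OF INF, of "ennreal (2 * K + 1)"] by (simp del: ennreal_plus)
    moreover have "0 < (INF q\<in>{q\<in>S. dist p q = r}. ennreal (dist (g p) (g q)))"
      using less_le_trans[OF _ INF, of 0] l r by simp
    ultimately show ?thesis
      by (intro divide_le_posI_ennreal) (auto simp: mult.commute)
  qed
  then show ?thesis
    unfolding dilatation_def using d(1)
    by (intro Limsup_bounded) (auto simp: eventually_at_right_field intro!: exI[of _ d])
qed

lemma C2_on_subset: "C2_on f S \<Longrightarrow> T \<subseteq> S \<Longrightarrow> C2_on f T"
  unfolding C2_on_def by (meson continuous_on_subset subsetD)

section \<open>The height function of the induced map\<close>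

context straight_chart_pair
begin

definition H :: "real \<Rightarrow> real" where "H y = h y 0"

lemma H_eq: "0 < y \<Longrightarrow> y < b \<Longrightarrow> h y \<theta> = H y"
  unfolding H_def using DERIV_isconst_all[of "h y" \<theta> 0] h_derivative_zero by blast

lemma H_in: "0 < y \<Longrightarrow> y < b \<Longrightarrow> 0 < H y \<and> H y < b'"
  unfolding H_def using f_E[of y 0] by metis

lemma chart_f:
  assumes "p \<in> W"
  shows "tgt.\<Phi> (hproj (f p)) = Complex (k * Re (src.\<Phi> (hproj p))) (H (Im (src.\<Phi> (hproj p))))"
proof -
  obtain x y \<theta> where xy: "Complex x y \<in> rect a b" "src.\<Phi> (hproj p) = Complex x y" "p = src.E x y \<theta>"
    using src.E_surj[OF vimageD[OF assms]] by metis
  then have y: "0 < y" "y < b" and x: "x \<in> {0<..<a}" by auto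
  obtain \<theta>' where "0 < h y \<theta>" "h y \<theta> < b'" "f (src.E x y \<theta>) = tgt.E (k * x) (h y \<theta>) \<theta>'"
    using f_E[OF y, of \<theta>] x by metis
  moreover have "Complex (k * x) (h y \<theta>) \<in> rect a' b'"
    using calculation kx_in[OF x] by simp
  ultimately show ?thesis
    using xy H_eq[OF y, of \<theta>] by (simp add: tgt.hproj_E tgt.inv_map)
qed

text \<open>Surjectivity of \<open>f\<close> passes to heights: a target point over the height
  \<open>y'\<close> has a preimage, and \<open>chart_f\<close> relates the two heights.\<close>

lemma H_surj:
  assumes "0 < y'" "y' < b'"
  obtains y where "0 < y" "y < b" "H y = y'"
proof -
  have R: "Complex (a' / 2) y' \<in> rect a' b'" using assms tgt.a_pos by simp
  define q where "q = hsection (\<psi> (Complex (a' / 2) y'))"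
  have q: "hproj q = \<psi> (Complex (a' / 2) y')"
    unfolding q_def using tgt.map_in[OF R] tgt.sub by (intro hproj_hsection) auto
  then have qW: "q \<in> W'" using tgt.map_in[OF R] by simp
  define \<zeta> where "\<zeta> = src.\<Phi> (hproj (finv q))"
  have "\<zeta> \<in> rect a b" using src.inv_in[OF vimageD[OF finv_in[OF qW]]] by (simp add: \<zeta>_def)
  moreover have "H (Im \<zeta>) = y'"
    using chart_f[OF finv_in[OF qW]] f_finv[OF qW] q tgt.inv_map[OF R] by (simp add: \<zeta>_def)
  ultimately show ?thesis using that[of "Im \<zeta>"] by (auto simp: rect_def)
qed

lemma H_has_derivative:
  assumes "0 < y" "y < b"
  obtains H' where "(H has_real_derivative H') (at y)"
proof -
  have y_in: "y \<in> {0<..<b}" "\<And>s. s \<in> {0<..<b} \<Longrightarrow> 0 < s \<and> s < b"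
    using assms by auto
  show ?thesis
    using f_along_path[OF open_greaterThanLessThan y_in DERIV_ident DERIV_const[of 0]] that
    unfolding H_def[abs_def] by blast
qed

text \<open>At a point of the fibre over the image of \<open>\<zeta>\<close>, the horizontal differential of the map in the
  charts is $w \mapsto \alpha w + \beta \bar w$ with \<open>\<alpha> + \<beta> = k\<close> and \<open>\<alpha> - \<beta> = H'\<close>.\<close>

lemma H_derivative_identity:
  assumes \<zeta>: "\<zeta> \<in> rect a b" and H': "(H has_real_derivative H') (at (Im \<zeta>))"
  shows "\<exists>p\<in>W. \<exists>t>0. \<bar>k + H'\<bar> / 2 = t * cmod (A p) \<and> \<bar>k - H'\<bar> / 2 = t * cmod (B p) \<and> t * (cmod (A p) - cmod (B p)) = k"
proof -
  define p where "p = hsection (\<phi> \<zeta>)"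
  have hp: "hproj p = \<phi> \<zeta>"
    unfolding p_def using src.map_in[OF \<zeta>] src.sub by (intro hproj_hsection) auto
  then have p: "p \<in> W" using \<zeta> by simp
  have fp: "f p \<in> W'" using f_in[OF p] .
  \<comment> \<open>\<open>c\<close> and \<open>c'\<close> are the complex factors by which the
    projections into the two rectangles act on horizontal vectors.\<close>
  define c where "c = 2 * \<i> * cnj (fst p) * inverse (deriv \<phi> \<zeta>)"
  define c' where "c' = 2 * \<i> * cnj (fst (f p)) * inverse (deriv \<psi> (tgt.\<Phi> (hproj (f p))))"
  have c_nz: "c \<noteq> 0" using src.fst_nonzero[of p] src.deriv_nonzero[OF \<zeta>] p by (simp add: c_def)
  define DV where "DV v = inverse (deriv \<phi> \<zeta>) * Complex (snd v) (2 * Re (cnj (fst p) * fst v))" for v :: heis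
  have V: "((\<lambda>p. src.\<Phi> (hproj p)) has_derivative DV) (at p)"
    using diff_chain_at[OF hproj_has_derivative src.has_deriv_inv[OF vimageD[OF p], unfolded has_field_derivative_def]]
    by (simp only: DV_def[abs_def] o_def hp src.inv_map[OF \<zeta>])
  have "((\<lambda>p. hproj (f p)) has_derivative (\<lambda>v. Complex (snd (Df p v)) (2 * Re (cnj (fst (f p)) * fst (Df p v))))) (at p)"
    using diff_chain_at[OF has_derivative_f[OF p] hproj_has_derivative] by (simp add: o_def)
  from diff_chain_at[OF this tgt.has_deriv_inv[OF vimageD[OF fp], unfolded has_field_derivative_def]]
  have U: "((\<lambda>p. tgt.\<Phi> (hproj (f p))) has_derivative (\<lambda>v. inverse (deriv \<psi> (tgt.\<Phi> (hproj (f p)))) *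
      Complex (snd (Df p v)) (2 * Re (cnj (fst (f p)) * fst (Df p v))))) (at p)"
    by (simp add: o_def)
  have HV: "((\<lambda>p. H (Im (src.\<Phi> (hproj p)))) has_derivative (\<lambda>v. H' * Im (DV v))) (at p)"
  proof -
    have "((\<lambda>p. Im (src.\<Phi> (hproj p))) has_derivative (\<lambda>v. Im (DV v))) (at p)"
      using has_derivative_Im[OF V] .
    moreover have "Im (src.\<Phi> (hproj p)) = Im \<zeta>" using hp src.inv_map[OF \<zeta>] by simp
    ultimately show ?thesis
      using diff_chain_at[of _ _ p H "(*) H'"] H' by (simp add: has_field_derivative_def o_def)
  qed
  have "((\<lambda>p. of_real (k * Re (src.\<Phi> (hproj p))) + \<i> * of_real (H (Im (src.\<Phi> (hproj p))))) has_derivative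
      (\<lambda>v. of_real (k * Re (DV v)) + \<i> * of_real (H' * Im (DV v)))) (at p)"
    by (intro has_derivative_add has_derivative_mult_right has_derivative_of_real has_derivative_Re V HV)
  then have "((\<lambda>p. tgt.\<Phi> (hproj (f p))) has_derivative (\<lambda>v. of_real (k * Re (DV v)) + \<i> * of_real (H' * Im (DV v)))) (at p)"
    by (rule has_derivative_transform_within_open[OF _ src.open_lift p]) (simp add: chart_f Complex_eq)
  from has_derivative_unique[OF U this]
  have "inverse (deriv \<psi> (tgt.\<Phi> (hproj (f p)))) * Complex (snd (Df p v)) (2 * Re (cnj (fst (f p)) * fst (Df p v))) =
      of_real (k * Re (DV v)) + \<i> * of_real (H' * Im (DV v))" for v
    by metis
  from this[of "hor p _"] have id: "c' * (A p * w + B p * cnj w) = of_real (k * Re (c * w)) + \<i> * of_real (H' * Im (c * w))" for w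
    unfolding Df_hor[OF p] hproj_derivative_hor DV_def by (simp only: c_def c'_def mult_ac)
  define \<alpha> where "\<alpha> = c' * A p / c"
  define \<beta> where "\<beta> = c' * B p / cnj c"
  have "\<alpha> + \<beta> = of_real k"
    using id[of "1 / c"] c_nz by (simp add: \<alpha>_def \<beta>_def field_simps)
  moreover have "\<alpha> - \<beta> = of_real H'"
  proof -
    have "\<i> * (\<alpha> - \<beta>) = c' * (A p * (\<i> / c) + B p * cnj (\<i> / c))"
      using c_nz by (simp add: \<alpha>_def \<beta>_def field_simps)
    also have "\<dots> = \<i> * of_real H'"
      unfolding id using c_nz by simp
    finally show ?thesis by simp
  qed
  ultimately have "\<alpha> = of_real ((k + H') / 2)" "\<beta> = of_real ((k - H') / 2)"
    by (simp_all add: complex_eq_iff)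
  then have "cmod \<alpha> = \<bar>k + H'\<bar> / 2" "cmod \<beta> = \<bar>k - H'\<bar> / 2"
    by (simp_all only: norm_of_real) auto
  \<comment> \<open>The common factor between the chart differential and the pair \<open>A\<close>,
    \<open>B\<close>; the identity of densities normalises it below.\<close>
  moreover define t where "t = cmod c' / cmod c"
  have "cmod \<alpha> = t * cmod (A p)" "cmod \<beta> = t * cmod (B p)"
    by (simp_all add: \<alpha>_def \<beta>_def t_def norm_mult norm_divide)
  moreover have c'_nz: "c' \<noteq> 0"
    using tgt.fst_nonzero[OF vimageD[OF fp]] tgt.deriv_nonzero[OF tgt.inv_in[OF vimageD[OF fp]]] by (simp add: c'_def)
  then have "0 < t" using c_nz by (simp add: t_def)
  moreover have "t * (cmod (A p) - cmod (B p)) = k"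
  proof -
    have "cmod c = a * src.dens p" "cmod c' = a' * tgt.dens (f p)"
      using src.a_pos tgt.a_pos hp src.inv_map[OF \<zeta>]
      by (auto simp: c_def c'_def src.dens_def tgt.dens_def norm_mult norm_inverse divide_inverse)
    then have "cmod c' * (cmod (A p) - cmod (B p)) = k * cmod c"
      using push[OF p] src.a_pos by (simp add: k_def)
    then show ?thesis using c_nz by (simp add: t_def field_simps)
  qed
  ultimately show ?thesis using p by metis
qed

text \<open>The identity of densities reads \<open>|k + H'| - |k - H'| = 2 * k\<close>, which forces
  \<open>k \<le> H'\<close>. The Beltrami bound \<open>H' - k \<le> q * (H' + k)\<close> then gives
  \<open>K = (1 + q) / (1 - q)\<close>.\<close>

lemma H_derivative_bounds:
  obtains K where "1 \<le> K"
    "\<And>y. 0 < y \<Longrightarrow> y < b \<Longrightarrow> \<exists>H'. (H has_real_derivative H') (at y) \<and> k \<le> H' \<and> H' \<le> K * k"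
proof -
  obtain q where q: "0 \<le> q" "q < 1" "\<And>p. p \<in> W \<Longrightarrow> cmod (B p) \<le> q * cmod (A p)"
    using beltrami by blast
  define K where "K = (1 + q) / (1 - q)"
  have K: "1 \<le> K" using q by (simp add: K_def field_simps)
  have "\<exists>H'. (H has_real_derivative H') (at y) \<and> k \<le> H' \<and> H' \<le> K * k" if y: "0 < y" "y < b" for y
  proof -
    obtain H' where H': "(H has_real_derivative H') (at y)" using H_has_derivative[OF y] by blast
    have R: "Complex (a / 2) y \<in> rect a b" using y src.a_pos by simp
    from H_derivative_identity[OF R, unfolded complex.sel, OF H']
    obtain p t where p: "p \<in> W" "0 < t" "\<bar>k + H'\<bar> / 2 = t * cmod (A p)" "\<bar>k - H'\<bar> / 2 = t * cmod (B p)"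
      "t * (cmod (A p) - cmod (B p)) = k" by blast
    have "\<bar>k + H'\<bar> - \<bar>k - H'\<bar> = 2 * k"
      using p(3-5) by (simp add: algebra_simps)
    then have ge: "k \<le> H'" using k_pos by linarith
    have "t * cmod (B p) \<le> t * (q * cmod (A p))"
      using q(3)[OF p(1)] p(2) by simp
    then have "\<bar>k - H'\<bar> \<le> q * \<bar>k + H'\<bar>"
      using p(3,4) by (simp add: mult.left_commute[of t q])
    then have "(1 - q) * H' \<le> (1 + q) * k"
      using ge k_pos by (simp add: algebra_simps)
    then have "H' \<le> K * k"
      using q by (simp add: K_def field_simps)
    with H' ge show ?thesis by blast
  qed
  with K that show ?thesis by blast
qed

lemma H_strict_mono:
  assumes "0 < y1" "y1 < y2" "y2 < b"
  shows "H y1 < H y2"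
proof -
  obtain K where K: "\<And>y. 0 < y \<Longrightarrow> y < b \<Longrightarrow> \<exists>H'. (H has_real_derivative H') (at y) \<and> k \<le> H' \<and> H' \<le> K * k"
    using H_derivative_bounds by blast
  show ?thesis
  proof (rule DERIV_pos_imp_increasing[OF assms(2)])
    fix y assume "y1 \<le> y" "y \<le> y2"
    then show "\<exists>D. (H has_real_derivative D) (at y) \<and> 0 < D"
      using K[of y] assms k_pos by fastforce
  qed
qed

text \<open>Any increasing continuation with the right end values would serve. It makes
  \<open>H\<close> part of a strictly increasing bijection of the line, which is automatically
  continuous, so the limits of \<open>H\<close> at \<open>0\<close> and \<open>b\<close> need no
  separate argument.\<close>

definition H_ext :: "real \<Rightarrow> real" where
  "H_ext y = (if y \<le> 0 then y else if y < b then H y else y - b + b')"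

lemma H_ext_eq: "0 < y \<Longrightarrow> y < b \<Longrightarrow> H_ext y = H y"
  by (simp add: H_ext_def)

lemma H_ext_strict_mono: "y1 < y2 \<Longrightarrow> H_ext y1 < H_ext y2"
  using H_strict_mono[of y1 y2] H_in[of y1] H_in[of y2] tgt.b_pos src.b_pos
  by (auto simp: H_ext_def)

lemma H_ext_surj: "\<exists>y. H_ext y = y'"
proof -
  consider "y' \<le> 0" | "0 < y'" "y' < b'" | "b' \<le> y'" by linarith
  then show ?thesis
  proof cases
    case 1
    then show ?thesis by (intro exI[of _ y']) (simp add: H_ext_def)
  next
    case 2
    then show ?thesis using H_surj H_ext_eq by metis
  next
    case 3
    then show ?thesis using src.b_pos by (intro exI[of _ "y' - b' + b"]) (simp add: H_ext_def)
  qed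
qed

lemma continuous_H_ext: "continuous_on S H_ext"
proof -
  have "range H_ext = UNIV" using H_ext_surj by (metis surj_def)
  then have "continuous_on UNIV H_ext"
    using H_ext_strict_mono by (intro continuous_onI_mono) (auto simp: less_eq_real_def)
  then show ?thesis using continuous_on_subset by blast
qed

lemma H_ext_le_iff: "H_ext y1 \<le> H_ext y2 \<longleftrightarrow> y1 \<le> y2"
  by (cases y1 y2 rule: linorder_cases) (auto dest: H_ext_strict_mono)

lemma H_ext_ends: "H_ext 0 = 0" "H_ext b = b'"
  using src.b_pos by (auto simp: H_ext_def)

definition S :: "complex \<Rightarrow> complex" where
  "S \<zeta> = Complex (k * Re \<zeta>) (H_ext (Im \<zeta>))"

text \<open>The sides and the closed rectangle are all cut out by conditions on the two coordinates,
  so one statement serves for all their images.\<close>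

lemma S_image:
  assumes "\<And>x y. P x y \<longleftrightarrow> P' (k * x) (H_ext y)"
  shows "S ` {\<zeta>. P (Re \<zeta>) (Im \<zeta>)} = {\<zeta>. P' (Re \<zeta>) (Im \<zeta>)}"
proof (intro set_eqI iffI)
  fix \<xi> assume \<xi>: "\<xi> \<in> {\<zeta>. P' (Re \<zeta>) (Im \<zeta>)}"
  obtain y where "H_ext y = Im \<xi>" using H_ext_surj by blast
  then have "\<xi> = S (Complex (Re \<xi> / k) y)" "P (Re \<xi> / k) y"
    using k_pos \<xi> assms by (auto simp: S_def complex_eq_iff)
  then show "\<xi> \<in> S ` {\<zeta>. P (Re \<zeta>) (Im \<zeta>)}" by (auto intro!: image_eqI)
qed (use assms in \<open>auto simp: S_def\<close>)

lemma k_scale: "0 \<le> k * x \<longleftrightarrow> 0 \<le> x" "k * x \<le> a' \<longleftrightarrow> x \<le> a" "k * x = 0 \<longleftrightarrow> x = 0" "k * x = a' \<longleftrightarrow> x = a"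
  using src.a_pos tgt.a_pos by (auto simp: k_def field_simps zero_le_mult_iff)

lemma H_scale: "0 \<le> H_ext y \<longleftrightarrow> 0 \<le> y" "H_ext y \<le> b' \<longleftrightarrow> y \<le> b" "H_ext y = 0 \<longleftrightarrow> y = 0" "H_ext y = b' \<longleftrightarrow> y = b"
  using H_ext_le_iff[of 0 y] H_ext_le_iff[of y b] H_ext_le_iff[of y 0] H_ext_le_iff[of b y] H_ext_ends
  by auto

lemma S_sides:
  "S ` left_side a b = left_side a' b'" "S ` right_side a b = right_side a' b'"
  "S ` bottom_side a b = bottom_side a' b'" "S ` top_side a b = top_side a' b'"
  unfolding left_side_def right_side_def bottom_side_def top_side_def
  using S_image[of "\<lambda>x y. x = 0 \<and> 0 \<le> y \<and> y \<le> b" "\<lambda>x y. x = 0 \<and> 0 \<le> y \<and> y \<le> b'"]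
    S_image[of "\<lambda>x y. x = a \<and> 0 \<le> y \<and> y \<le> b" "\<lambda>x y. x = a' \<and> 0 \<le> y \<and> y \<le> b'"]
    S_image[of "\<lambda>x y. 0 \<le> x \<and> x \<le> a \<and> y = 0" "\<lambda>x y. 0 \<le> x \<and> x \<le> a' \<and> y = 0"]
    S_image[of "\<lambda>x y. 0 \<le> x \<and> x \<le> a \<and> y = b" "\<lambda>x y. 0 \<le> x \<and> x \<le> a' \<and> y = b'"]
  by (simp_all add: k_scale H_scale less_imp_neq[OF k_pos, symmetric])

lemma homeomorphism_S:
  obtains S' where "homeomorphism (cbox 0 (Complex a b)) (cbox 0 (Complex a' b')) S S'"
proof -
  have cb: "cbox 0 (Complex x y) = {\<zeta>. 0 \<le> Re \<zeta> \<and> Re \<zeta> \<le> x \<and> 0 \<le> Im \<zeta> \<and> Im \<zeta> \<le> y}" for x y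
    by (auto simp: in_cbox_complex_iff)
  have "S ` cbox 0 (Complex a b) = cbox 0 (Complex a' b')"
    unfolding cb
    using S_image[of "\<lambda>x y. 0 \<le> x \<and> x \<le> a \<and> 0 \<le> y \<and> y \<le> b" "\<lambda>x y. 0 \<le> x \<and> x \<le> a' \<and> 0 \<le> y \<and> y \<le> b'"]
    by (simp add: k_scale H_scale)
  moreover have "continuous_on (cbox 0 (Complex a b)) S"
    unfolding S_def Complex_eq by (intro continuous_intros continuous_on_compose2[OF continuous_H_ext[of UNIV]]) auto
  moreover have "inj_on S (cbox 0 (Complex a b))"
  proof (rule inj_onI)
    fix \<zeta> \<xi> assume "S \<zeta> = S \<xi>"
    then have "Re \<zeta> = Re \<xi>" "H_ext (Im \<zeta>) = H_ext (Im \<xi>)" using k_pos by (auto simp: S_def)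
    then show "\<zeta> = \<xi>" using H_ext_le_iff by (metis complex_eqI order_antisym order_refl)
  qed
  ultimately show ?thesis
    using homeomorphism_compact[OF compact_cbox] that by metis
qed

lemma S_in: "\<zeta> \<in> rect a b \<Longrightarrow> S \<zeta> \<in> rect a' b'"
  using H_in[of "Im \<zeta>"] kx_in[of "Re \<zeta>"] by (auto simp: S_def rect_def H_ext_eq)

lemma S_has_derivative:
  assumes \<zeta>: "\<zeta> \<in> rect a b" and H': "(H has_real_derivative H') (at (Im \<zeta>))"
  shows "(S has_derivative (\<lambda>u. Complex (k * Re u) (H' * Im u))) (at \<zeta>)"
proof -
  have "((\<lambda>\<zeta>. H (Im \<zeta>)) has_derivative (\<lambda>u. H' * Im u)) (at \<zeta>)"
    using diff_chain_at[OF bounded_linear_imp_has_derivative[OF bounded_linear_Im] H'[unfolded has_field_derivative_def]]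
    by (simp add: o_def)
  then have "((\<lambda>\<zeta>. of_real (k * Re \<zeta>) + \<i> * of_real (H (Im \<zeta>))) has_derivative (\<lambda>u. of_real (k * Re u) + \<i> * of_real (H' * Im u))) (at \<zeta>)"
    by (intro has_derivative_add has_derivative_mult_right has_derivative_of_real has_derivative_Re has_derivative_ident)
  then show ?thesis
    unfolding Complex_eq
    by (rule has_derivative_transform_within_open[OF _ open_rect \<zeta>])
      (auto simp: S_def rect_def H_ext_eq Complex_eq)
qed

section \<open>Descent to the half-plane\<close>

definition g :: "complex \<Rightarrow> complex" where
  "g w = hproj (f (hsection w))"

lemma hsection_in: "w \<in> \<Omega> \<Longrightarrow> hsection w \<in> W"
  using src.sub by (auto simp: hproj_hsection)

lemma g_eq:
  assumes "w \<in> \<Omega>"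
  shows "g w = \<psi> (S (src.\<Phi> w))"
proof -
  have p: "hsection w \<in> W" "hproj (hsection w) = w"
    using hsection_in[OF assms] assms src.sub by (auto intro: hproj_hsection)
  have "tgt.\<Phi> (g w) = S (src.\<Phi> w)"
    using chart_f[OF p(1)] src.inv_in[OF assms] by (simp add: g_def p S_def rect_def H_ext_eq)
  then show ?thesis
    using tgt.map_inv[OF vimageD[OF f_in[OF p(1)]]] by (simp add: g_def)
qed

lemma hproj_f: "p \<in> W \<Longrightarrow> hproj (f p) = g (hproj p)"
proof -
  assume p: "p \<in> W"
  then have w: "hproj p \<in> \<Omega>" by simp
  have "tgt.\<Phi> (hproj (f p)) = S (src.\<Phi> (hproj p))"
    using chart_f[OF p] src.inv_in[OF w] by (simp add: S_def rect_def H_ext_eq)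
  then show ?thesis
    using tgt.map_inv[OF vimageD[OF f_in[OF p]]] g_eq[OF w] by simp
qed

lemma g_image: "g ` \<Omega> = \<Omega>'"
proof (intro set_eqI iffI)
  fix w assume w: "w \<in> \<Omega>'"
  define q where "q = hsection w"
  have q: "hproj q = w" "q \<in> W'" using w tgt.sub by (auto simp: q_def hproj_hsection subset_iff)
  have "w = g (hproj (finv q))"
    using hproj_f[OF finv_in[OF q(2)]] f_finv[OF q(2)] q by simp
  then show "w \<in> g ` \<Omega>" using finv_in[OF q(2)] by auto
qed (use f_in[OF hsection_in] in \<open>auto simp: g_def\<close>)

text \<open>The definition through \<open>hsection\<close> inherits the regularity of
  \<open>f\<close>; the formula in \<open>g_eq\<close> involves \<open>H\<close>, of which only
  first derivatives have been obtained.\<close>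

lemma C2_g: "C2_on g \<Omega>"
proof -
  have "C2_on (hproj \<circ> (f \<circ> hsection)) \<Omega>"
    by (rule C2_on_compose[OF C2_on_compose[OF C2_on_subset[OF C2_on_hsection src.sub] qc(2)] C2_on_hproj[of UNIV]])
      (use hsection_in in auto)
  then show ?thesis by (simp add: g_def[abs_def] o_def)
qed

lemma g_has_derivative:
  assumes w: "w \<in> \<Omega>" and H': "(H has_real_derivative H') (at (Im (src.\<Phi> w)))"
  shows "(g has_derivative (\<lambda>v. deriv \<psi> (S (src.\<Phi> w)) *
    Complex (k * Re (v / deriv \<phi> (src.\<Phi> w))) (H' * Im (v / deriv \<phi> (src.\<Phi> w))))) (at w)"
proof -
  have \<zeta>: "src.\<Phi> w \<in> rect a b" using w by simp
  have "(S \<circ> src.\<Phi> has_derivative (\<lambda>u. Complex (k * Re u) (H' * Im u)) \<circ> (*) (inverse (deriv \<phi> (src.\<Phi> w)))) (at w)"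
    using diff_chain_at[OF src.has_deriv_inv[OF w, unfolded has_field_derivative_def] S_has_derivative[OF \<zeta> H']] .
  from diff_chain_at[OF this] tgt.has_deriv[OF S_in[OF \<zeta>]]
  have "(\<psi> \<circ> (S \<circ> src.\<Phi>) has_derivative (*) (deriv \<psi> (S (src.\<Phi> w))) \<circ>
      ((\<lambda>u. Complex (k * Re u) (H' * Im u)) \<circ> (*) (inverse (deriv \<phi> (src.\<Phi> w))))) (at w)"
    by (simp add: has_field_derivative_def)
  then have "((\<lambda>w. \<psi> (S (src.\<Phi> w))) has_derivative (\<lambda>v. deriv \<psi> (S (src.\<Phi> w)) *
    Complex (k * Re (v / deriv \<phi> (src.\<Phi> w))) (H' * Im (v / deriv \<phi> (src.\<Phi> w))))) (at w)"
    by (simp add: o_def divide_inverse mult.commute)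
  then show ?thesis
    by (rule has_derivative_transform_within_open[OF _ src.open_\<Omega> w]) (simp add: g_eq)
qed

text \<open>The smaller singular value of the differential of \<open>g\<close>: it is
  \<open>k\<close> in the charts, because \<open>k \<le> H'\<close>, and gets multiplied by the
  conformal factors.\<close>

definition stretch :: "complex \<Rightarrow> real" where
  "stretch w = k * cmod (deriv \<psi> (S (src.\<Phi> w))) / cmod (deriv \<phi> (src.\<Phi> w))"

lemma stretch_pos:
  assumes "w \<in> \<Omega>"
  shows "0 < stretch w"
proof -
  have "src.\<Phi> w \<in> rect a b" using assms by simp
  then show ?thesis
    using tgt.deriv_nonzero[OF S_in] src.deriv_nonzero k_pos by (simp add: stretch_def)
qed

text \<open>In the charts the differential is diagonal with entries \<open>k \<le> H'\<close>. Up to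
  a common conformal factor its Wirtinger derivatives therefore have moduli
  \<open>(H' + k) / 2\<close> and \<open>(H' - k) / 2\<close>.\<close>

lemma g_local:
  assumes w: "w \<in> \<Omega>" and K: "1 \<le> K"
    and H': "(H has_real_derivative H') (at (Im (src.\<Phi> w)))" "k \<le> H'" "H' \<le> K * k"
  shows "\<exists>D. (g has_derivative D) (at w) \<and>
      (\<forall>v. stretch w * cmod v \<le> cmod (D v) \<and> cmod (D v) \<le> K * stretch w * cmod v)"
    and "cmod (Wirt g w) - cmod (Wirt_bar g w) = stretch w"
    and "(K + 1) * cmod (Wirt_bar g w) \<le> (K - 1) * cmod (Wirt g w)"
proof -
  define \<zeta> where "\<zeta> = src.\<Phi> w"
  have \<zeta>: "\<zeta> \<in> rect a b" using w by (simp add: \<zeta>_def)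
  define P where "P = deriv \<psi> (S \<zeta>)"
  define F where "F = deriv \<phi> \<zeta>"
  have nz: "P \<noteq> 0" "F \<noteq> 0"
    using tgt.deriv_nonzero[OF S_in[OF \<zeta>]] src.deriv_nonzero[OF \<zeta>] by (auto simp: P_def F_def)
  define D where "D v = P * Complex (k * Re (v / F)) (H' * Im (v / F))" for v
  have D: "(g has_derivative D) (at w)"
    using g_has_derivative[OF w H'(1)] by (simp add: D_def[abs_def] P_def F_def \<zeta>_def)
  define l where l_def0: "l = stretch w"
  have l_def: "l = k * cmod P / cmod F" by (simp add: l_def0 stretch_def P_def F_def \<zeta>_def)
  have S_bounds: "k * cmod u \<le> cmod (Complex (k * Re u) (H' * Im u))"
    "cmod (Complex (k * Re u) (H' * Im u)) \<le> K * k * cmod u" for u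
  proof -
    have "(k * Re u)\<^sup>2 + (k * Im u)\<^sup>2 \<le> (k * Re u)\<^sup>2 + (H' * Im u)\<^sup>2"
      using H'(2) k_pos by (simp add: power_mult_distrib mult_right_mono power_mono)
    then have "(k * cmod u)\<^sup>2 \<le> (cmod (Complex (k * Re u) (H' * Im u)))\<^sup>2"
      by (simp add: cmod_power2 power_mult_distrib distrib_left)
    then show "k * cmod u \<le> cmod (Complex (k * Re u) (H' * Im u))"
      by (rule power2_le_imp_le) simp
    have "k \<le> K * k" using K k_pos by simp
    then have "k\<^sup>2 \<le> (K * k)\<^sup>2" "H'\<^sup>2 \<le> (K * k)\<^sup>2"
      using H'(2,3) k_pos by (auto intro!: power_mono)
    then have "(k * Re u)\<^sup>2 + (H' * Im u)\<^sup>2 \<le> (K * k)\<^sup>2 * (Re u)\<^sup>2 + (K * k)\<^sup>2 * (Im u)\<^sup>2"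
      unfolding power_mult_distrib[of k] power_mult_distrib[of H'] by (intro add_mono mult_right_mono) auto
    then have "(cmod (Complex (k * Re u) (H' * Im u)))\<^sup>2 \<le> (K * k * cmod u)\<^sup>2"
      by (simp add: cmod_power2 power_mult_distrib[of "K * k" "cmod u"] distrib_left)
    then show "cmod (Complex (k * Re u) (H' * Im u)) \<le> K * k * cmod u"
      by (rule power2_le_imp_le) (use K k_pos in simp)
  qed
  have bounds: "l * cmod v \<le> cmod (D v)" "cmod (D v) \<le> K * l * cmod v" for v
  proof -
    have e: "l * cmod v = cmod P * (k * cmod (v / F))" "K * l * cmod v = cmod P * (K * k * cmod (v / F))"
      by (simp_all add: l_def norm_divide)
    show "l * cmod v \<le> cmod (D v)" "cmod (D v) \<le> K * l * cmod v"
      unfolding D_def norm_mult[of P] e by (intro mult_left_mono S_bounds norm_ge_zero)+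
  qed
  have fd: "frechet_derivative g (at w) = D"
    using frechet_derivative_at[OF D] by simp
  have D_eq: "D v = P * (of_real ((k + H') / 2) * (v / F) + of_real ((k - H') / 2) * (cnj v / cnj F))" for v
  proof -
    have "Complex (k * Re u) (H' * Im u) = of_real ((k + H') / 2) * u + of_real ((k - H') / 2) * cnj u" for u
      by (simp add: complex_eq_iff field_simps)
    then show ?thesis unfolding D_def by (simp only: complex_cnj_divide)
  qed
  have Wirt: "Wirt g w = P * of_real ((k + H') / 2) / F" "Wirt_bar g w = P * of_real ((k - H') / 2) / cnj F"
    unfolding Wirt_def Wirt_bar_def Let_def fd D_eq using nz by (simp_all add: field_simps)
  have Wn: "cmod (Wirt g w) = cmod P / cmod F * ((H' + k) / 2)" "cmod (Wirt_bar g w) = cmod P / cmod F * ((H' - k) / 2)"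
    unfolding Wirt norm_divide norm_mult norm_of_real using H'(2) k_pos by (auto simp: ac_simps)
  show "cmod (Wirt g w) - cmod (Wirt_bar g w) = stretch w"
    unfolding l_def0[symmetric] Wn l_def by (simp add: algebra_simps add_divide_distrib diff_divide_distrib)
  show "(K + 1) * cmod (Wirt_bar g w) \<le> (K - 1) * cmod (Wirt g w)"
  proof -
    have "(K + 1) * (H' - k) \<le> (K - 1) * (H' + k)"
      using H'(3) by (simp add: algebra_simps)
    then have "cmod P / cmod F / 2 * ((K + 1) * (H' - k)) \<le> cmod P / cmod F / 2 * ((K - 1) * (H' + k))"
      by (rule mult_left_mono) simp
    then show ?thesis unfolding Wn by (simp add: mult_ac)
  qed
  show "\<exists>D. (g has_derivative D) (at w) \<and>
      (\<forall>v. stretch w * cmod v \<le> cmod (D v) \<and> cmod (D v) \<le> K * stretch w * cmod v)"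
    unfolding l_def0[symmetric] using D bounds by blast
qed

lemma H_derivative_at:
  obtains K where "1 \<le> K"
    "\<And>w. w \<in> \<Omega> \<Longrightarrow> \<exists>H'. (H has_real_derivative H') (at (Im (src.\<Phi> w))) \<and> k \<le> H' \<and> H' \<le> K * k"
proof -
  have "0 < Im (src.\<Phi> w)" "Im (src.\<Phi> w) < b" if "w \<in> \<Omega>" for w
    using src.inv_in[OF that] by (auto simp: rect_def)
  then show ?thesis using that H_derivative_bounds by metis
qed

text \<open>Each of \<psi>, \<open>S\<close> and the inverse of \<phi> is a homeomorphism on closed
  sets, so their composition is the extension.\<close>

lemma g_extension:
  "\<exists>G h. homeomorphism (closure \<Omega>) (closure \<Omega>') G h \<and> (\<forall>w\<in>\<Omega>. G w = g w) \<and>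
    G ` (\<phi> ` left_side a b) = \<psi> ` left_side a' b' \<and>
    G ` (\<phi> ` right_side a b) = \<psi> ` right_side a' b' \<and>
    G ` (\<phi> ` bottom_side a b) = \<psi> ` bottom_side a' b' \<and>
    G ` (\<phi> ` top_side a b) = \<psi> ` top_side a' b'"
proof -
  obtain h1 where h1: "homeomorphism (cbox 0 (Complex a b)) (closure \<Omega>) \<phi> h1" using src.homeo by blast
  obtain h2 where h2: "homeomorphism (cbox 0 (Complex a' b')) (closure \<Omega>') \<psi> h2" using tgt.homeo by blast
  obtain S' where S': "homeomorphism (cbox 0 (Complex a b)) (cbox 0 (Complex a' b')) S S'" using homeomorphism_S by blast
  define G where "G = \<psi> \<circ> (S \<circ> h1)"
  have homeo: "homeomorphism (closure \<Omega>) (closure \<Omega>') G ((\<phi> \<circ> S') \<circ> h2)"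
    unfolding G_def
    by (rule homeomorphism_compose[OF homeomorphism_compose[OF homeomorphism_symD[OF h1] S'] h2])
  have G: "G (\<phi> \<zeta>) = \<psi> (S \<zeta>)" if "\<zeta> \<in> cbox 0 (Complex a b)" for \<zeta>
    using homeomorphism_apply1[OF h1 that] by (simp add: G_def)
  have G_eq: "G w = g w" if "w \<in> \<Omega>" for w
  proof -
    have "src.\<Phi> w \<in> cbox 0 (Complex a b)"
      using src.inv_in[OF that] box_subset_cbox unfolding rect_eq_box by blast
    then show ?thesis using G[of "src.\<Phi> w"] g_eq[OF that] src.map_inv[OF that] by simp
  qed
  have G_image: "G ` (\<phi> ` X) = \<psi> ` (S ` X)" if "X \<subseteq> cbox 0 (Complex a b)" for X
    unfolding image_image using G that by (intro image_cong) auto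
  have sides: "G ` (\<phi> ` left_side a b) = \<psi> ` left_side a' b'" "G ` (\<phi> ` right_side a b) = \<psi> ` right_side a' b'"
    "G ` (\<phi> ` bottom_side a b) = \<psi> ` bottom_side a' b'" "G ` (\<phi> ` top_side a b) = \<psi> ` top_side a' b'"
    using src.sides_subset by (simp_all add: G_image S_sides)
  show ?thesis
    by (rule exI[of _ G], rule exI[of _ "(\<phi> \<circ> S') \<circ> h2"]) (intro conjI ballI homeo G_eq sides)
qed

lemma quasiconformal_g: "quasiconformal_C g \<Omega> \<Omega>'"
proof -
  obtain K where K: "1 \<le> K"
    "\<And>w. w \<in> \<Omega> \<Longrightarrow> \<exists>H'. (H has_real_derivative H') (at (Im (src.\<Phi> w))) \<and> k \<le> H' \<and> H' \<le> K * k"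
    using H_derivative_at by blast
  have loc: "\<exists>D. (g has_derivative D) (at w) \<and>
      (\<forall>v. stretch w * cmod v \<le> cmod (D v) \<and> cmod (D v) \<le> K * stretch w * cmod v)"
    "cmod (Wirt g w) - cmod (Wirt_bar g w) = stretch w"
    "(K + 1) * cmod (Wirt_bar g w) \<le> (K - 1) * cmod (Wirt g w)" if "w \<in> \<Omega>" for w
    using K(2)[OF that] g_local[OF that K(1)] by blast+
  obtain G G' where G: "homeomorphism (closure \<Omega>) (closure \<Omega>') G G'" "\<forall>w\<in>\<Omega>. G w = g w"
    "G ` (\<phi> ` left_side a b) = \<psi> ` left_side a' b'" "G ` (\<phi> ` right_side a b) = \<psi> ` right_side a' b'"
    "G ` (\<phi> ` bottom_side a b) = \<psi> ` bottom_side a' b'" "G ` (\<phi> ` top_side a b) = \<psi> ` top_side a' b'"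
    using g_extension by (elim exE conjE)
  have "homeomorphism \<Omega> \<Omega>' G G'"
    using homeomorphism_of_subsets[OF G(1) closure_subset, of \<Omega>'] closure_subset[of \<Omega>'] g_image G(2) by (metis image_cong)
  then have "homeomorphism \<Omega> \<Omega>' g G'"
    by (rule homeomorphism_cong) (use G(2) in auto)
  moreover have "dilatation dist \<Omega> g w \<le> ennreal (2 * K + 1)" if "w \<in> \<Omega>" for w
    using loc(1)[OF that] dilatation_le[OF _ stretch_pos[OF that]] by blast
  moreover have "orientation_preserving_C g \<Omega>"
  proof -
    define \<mu> where "\<mu> w = Wirt_bar g w / Wirt g w" for w
    have nz: "Wirt g w \<noteq> 0" if "w \<in> \<Omega>" for w
    proof -
      have "0 < cmod (Wirt g w)"
        using loc(2)[OF that] stretch_pos[OF that] norm_ge_zero[of "Wirt_bar g w"] by linarith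
      then show ?thesis by auto
    qed
    have "continuous_on \<Omega> \<mu>"
      unfolding \<mu>_def Wirt_def Wirt_bar_def Let_def
      by (intro continuous_intros C2_on_imp_continuous_frechet_derivative[OF C2_g])
        (use nz in \<open>auto simp: Wirt_def Let_def\<close>)
    then have "\<mu> \<in> borel_measurable (lebesgue_on \<Omega>)"
      using src.open_\<Omega> by (intro continuous_imp_measurable_on_sets_lebesgue) auto
    moreover have "cmod (\<mu> w) \<le> (K - 1) / (K + 1)" if "w \<in> \<Omega>" for w
      using K(1) loc(3)[OF that] nz[OF that] by (auto simp: \<mu>_def norm_divide field_simps)
    then have "AE w in lebesgue_on \<Omega>. cmod (\<mu> w) \<le> (K - 1) / (K + 1)"
      by (intro AE_I2) simp
    moreover have "(K - 1) / (K + 1) < 1" using K(1) by simp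
    moreover have "AE w in lebesgue_on \<Omega>. Wirt_bar g w = \<mu> w * Wirt g w"
      using nz by (intro AE_I2) (simp add: \<mu>_def)
    ultimately show ?thesis
      unfolding orientation_preserving_C_def beltrami_coeff_def by blast
  qed
  ultimately show ?thesis
    using C2_g src.domain tgt.domain unfolding quasiconformal_C_def metric_qc_def by blast
qed

text \<open>The push-forward divides by the smallest stretch, which in the charts is
  \<open>k = a' / a\<close> whatever \<open>H'\<close> is; so the constant density
  \<open>1 / a\<close> becomes \<open>1 / a'\<close>.\<close>

lemma pushforward_g:
  assumes w: "w \<in> \<Omega>'"
  shows "pushforward_C g \<Omega> (rect_density \<phi> a b) w = rect_density \<psi> a' b' w"
proof -
  define v where "v = inv_into \<Omega> g w"
  have v: "v \<in> \<Omega>" "g v = w"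
    using w g_image unfolding v_def by (auto intro: inv_into_into f_inv_into_f)
  define P where "P = cmod (deriv \<psi> (S (src.\<Phi> v)))"
  define F where "F = cmod (deriv \<phi> (src.\<Phi> v))"
  have \<zeta>: "src.\<Phi> v \<in> rect a b" using v by simp
  have pos: "0 < P" "0 < F"
    using tgt.deriv_nonzero[OF S_in[OF \<zeta>]] src.deriv_nonzero[OF \<zeta>] by (auto simp: P_def F_def)
  have l: "cmod (Wirt g v) - cmod (Wirt_bar g v) = k * P / F"
    using H_derivative_at g_local(2)[OF v(1)] v(1) unfolding stretch_def P_def F_def by metis
  have "tgt.\<Phi> w = S (src.\<Phi> v)"
    using g_eq[OF v(1)] v(2) tgt.inv_map[OF S_in[OF \<zeta>]] by simp
  then have "rect_density \<psi> a' b' w = ennreal (1 / (a' * P))"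
    using tgt.rect_density_eq[OF w] by (simp add: P_def)
  moreover have "pushforward_C g \<Omega> (rect_density \<phi> a b) w = ennreal (1 / (a * F)) / ennreal (k * P / F)"
    using src.rect_density_eq[OF v(1)] by (simp add: pushforward_C_def Let_def v_def[symmetric] l F_def)
  moreover have "\<dots> = ennreal (1 / (a * F) / (k * P / F))"
    using pos k_pos src.a_pos by (intro divide_ennreal) auto
  moreover have "1 / (a * F) / (k * P / F) = 1 / (a' * P)"
    using pos src.a_pos tgt.a_pos by (simp add: k_def field_simps)
  ultimately show ?thesis by simp
qed

end

theorem theorem3p2p4:
  fixes a b a' b' :: real
    and \<phi> \<psi> :: "complex \<Rightarrow> complex"
    and \<Omega> \<Omega>' :: "complex set"
    and f :: "heis \<Rightarrow> heis"
    and \<rho>\<^sub>\<phi> \<rho>\<^sub>\<psi> :: "heis \<Rightarrow> ennreal"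
  assumes "0 < a" "0 < b" "0 < a'" "0 < b'"
    and "rect_chart \<phi> a b \<Omega>"
    and "rect_chart \<psi> a' b' \<Omega>'"
    and "f \<in> qc_class \<phi> a b \<Omega> \<psi> a' b' \<Omega>'"
    and "extremal_density (hproj -` \<Omega>) (lifted_family \<phi> a b) \<rho>\<^sub>\<phi>"
    and "extremal_density (hproj -` \<Omega>') (lifted_family \<psi> a' b') \<rho>\<^sub>\<psi>"
    and "AE q in lebesgue_on (hproj -` \<Omega>'). pushforward_H f (hproj -` \<Omega>) \<rho>\<^sub>\<phi> q = \<rho>\<^sub>\<psi> q"
    and "AE p in lebesgue_on (hproj -` \<Omega>). \<rho>\<^sub>\<phi> p = pullback_hproj (rect_density \<phi> a b) p"
    and "AE q in lebesgue_on (hproj -` \<Omega>'). \<rho>\<^sub>\<psi> q = pullback_hproj (rect_density \<psi> a' b') q"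
  shows "\<exists>g. quasiconformal_C g \<Omega> \<Omega>' \<and>
           (\<exists>G h. homeomorphism (closure \<Omega>) (closure \<Omega>') G h \<and> (\<forall>w\<in>\<Omega>. G w = g w) \<and>
              G ` (\<phi> ` left_side a b) = \<psi> ` left_side a' b' \<and>
              G ` (\<phi> ` right_side a b) = \<psi> ` right_side a' b' \<and>
              G ` (\<phi> ` bottom_side a b) = \<psi> ` bottom_side a' b' \<and>
              G ` (\<phi> ` top_side a b) = \<psi> ` top_side a' b') \<and>
           (\<forall>p\<in>hproj -` \<Omega>. hproj (f p) = g (hproj p)) \<and>
           (\<forall>w\<in>\<Omega>'. pushforward_C g \<Omega> (rect_density \<phi> a b) w = rect_density \<psi> a' b' w)"
proof -
  interpret src: rectangle_chart \<phi> a b \<Omega>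
    by standard (use assms in auto)
  interpret tgt: rectangle_chart \<psi> a' b' \<Omega>'
    by standard (use assms in auto)
  interpret chart_pair \<phi> a b \<Omega> \<psi> a' b' \<Omega>' f
    by standard (use assms in auto)
  \<comment> \<open>Extremality of the two densities enters through \<open>extremal_J_eq\<close>,
    and the almost-everywhere identities through \<open>pushforward_pointwise\<close>.\<close>
  interpret straight_chart_pair \<phi> a b \<Omega> \<psi> a' b' \<Omega>' f
  proof
    show "src.J \<zeta> = src.J \<xi>" if "\<zeta> \<in> rect a b" "\<xi> \<in> rect a b" "Im \<zeta> = Im \<xi>" for \<zeta> \<xi>
      using src.extremal_J_eq[OF assms(8,11) that(2,1)] that(3) by simp
    show "tgt.J \<zeta> = tgt.J \<xi>" if "\<zeta> \<in> rect a' b'" "\<xi> \<in> rect a' b'" "Im \<zeta> = Im \<xi>" for \<zeta> \<xi>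
      using tgt.extremal_J_eq[OF assms(9,12) that(2,1)] that(3) by simp
    show "src.dens p = (cmod (A p) - cmod (B p)) * tgt.dens (f p)" if "p \<in> W" for p
      using pushforward_pointwise[OF assms(10-12) that] .
  qed
  show ?thesis
    by (rule exI[of _ g], intro conjI ballI g_extension quasiconformal_g hproj_f pushforward_g)
qed

end
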